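(* Let $2<p<\infty$. Almost surely, the following limits exist: $$L_{p,u}(t):=\lim_{n\to\infty}L_{n,p,u}(t)=\lim_{n\to\infty}\mathbb{E}L_{n,p,u}(t)\quad\text{for all }u,t>0,$$ $$L_p(t):=\lim_{n\to\infty}L_{n,p}(t)=\sup_{u>0}L_{p,u}(t)\quad\text{for all }t>0.$$
   Context: $(g_{ij})_{i,j\ge1}$ are i.i.d. standard Gaussian random variables on one probability space, and $G_n=(g_{ij})_{i,j\in[n]}$, $[n]=\{1,\dots,n\}$. For $x\in\mathbb{R}^n$ and $1\le q<\infty$ the normalized norm is $|||x|||_q=\bigl(\frac1n\sum_{i\in[n]}|x_i|^q\bigr)^{1/q}$. For $t>0$ and $u>0$, $$L_{n,p}(t)=\max_{x\in\mathbb{R}^n}\Bigl(\frac{\langle G_nx,x\rangle}{n^{3/2}}-t|||x|||_p^p\Bigr),\qquad L_{n,p,u}(t)=\max_{x\in\mathbb{R}^n:|||x|||_2^2=u}\Bigl(\frac{\langle G_nx,x\rangle}{n^{3/2}}-t|||x|||_p^p\Bigr).$$ "Almost surely ... for all" means that there is one event of probability one on which the convergence holds simultaneously for all values of the parameters $u,t$. *)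

theory Defs
  imports "HOL-Probability.Probability"
begin

(* Since the dimension n varies, R^n is the set of extensional functions on {1..n}. *)
definition euclid :: "nat \<Rightarrow> (nat \<Rightarrow> real) set" where
  "euclid n = {1..n} \<rightarrow>\<^sub>E UNIV"

definition normalized_norm :: "nat \<Rightarrow> real \<Rightarrow> (nat \<Rightarrow> real) \<Rightarrow> real" where
  "normalized_norm n q x = (1 / real n * (\<Sum>i\<in>{1..n}. \<bar>x i\<bar> powr q)) powr (1 / q)"

(* The value of <A x, x>, where only the upper left n by n corner of the infinite array A is used. *)
definition quad_form :: "(nat \<Rightarrow> nat \<Rightarrow> real) \<Rightarrow> nat \<Rightarrow> (nat \<Rightarrow> real) \<Rightarrow> real" where
  "quad_form A n x = (\<Sum>i\<in>{1..n}. (\<Sum>j\<in>{1..n}. A i j * x j) * x i)"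

definition objective :: "(nat \<Rightarrow> nat \<Rightarrow> real) \<Rightarrow> nat \<Rightarrow> real \<Rightarrow> real \<Rightarrow> (nat \<Rightarrow> real) \<Rightarrow> real" where
  "objective A n p t x =
     quad_form A n x / real n powr (3 / 2) - t * normalized_norm n p x powr p"

(* The maximum of f over S, meaningful only if it is attained: a genuine maximum, not a supremum. *)
definition max_over :: "('b \<Rightarrow> real) \<Rightarrow> 'b set \<Rightarrow> real" where
  "max_over f S = (GREATEST v. v \<in> f ` S)"

definition L_max :: "(nat \<Rightarrow> nat \<Rightarrow> real) \<Rightarrow> nat \<Rightarrow> real \<Rightarrow> real \<Rightarrow> real" where
  "L_max A n p t = max_over (objective A n p t) (euclid n)"

definition L_max_sphere :: "(nat \<Rightarrow> nat \<Rightarrow> real) \<Rightarrow> nat \<Rightarrow> real \<Rightarrow> real \<Rightarrow> real \<Rightarrow> real" where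
  "L_max_sphere A n p u t =
     max_over (objective A n p t) {x \<in> euclid n. (normalized_norm n 2 x)\<^sup>2 = u}"

definition iid_std_gaussian_array :: "'a measure \<Rightarrow> (nat \<Rightarrow> nat \<Rightarrow> 'a \<Rightarrow> real) \<Rightarrow> bool" where
  "iid_std_gaussian_array M g \<longleftrightarrow>
     prob_space.indep_vars M (\<lambda>_. borel) (\<lambda>(i, j). g i j) ({1..} \<times> {1..}) \<and>
     (\<forall>i\<ge>1. \<forall>j\<ge>1. distributed M lborel (g i j) std_normal_density)"

end

theory Submission
  imports Defs
begin

text \<open>
  By scaling, \<open>L\<^sub>n\<^sub>,\<^sub>p\<^sub>,\<^sub>u(t) = u \<cdot> \<phi>\<^sub>n(t u\<^bsup>p/2-1\<^esup>)\<close> with \<open>\<phi>\<^sub>n(t) = L\<^sub>n\<^sub>,\<^sub>p\<^sub>,\<^sub>1(t)\<close>, so only one parameter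
  matters, and \<open>\<phi>\<^sub>n\<close> is convex and nonincreasing in \<open>t\<close>. Slepian's inequality, applied to the product of two
  spheres inside the sphere of dimension \<open>m + n\<close>, shows that \<open>n E \<phi>\<^sub>n(t)\<close> is superadditive; compared with
  the linear process \<open>\<surd>2 \<langle>g, x\<rangle> / n\<close> it also gives \<open>E \<phi>\<^sub>n(0) \<le> \<surd>2\<close>. Hence \<open>E \<phi>\<^sub>n(t)\<close> converges.
  Another Gaussian comparison gives \<open>E |\<phi>\<^sub>n - E \<phi>\<^sub>n| \<le> 2 / \<surd>n\<close>, which is summable along
  fourth powers. The gaps are filled pathwise: extending a maximizer by zeros shows that \<open>\<phi>\<^sub>n\<close> is
  monotone in \<open>n\<close> up to a rescaling of \<open>t\<close> that tends to the identity when \<open>n\<close> varies between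
  consecutive fourth powers, and convexity makes the limit continuous in \<open>t\<close>. Since rational \<open>t\<close>
  suffice, one null set serves all parameters. Finally \<open>L\<^sub>n\<^sub>,\<^sub>p(t)\<close> is the maximum of \<open>u \<phi>\<^sub>n(t u\<^bsup>p/2-1\<^esup>)\<close>
  over \<open>u\<close>, where \<open>\<phi>\<^sub>n(s) \<le> \<phi>\<^sub>n(0) - s\<close> confines \<open>u\<close> to a compact interval.
\<close>


section \<open>Gaussian product measures\<close>

text \<open>On the sphere the process \<open><G x, x> / n^(3/2)\<close> has covariance
  \<open><x, y>^2 / n^3\<close>, while the penalty is deterministic: it enters every Gaussian
  comparison as a mere shift and is additive over concatenated vectors. All probabilistic estimates
  come from one principle: exchange independent Gaussian blocks in small portions inside a smooth
  function of finitely many coordinates; the second-order term then sees covariances only. With a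
  softmax this term has a sign, which gives Slepian's inequality. With a smoothed
  \<open>|X - Y|\<close>, where \<open>X\<close> and \<open>Y\<close> are two equal or two
  independent maxima, it is bounded by the largest covariance, which is \<open>1/n\<close>. This
  controls only the mean deviation, at a rate that is not summable over all \<open>n\<close>; hence
  the detour through a subsequence and a deterministic comparison between dimensions. The assumption
  \<open>2 < p\<close> enters through the power mean inequality: on the unit sphere the penalty is
  at least \<open>t\<close>, so at large radius it outgrows the quadratic form.\<close>

abbreviation stdN :: "real measure" where
  "stdN \<equiv> density lborel std_normal_density"

text \<open>The index set is arbitrary so that several independent matrices and auxiliary variables
  can live as disjoint tagged blocks of one family; every comparison below moves between such
  blocks.\<close>

definition gauss :: "'k set \<Rightarrow> ('k \<Rightarrow> real) measure" where
  "gauss K = PiM K (\<lambda>_. stdN)"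

lemma prob_space_stdN: "prob_space stdN"
  by (rule prob_space_normal_density) simp

lemma prob_space_gauss [simp, intro]: "prob_space (gauss K)"
  unfolding gauss_def by (intro prob_space_PiM prob_space_stdN)

lemma product_prob_space_stdN: "product_prob_space (\<lambda>_. stdN)"
  by (intro product_prob_spaceI prob_space_stdN)

lemma product_sigma_finite_stdN: "product_sigma_finite (\<lambda>_. stdN)"
  by (rule product_prob_space.axioms(1)[OF product_prob_space_stdN])

lemma sets_gauss [measurable_cong]: "sets (gauss K) = sets (PiM K (\<lambda>_. borel))"
  unfolding gauss_def by (intro sets_PiM_cong) auto

lemma space_gauss: "space (gauss K) = K \<rightarrow>\<^sub>E UNIV"
  unfolding gauss_def by (simp add: space_PiM)

lemma measurable_gauss_component:
  "k \<in> K \<Longrightarrow> (\<lambda>g. g k) \<in> borel_measurable (gauss K)"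
  by measurable

text \<open>Both sides have the characteristic function \<open>exp (- (c t)^2 / 2)\<close>.
  Characteristic functions, unlike densities, cover the degenerate case \<open>c = 0\<close>, which
  occurs at the end points of the interpolation in \<open>comparison\<close>.\<close>

lemma stdN_linear_comb:
  assumes "a\<^sup>2 + b\<^sup>2 = c\<^sup>2"
  shows "distr (stdN \<Otimes>\<^sub>M stdN) borel (\<lambda>(x, y). a * x + b * y) = distr stdN borel (\<lambda>x. c * x)"
proof -
  interpret N: prob_space stdN by (rule prob_space_stdN)
  interpret P: pair_prob_space stdN stdN ..
  have L: "real_distribution (distr (stdN \<Otimes>\<^sub>M stdN) borel (\<lambda>(x, y). a * x + b * y))"
    by (intro P.real_distribution_distr) simp
  have R: "real_distribution (distr stdN borel (\<lambda>x. c * x))"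
    by (intro N.real_distribution_distr) simp
  have ch: "(CLINT x|stdN. iexp (t * x)) = of_real (exp (- (t\<^sup>2) / 2))" for t
    using fun_cong[OF char_std_normal_distribution, of t] by (simp add: char_def)
  have int: "integrable stdN (\<lambda>x. iexp (t * x))" for t
    by (rule N.integrable_iexp) auto
  have "char (distr (stdN \<Otimes>\<^sub>M stdN) borel (\<lambda>(x, y). a * x + b * y)) t =
        char (distr stdN borel (\<lambda>x. c * x)) t" for t
  proof -
    have i: "integrable (stdN \<Otimes>\<^sub>M stdN) (\<lambda>(x, y). iexp (t * (a * x + b * y)))"
      by (rule P.P.integrable_const_bound[where B = 1]) auto
    have "char (distr (stdN \<Otimes>\<^sub>M stdN) borel (\<lambda>(x, y). a * x + b * y)) t =
          (CLINT z|(stdN \<Otimes>\<^sub>M stdN). (\<lambda>(x, y). iexp (t * (a * x + b * y))) z)"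
      unfolding char_def by (subst integral_distr) (auto simp: case_prod_unfold)
    also have "\<dots> = (CLINT x|stdN. CLINT y|stdN. iexp (t * (a * x + b * y)))"
      by (subst P.integral_fst'[OF i, symmetric]) simp
    also have "\<dots> = (CLINT x|stdN. CLINT y|stdN. iexp ((t * a) * x) * iexp ((t * b) * y))"
      by (simp add: exp_add[symmetric] algebra_simps)
    also have "\<dots> = of_real (exp (- ((t * a)\<^sup>2) / 2)) * of_real (exp (- ((t * b)\<^sup>2) / 2))"
      by (simp only: ch integral_mult_right_zero integral_mult_left_zero)
    also have "\<dots> = of_real (exp (- ((t * c)\<^sup>2) / 2))"
    proof -
      have "(t * c)\<^sup>2 = (t * a)\<^sup>2 + (t * b)\<^sup>2"
        by (simp add: power_mult_distrib assms[symmetric] distrib_left)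
      then show ?thesis by (simp only: of_real_mult[symmetric] exp_add[symmetric]) (simp add: field_simps)
    qed
    also have "\<dots> = (CLINT x|stdN. iexp (t * (c * x)))"
      by (simp only: ch[symmetric] mult.assoc)
    also have "\<dots> = char (distr stdN borel (\<lambda>x. c * x)) t"
      unfolding char_def by (subst integral_distr) auto
    finally show ?thesis .
  qed
  then show ?thesis
    by (intro Levy_uniqueness L R ext)
qed

text \<open>A finite product measure is determined by its values on boxes, where the one-dimensional
  law applies factor by factor. The coefficients may depend on \<open>k\<close>, so that an
  increment can be given to one block of coordinates only.\<close>

lemma gauss_linear_comb:
  assumes K: "finite K" and abc: "\<And>k. k \<in> K \<Longrightarrow> (a k)\<^sup>2 + (b k)\<^sup>2 = (c k)\<^sup>2"
  shows "distr (gauss K \<Otimes>\<^sub>M gauss K) (PiM K (\<lambda>_. borel)) (\<lambda>(g, h). \<lambda>k\<in>K. a k * g k + b k * h k)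
       = distr (gauss K) (PiM K (\<lambda>_. borel)) (\<lambda>g. \<lambda>k\<in>K. c k * g k)"
    (is "?L = ?R")
proof -
  interpret N: prob_space stdN by (rule prob_space_stdN)
  interpret P: pair_prob_space stdN stdN ..
  interpret S: product_sigma_finite "\<lambda>_. stdN" by (rule product_sigma_finite_stdN)
  interpret G: prob_space "gauss K" by simp
  interpret Q: pair_prob_space "gauss K" "gauss K" ..
  have prob: "prob_space (distr stdN borel (\<lambda>x. c k * x))" for k
    by (intro N.prob_space_distr) simp
  interpret D: product_prob_space "\<lambda>k. distr stdN borel (\<lambda>x. c k * x)"
    by (rule product_prob_spaceI[OF prob])
  have [measurable]: "(\<lambda>g. \<lambda>k\<in>K. c k * g k) \<in> measurable (gauss K) (PiM K (\<lambda>_. borel))"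
    by measurable
  have 1: "emeasure stdN ((\<lambda>x. c k * x) -` A k) = (\<integral>\<^sup>+x. \<integral>\<^sup>+y. indicator (A k) (a k * x + b k * y) \<partial>stdN \<partial>stdN)"
    if "k \<in> K" "A k \<in> sets borel" for k A
  proof -
    note [measurable] = that(2)
    have "emeasure stdN ((\<lambda>x. c k * x) -` A k) = emeasure (distr stdN borel (\<lambda>x. c k * x)) (A k)"
      by (subst emeasure_distr) auto
    also have "\<dots> = emeasure (distr (stdN \<Otimes>\<^sub>M stdN) borel (\<lambda>(x, y). a k * x + b k * y)) (A k)"
      by (simp add: stdN_linear_comb[OF abc[OF that(1)]])
    also have "\<dots> = (\<integral>\<^sup>+z. indicator (A k) z \<partial>distr (stdN \<Otimes>\<^sub>M stdN) borel (\<lambda>(x, y). a k * x + b k * y))"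
      by (subst nn_integral_indicator) auto
    also have "\<dots> = (\<integral>\<^sup>+z. (\<lambda>(x, y). indicator (A k) (a k * x + b k * y)) z \<partial>(stdN \<Otimes>\<^sub>M stdN))"
      by (subst nn_integral_distr) (auto simp: case_prod_unfold)
    also have "\<dots> = (\<integral>\<^sup>+x. \<integral>\<^sup>+y. indicator (A k) (a k * x + b k * y) \<partial>stdN \<partial>stdN)"
      by (subst N.nn_integral_fst[symmetric]) auto
    finally show ?thesis .
  qed
  have mult_vimage: "(\<lambda>x. c k * x) -` B \<in> sets borel" if "B \<in> sets borel" for k and B :: "real set"
    using measurable_sets[of "\<lambda>x. c k * x" borel borel B] that by simp
  have box: "Pi\<^sub>E K A \<in> sets (PiM K (\<lambda>_. borel))" if "\<And>k. k \<in> K \<Longrightarrow> A k \<in> sets (borel::real measure)" for A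
    using that by (intro sets_PiM_I_finite K) auto
  have "?R = PiM K (\<lambda>k. distr stdN borel (\<lambda>x. c k * x))"
  proof (rule D.PiM_eqI[OF K])
    show "sets ?R = sets (PiM K (\<lambda>k. distr stdN borel (\<lambda>x. c k * x)))"
      by (simp, intro sets_PiM_cong) auto
  next
    fix A assume A: "\<And>k. k \<in> K \<Longrightarrow> A k \<in> sets (distr stdN borel (\<lambda>x. c k * x))"
    then have A'[measurable]: "\<And>k. k \<in> K \<Longrightarrow> A k \<in> sets borel" by simp
    have "emeasure ?R (Pi\<^sub>E K A) = emeasure (gauss K) ((\<lambda>g. \<lambda>k\<in>K. c k * g k) -` Pi\<^sub>E K A \<inter> space (gauss K))"
      by (intro emeasure_distr box A') measurable
    also have "(\<lambda>g. \<lambda>k\<in>K. c k * g k) -` Pi\<^sub>E K A \<inter> space (gauss K) = Pi\<^sub>E K (\<lambda>k. (\<lambda>x. c k * x) -` A k)"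
      by (auto simp: space_gauss PiE_iff extensional_def)
    also have "emeasure (gauss K) \<dots> = (\<Prod>k\<in>K. emeasure stdN ((\<lambda>x. c k * x) -` A k))"
      unfolding gauss_def by (intro S.emeasure_PiM K) (use mult_vimage A' in auto)
    also have "\<dots> = (\<Prod>k\<in>K. emeasure (distr stdN borel (\<lambda>x. c k * x)) (A k))"
      by (intro prod.cong refl) (use A' in \<open>simp add: emeasure_distr\<close>)
    finally show "emeasure ?R (Pi\<^sub>E K A) = (\<Prod>k\<in>K. emeasure (distr stdN borel (\<lambda>x. c k * x)) (A k))" .
  qed
  moreover have "?L = PiM K (\<lambda>k. distr stdN borel (\<lambda>x. c k * x))"
  proof (rule D.PiM_eqI[OF K])
    show "sets ?L = sets (PiM K (\<lambda>k. distr stdN borel (\<lambda>x. c k * x)))"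
      by (simp, intro sets_PiM_cong) auto
  next
    fix A assume A: "\<And>k. k \<in> K \<Longrightarrow> A k \<in> sets (distr stdN borel (\<lambda>x. c k * x))"
    then have A'[measurable]: "\<And>k. k \<in> K \<Longrightarrow> A k \<in> sets borel" by simp
    have ind: "indicator (Pi\<^sub>E K A) (\<lambda>k\<in>K. a k * g k + b k * h k) = (\<Prod>k\<in>K. indicator (A k) (a k * g k + b k * h k) :: ennreal)" for g h
      using K by (auto simp: indicator_def PiE_iff split: if_splits)
    have M: "(\<lambda>(g, h). \<lambda>k\<in>K. a k * g k + b k * h k) \<in> measurable (gauss K \<Otimes>\<^sub>M gauss K) (PiM K (\<lambda>_. borel))"
      by measurable
    note B = box[OF A']
    note [measurable] = M
    have "emeasure ?L (Pi\<^sub>E K A) = (\<integral>\<^sup>+z. indicator (Pi\<^sub>E K A) z \<partial>?L)"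
      by (subst nn_integral_indicator) (auto intro: B)
    also have "\<dots> = (\<integral>\<^sup>+z. (\<lambda>(g, h). indicator (Pi\<^sub>E K A) (\<lambda>k\<in>K. a k * g k + b k * h k)) z \<partial>(gauss K \<Otimes>\<^sub>M gauss K))"
      by (subst nn_integral_distr[OF M]) (use B in \<open>auto simp: case_prod_unfold\<close>)
    also have "\<dots> = (\<integral>\<^sup>+z. (\<lambda>(g, h). \<Prod>k\<in>K. indicator (A k) (a k * g k + b k * h k)) z \<partial>(gauss K \<Otimes>\<^sub>M gauss K))"
      by (simp only: ind)
    also have "\<dots> = (\<integral>\<^sup>+g. \<integral>\<^sup>+h. (\<Prod>k\<in>K. indicator (A k) (a k * g k + b k * h k)) \<partial>gauss K \<partial>gauss K)"
      by (subst G.nn_integral_fst[symmetric]) (auto simp: case_prod_unfold)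
    also have "\<dots> = (\<integral>\<^sup>+g. (\<Prod>k\<in>K. (\<integral>\<^sup>+y. indicator (A k) (a k * g k + b k * y) \<partial>stdN)) \<partial>gauss K)"
      unfolding gauss_def by (subst S.product_nn_integral_prod[OF K, where f = "\<lambda>k y. indicator (A k) (a k * _ k + b k * y)"]) auto
    also have "\<dots> = (\<Prod>k\<in>K. (\<integral>\<^sup>+x. \<integral>\<^sup>+y. indicator (A k) (a k * x + b k * y) \<partial>stdN \<partial>stdN))"
      unfolding gauss_def by (subst S.product_nn_integral_prod[OF K, where f = "\<lambda>k x. \<integral>\<^sup>+y. indicator (A k) (a k * x + b k * y) \<partial>stdN"]) auto
    also have "\<dots> = (\<Prod>k\<in>K. emeasure (distr stdN borel (\<lambda>x. c k * x)) (A k))"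
      by (intro prod.cong refl) (use A' 1 in \<open>simp add: emeasure_distr\<close>)
    finally show "emeasure ?L (Pi\<^sub>E K A) = (\<Prod>k\<in>K. emeasure (distr stdN borel (\<lambda>x. c k * x)) (A k))" .
  qed
  ultimately show ?thesis by simp
qed

text \<open>A tagged block of a large family is again a standard Gaussian family; this is how one
  matrix is read off a space that carries several.\<close>

lemma gauss_reindex:
  assumes "inj_on h A" "h ` A \<subseteq> K"
  shows "distr (gauss K) (PiM A (\<lambda>_. borel)) (\<lambda>g. \<lambda>k\<in>A. g (h k)) = gauss A"
proof -
  have "distr (gauss K) (PiM A (\<lambda>_. borel)) (\<lambda>g. \<lambda>k\<in>A. g (h k)) = distr (gauss K) (gauss A) (\<lambda>g. \<lambda>k\<in>A. g (h k))"
    by (intro distr_cong) (auto simp: sets_gauss)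
  also have "\<dots> = gauss A"
    unfolding gauss_def using assms by (intro distr_PiM_reindex prob_space_stdN) auto
  finally show ?thesis .
qed

lemma integral_gauss_reindex:
  fixes f :: "_ \<Rightarrow> real"
  assumes "inj_on h A" "h ` A \<subseteq> K" and [measurable]: "f \<in> borel_measurable (PiM A (\<lambda>_. borel))"
  shows "(\<integral>g. f (\<lambda>k\<in>A. g (h k)) \<partial>gauss K) = (\<integral>g. f g \<partial>gauss A)"
    and "integrable (gauss A) f \<Longrightarrow> integrable (gauss K) (\<lambda>g. f (\<lambda>k\<in>A. g (h k)))"
proof -
  have M: "(\<lambda>g. \<lambda>k\<in>A. g (h k)) \<in> measurable (gauss K) (PiM A (\<lambda>_. borel))"
    using assms(2) by (intro measurable_restrict) auto
  show "(\<integral>g. f (\<lambda>k\<in>A. g (h k)) \<partial>gauss K) = (\<integral>g. f g \<partial>gauss A)"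
    using integral_distr[OF M assms(3)] by (simp only: gauss_reindex[OF assms(1,2)])
  assume "integrable (gauss A) f"
  then have "integrable (distr (gauss K) (PiM A (\<lambda>_. borel)) (\<lambda>g. \<lambda>k\<in>A. g (h k))) f"
    by (subst gauss_reindex[OF assms(1,2)])
  then show "integrable (gauss K) (\<lambda>g. f (\<lambda>k\<in>A. g (h k)))"
    by (simp only: integrable_distr_eq[OF M assms(3)])
qed

section \<open>Moments of Gaussian vectors\<close>

lemma stdN_moments:
  "integrable stdN (\<lambda>x. x)" "(\<integral>x. x \<partial>stdN) = 0"
  "integrable stdN (\<lambda>x. x * x)" "(\<integral>x. x * x \<partial>stdN) = 1"
  "integrable stdN (\<lambda>x. \<bar>x\<bar> ^ m)"
proof -
  have *: "integrable stdN (\<lambda>x. x ^ k)" for k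
    using integrable_std_normal_moment[of k] by (subst integrable_density) (auto simp: mult.commute)
  show "integrable stdN (\<lambda>x. x)" using *[of 1] by simp
  show "integrable stdN (\<lambda>x. x * x)" using *[of 2] by (simp add: power2_eq_square)
  show "integrable stdN (\<lambda>x. \<bar>x\<bar> ^ m)"
    using integrable_std_normal_moment_abs[of m] by (subst integrable_density) (auto simp: mult.commute)
  show "(\<integral>x. x \<partial>stdN) = 0"
    using integral_std_normal_moment_odd[of 0] by (subst integral_density) auto
  show "(\<integral>x. x * x \<partial>stdN) = 1"
    using integral_std_normal_moment_even[of 1]
    by (subst integral_density) (auto simp: power2_eq_square)
qed

lemma gauss_component:
  fixes f :: "real \<Rightarrow> real"
  assumes "k \<in> K" and [measurable]: "f \<in> borel_measurable borel"
  shows "(\<integral>g. f (g k) \<partial>gauss K) = (\<integral>x. f x \<partial>stdN)"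
    and "integrable stdN f \<Longrightarrow> integrable (gauss K) (\<lambda>g. f (g k))"
proof -
  have M: "(\<lambda>g. g k) \<in> measurable (gauss K) stdN" using assms(1) by measurable
  have D: "distr (gauss K) stdN (\<lambda>g. g k) = stdN"
    unfolding gauss_def using assms(1) by (intro distr_PiM_component prob_space_stdN)
  have F: "f \<in> borel_measurable stdN" by simp
  show "(\<integral>g. f (g k) \<partial>gauss K) = (\<integral>x. f x \<partial>stdN)"
    using integral_distr[OF M F] unfolding D by (rule sym)
  show "integrable (gauss K) (\<lambda>g. f (g k))" if "integrable stdN f"
    using integrable_distr_eq[OF M F] that unfolding D by (rule iffD1)
qed

lemma gauss_moments:
  assumes K: "finite K" and k: "k \<in> K"
  shows "integrable (gauss K) (\<lambda>g. g k)" "(\<integral>g. g k \<partial>gauss K) = 0"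
    "integrable (gauss K) (\<lambda>g. \<bar>g k\<bar> ^ m)"
    "l \<in> K \<Longrightarrow> integrable (gauss K) (\<lambda>g. g k * g l)"
    "l \<in> K \<Longrightarrow> (\<integral>g. g k * g l \<partial>gauss K) = (if k = l then 1 else 0)"
proof -
  interpret S: product_sigma_finite "\<lambda>_. stdN" by (rule product_sigma_finite_stdN)
  interpret N: prob_space stdN by (rule prob_space_stdN)
  interpret G: prob_space "gauss K" by simp
  show "integrable (gauss K) (\<lambda>g. g k)" "(\<integral>g. g k \<partial>gauss K) = 0"
    "integrable (gauss K) (\<lambda>g. \<bar>g k\<bar> ^ m)"
  proof -
    show "integrable (gauss K) (\<lambda>g. g k)"
      by (rule gauss_component(2)[OF k _ stdN_moments(1)]) simp
    show "(\<integral>g. g k \<partial>gauss K) = 0"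
      using gauss_component(1)[OF k, of "\<lambda>x. x"] by (simp add: stdN_moments(2))
    show "integrable (gauss K) (\<lambda>g. \<bar>g k\<bar> ^ m)"
      by (rule gauss_component(2)[OF k _ stdN_moments(5)]) simp
  qed
  assume l: "l \<in> K"
  show "integrable (gauss K) (\<lambda>g. g k * g l)"
  proof (rule Bochner_Integration.integrable_bound)
    show "integrable (gauss K) (\<lambda>g. g k * g k + g l * g l)"
      using k l by (intro Bochner_Integration.integrable_add gauss_component(2)[of _ K "\<lambda>x. x * x"] stdN_moments) auto
    have "\<bar>x * y\<bar> \<le> \<bar>x * x + y * y\<bar>" for x y :: real
    proof -
      have "0 \<le> (\<bar>x\<bar> - \<bar>y\<bar>)\<^sup>2" by simp
      then have "2 * (\<bar>x\<bar> * \<bar>y\<bar>) \<le> x * x + y * y"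
        by (simp add: power2_diff) (simp add: power2_eq_square)
      moreover have "0 \<le> \<bar>x\<bar> * \<bar>y\<bar>" by simp
      ultimately have "\<bar>x\<bar> * \<bar>y\<bar> \<le> x * x + y * y" by linarith
      then show ?thesis by (simp add: abs_mult)
    qed
    then show "AE g in gauss K. norm (g k * g l) \<le> norm (g k * g k + g l * g l)"
      by simp
    show "(\<lambda>g. g k * g l) \<in> borel_measurable (gauss K)" using k l by measurable
  qed
  show "(\<integral>g. g k * g l \<partial>gauss K) = (if k = l then 1 else 0)"
  proof (cases "k = l")
    case True
    have "(\<integral>g. g k * g k \<partial>gauss K) = (\<integral>x. x * x \<partial>stdN)"
      by (rule gauss_component(1)[OF k]) simp
    then show ?thesis unfolding stdN_moments(4) using True by simp
  next
    case False
    \<comment> \<open>The factor 1 at all other coordinates turns the product of two coordinates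
      into a product over \<open>K\<close>, whose integral factors; the factor at \<open>k\<close>
      integrates to 0.\<close>
    let ?f = "\<lambda>i x :: real. if i = k \<or> i = l then x else 1"
    have "integrable stdN (?f i)" for i
      by (cases "i = k \<or> i = l") (simp_all only: if_True if_False stdN_moments(1) N.integrable_const)
    then have "(\<integral>g. (\<Prod>i\<in>K. ?f i (g i)) \<partial>gauss K) = (\<Prod>i\<in>K. \<integral>x. ?f i x \<partial>stdN)"
      unfolding gauss_def by (rule S.product_integral_prod[OF K])
    also have "\<dots> = 0"
      by (rule prod_zero[OF K]) (rule bexI[OF _ k], simp only: simp_thms if_True stdN_moments(2))
    also have "(\<lambda>g. \<Prod>i\<in>K. ?f i (g i)) = (\<lambda>g. g k * g l)"
    proof
      fix g :: "'a \<Rightarrow> real"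
      have "(\<Prod>i\<in>K. ?f i (g i)) = (\<Prod>i\<in>{k, l}. ?f i (g i))"
        using K k l by (intro prod.mono_neutral_right) auto
      then show "(\<Prod>i\<in>K. ?f i (g i)) = g k * g l" using False by simp
    qed
    finally show ?thesis using False by simp
  qed
qed

lemma gauss_linear_moments:
  assumes K: "finite K"
  shows "integrable (gauss K) (\<lambda>g. \<Sum>k\<in>K. u k * g k)" "(\<integral>g. (\<Sum>k\<in>K. u k * g k) \<partial>gauss K) = 0"
    "integrable (gauss K) (\<lambda>g. (\<Sum>k\<in>K. u k * g k) * (\<Sum>k\<in>K. v k * g k))"
    "(\<integral>g. (\<Sum>k\<in>K. u k * g k) * (\<Sum>k\<in>K. v k * g k) \<partial>gauss K) = (\<Sum>k\<in>K. u k * v k)"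
proof -
  show "integrable (gauss K) (\<lambda>g. \<Sum>k\<in>K. u k * g k)"
    using gauss_moments[OF K] by (auto intro!: Bochner_Integration.integrable_sum)
  show "(\<integral>g. (\<Sum>k\<in>K. u k * g k) \<partial>gauss K) = 0"
    using gauss_moments[OF K] by (subst Bochner_Integration.integral_sum) auto
  have e: "(\<Sum>k\<in>K. u k * g k) * (\<Sum>k\<in>K. v k * g k) = (\<Sum>k\<in>K. \<Sum>l\<in>K. (u k * v l) * (g k * g l))" for g
    by (simp add: sum_product algebra_simps)
  show "integrable (gauss K) (\<lambda>g. (\<Sum>k\<in>K. u k * g k) * (\<Sum>k\<in>K. v k * g k))"
    unfolding e using gauss_moments[OF K] by (auto intro!: Bochner_Integration.integrable_sum)
  have "(\<integral>g. (\<Sum>k\<in>K. u k * g k) * (\<Sum>k\<in>K. v k * g k) \<partial>gauss K)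
     = (\<Sum>k\<in>K. \<Sum>l\<in>K. (u k * v l) * (if k = l then 1 else 0))"
    unfolding e using gauss_moments(4,5)[OF K]
    by (simp add: Bochner_Integration.integral_sum Bochner_Integration.integrable_sum)
  also have "\<dots> = (\<Sum>k\<in>K. u k * v k)"
    using K by (simp add: if_distrib[of "\<lambda>x. _ * x"] sum.delta cong: if_cong)
  finally show "(\<integral>g. (\<Sum>k\<in>K. u k * g k) * (\<Sum>k\<in>K. v k * g k) \<partial>gauss K) = (\<Sum>k\<in>K. u k * v k)" .
qed

text \<open>The sum is at most the cardinality times its largest term, and the cube of that term is
  among the summands on the right.\<close>

lemma cube_sum_le_card_cubed:
  fixes f :: "'a \<Rightarrow> real"
  assumes "finite K" "\<And>k. k \<in> K \<Longrightarrow> 0 \<le> f k"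
  shows "(\<Sum>k\<in>K. f k) ^ 3 \<le> real (card K) ^ 3 * (\<Sum>k\<in>K. f k ^ 3)"
proof (cases "K = {}")
  case False
  define M where "M = Max (f ` K)"
  have M: "M \<in> f ` K" unfolding M_def using assms False by simp
  then obtain k where k: "k \<in> K" "M = f k" by auto
  have "(\<Sum>k\<in>K. f k) \<le> (\<Sum>k\<in>K. M)" unfolding M_def using assms by (intro sum_mono) auto
  then have "(\<Sum>k\<in>K. f k) \<le> real (card K) * M" by simp
  then have "(\<Sum>k\<in>K. f k) ^ 3 \<le> (real (card K) * M) ^ 3"
    using assms by (intro power_mono sum_nonneg) auto
  also have "\<dots> = real (card K) ^ 3 * f k ^ 3" by (simp add: power_mult_distrib k)
  also have "\<dots> \<le> real (card K) ^ 3 * (\<Sum>k\<in>K. f k ^ 3)"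
    using assms k by (intro mult_left_mono member_le_sum) auto
  finally show ?thesis .
qed simp

lemma gauss_sum_abs_moments:
  assumes K: "finite K"
  shows "integrable (gauss K) (\<lambda>g. \<Sum>k\<in>K. \<bar>g k\<bar>)"
    and "integrable (gauss K) (\<lambda>g. (\<Sum>k\<in>K. \<bar>g k\<bar>) ^ 3)"
proof -
  show "integrable (gauss K) (\<lambda>g. \<Sum>k\<in>K. \<bar>g k\<bar>)"
    using gauss_moments(3)[OF K, of _ 1] by (intro Bochner_Integration.integrable_sum) auto
  show "integrable (gauss K) (\<lambda>g. (\<Sum>k\<in>K. \<bar>g k\<bar>) ^ 3)"
  proof (rule Bochner_Integration.integrable_bound)
    show "integrable (gauss K) (\<lambda>g. real (card K) ^ 3 * (\<Sum>k\<in>K. \<bar>g k\<bar> ^ 3))"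
      using gauss_moments(3)[OF K, of _ 3]
      by (intro integrable_mult_right Bochner_Integration.integrable_sum) auto
    show "AE g in gauss K. norm ((\<Sum>k\<in>K. \<bar>g k\<bar>) ^ 3) \<le> norm (real (card K) ^ 3 * (\<Sum>k\<in>K. \<bar>g k\<bar> ^ 3))"
      using cube_sum_le_card_cubed[OF K] by (auto simp: sum_nonneg)
    have "(\<lambda>g. \<Sum>k\<in>K. \<bar>g k\<bar>) \<in> borel_measurable (gauss K)"
      by (intro borel_measurable_sum) simp
    then show "(\<lambda>g. (\<Sum>k\<in>K. \<bar>g k\<bar>) ^ 3) \<in> borel_measurable (gauss K)"
      by (rule borel_measurable_power)
  qed
qed

section \<open>Comparison of Gaussian vectors by swapping small increments\<close>

text \<open>The form in which the equality of laws is used: the increment \<open>h\<close> is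
  integrated first, with \<open>g\<close> frozen. Integrability for the pair is inherited from the
  single variable through that equality.\<close>

lemma gauss_linear_comb_integral:
  fixes f :: "('k \<Rightarrow> real) \<Rightarrow> real"
  assumes K: "finite K" and abc: "\<And>k. k \<in> K \<Longrightarrow> (a k)\<^sup>2 + (b k)\<^sup>2 = (c k)\<^sup>2"
    and f: "f \<in> borel_measurable (PiM K (\<lambda>_. borel))"
    and int: "integrable (gauss K) (\<lambda>g. f (\<lambda>k\<in>K. c k * g k))"
  shows "(\<integral>g. f (\<lambda>k\<in>K. c k * g k) \<partial>gauss K) = (\<integral>g. (\<integral>h. f (\<lambda>k\<in>K. a k * g k + b k * h k) \<partial>gauss K) \<partial>gauss K)"
    and "integrable (gauss K) (\<lambda>g. \<integral>h. f (\<lambda>k\<in>K. a k * g k + b k * h k) \<partial>gauss K)"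
proof -
  interpret G: prob_space "gauss K" by simp
  interpret Q: pair_prob_space "gauss K" "gauss K" ..
  let ?F = "\<lambda>(g, h). \<lambda>k\<in>K. a k * g k + b k * h k"
  have C: "(\<lambda>g. \<lambda>k\<in>K. c k * g k) \<in> measurable (gauss K) (PiM K (\<lambda>_. borel))"
    by measurable
  have M: "?F \<in> measurable (gauss K \<Otimes>\<^sub>M gauss K) (PiM K (\<lambda>_. borel))"
    by measurable
  have eq: "distr (gauss K \<Otimes>\<^sub>M gauss K) (PiM K (\<lambda>_. borel)) ?F
      = distr (gauss K) (PiM K (\<lambda>_. borel)) (\<lambda>g. \<lambda>k\<in>K. c k * g k)"
    by (rule gauss_linear_comb[OF K abc])
  have "integrable (distr (gauss K \<Otimes>\<^sub>M gauss K) (PiM K (\<lambda>_. borel)) ?F) f"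
    unfolding eq using int integrable_distr_eq[OF C f] by blast
  then have i: "integrable (gauss K \<Otimes>\<^sub>M gauss K) (\<lambda>z. f (?F z))"
    unfolding integrable_distr_eq[OF M f] .
  have "(\<integral>g. f (\<lambda>k\<in>K. c k * g k) \<partial>gauss K) = (\<integral>z. f (?F z) \<partial>(gauss K \<Otimes>\<^sub>M gauss K))"
    using integral_distr[OF C f] integral_distr[OF M f] unfolding eq by metis
  also have "\<dots> = (\<integral>g. (\<integral>h. f (\<lambda>k\<in>K. a k * g k + b k * h k) \<partial>gauss K) \<partial>gauss K)"
    by (subst Q.integral_fst'[OF i, symmetric]) simp
  finally show "(\<integral>g. f (\<lambda>k\<in>K. c k * g k) \<partial>gauss K) = (\<integral>g. (\<integral>h. f (\<lambda>k\<in>K. a k * g k + b k * h k) \<partial>gauss K) \<partial>gauss K)" .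
  show "integrable (gauss K) (\<lambda>g. \<integral>h. f (\<lambda>k\<in>K. a k * g k + b k * h k) \<partial>gauss K)"
    using Q.integrable_fst'[OF i] by simp
qed

text \<open>\<open>D1\<close> and \<open>D2\<close> play the gradient and the Hessian of
  \<open>\<Psi>\<close>, but only an expansion with a uniform cubic remainder is recorded, and they
  are evaluated at one frozen \<open>w\<close> at a time. \<open>growth\<close> gives integrability
  against Gaussian vectors; \<open>\<Psi>_restrict\<close> makes \<open>\<Psi>\<close> depend on the
  coordinates in \<open>T\<close> alone although its argument is a total function.\<close>

locale lindeberg_function =
  fixes T :: "'t set" and \<Psi> :: "('t \<Rightarrow> real) \<Rightarrow> real"
    and D1 :: "('t \<Rightarrow> real) \<Rightarrow> 't \<Rightarrow> real" and D2 :: "('t \<Rightarrow> real) \<Rightarrow> 't \<Rightarrow> 't \<Rightarrow> real"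
    and c0 c1 C :: real
  assumes finite_T: "finite T"
    and measurable_\<Psi>: "\<Psi> \<in> borel_measurable (PiM T (\<lambda>_. borel))"
    and \<Psi>_restrict: "\<And>w. \<Psi> (restrict w T) = \<Psi> w"
    and growth: "\<And>w. \<bar>\<Psi> w\<bar> \<le> c0 + c1 * (\<Sum>t\<in>T. \<bar>w t\<bar>)" and c1: "0 \<le> c1"
    and expansion: "\<And>w v. \<bar>\<Psi> (\<lambda>t. w t + v t) - \<Psi> w - (\<Sum>t\<in>T. D1 w t * v t)
        - (\<Sum>t\<in>T. \<Sum>s\<in>T. D2 w t s * (v t * v s)) / 2\<bar> \<le> C * (\<Sum>t\<in>T. \<bar>v t\<bar>) ^ 3"
begin

lemma measurable_affine:
  assumes "\<And>t. t \<in> T \<Longrightarrow> X t \<in> borel_measurable N"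
  shows "(\<lambda>x. \<Psi> (\<lambda>t. X t x)) \<in> borel_measurable N"
proof -
  have "(\<lambda>x. \<lambda>t\<in>T. X t x) \<in> measurable N (PiM T (\<lambda>_. borel))"
    using assms by (intro measurable_restrict) auto
  from measurable_compose[OF this measurable_\<Psi>] show ?thesis
    by (simp add: \<Psi>_restrict)
qed

lemma integrable_affine:
  assumes K: "finite K"
  shows "integrable (gauss K) (\<lambda>g. \<Psi> (\<lambda>t. w t + (\<Sum>k\<in>K. u t k * g k)))"
proof (rule Bochner_Integration.integrable_bound)
  interpret G: prob_space "gauss K" by simp
  show "integrable (gauss K) (\<lambda>g. c0 + c1 * (\<Sum>t\<in>T. \<bar>w t\<bar> + (\<Sum>k\<in>K. \<bar>u t k\<bar> * \<bar>g k\<bar>)))"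
    using gauss_moments(3)[OF K, of _ 1]
    by (intro Bochner_Integration.integrable_add G.integrable_const integrable_mult_right
        Bochner_Integration.integrable_sum) auto
  show "(\<lambda>g. \<Psi> (\<lambda>t. w t + (\<Sum>k\<in>K. u t k * g k))) \<in> borel_measurable (gauss K)"
    by (intro measurable_affine) measurable
  have "\<bar>\<Psi> (\<lambda>t. w t + (\<Sum>k\<in>K. u t k * g k))\<bar> \<le> c0 + c1 * (\<Sum>t\<in>T. \<bar>w t\<bar> + (\<Sum>k\<in>K. \<bar>u t k\<bar> * \<bar>g k\<bar>))" for g
  proof -
    have "\<bar>w t + (\<Sum>k\<in>K. u t k * g k)\<bar> \<le> \<bar>w t\<bar> + (\<Sum>k\<in>K. \<bar>u t k\<bar> * \<bar>g k\<bar>)" for t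
    proof -
      have "\<bar>\<Sum>k\<in>K. u t k * g k\<bar> \<le> (\<Sum>k\<in>K. \<bar>u t k\<bar> * \<bar>g k\<bar>)"
        using sum_abs[of "\<lambda>k. u t k * g k" K] by (simp add: abs_mult)
      then show ?thesis by linarith
    qed
    then have "(\<Sum>t\<in>T. \<bar>w t + (\<Sum>k\<in>K. u t k * g k)\<bar>) \<le> (\<Sum>t\<in>T. \<bar>w t\<bar> + (\<Sum>k\<in>K. \<bar>u t k\<bar> * \<bar>g k\<bar>))"
      by (intro sum_mono)
    from mult_left_mono[OF this c1] show ?thesis
      using growth[of "\<lambda>t. w t + (\<Sum>k\<in>K. u t k * g k)"] by linarith
  qed
  then show "AE g in gauss K. norm (\<Psi> (\<lambda>t. w t + (\<Sum>k\<in>K. u t k * g k)))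
      \<le> norm (c0 + c1 * (\<Sum>t\<in>T. \<bar>w t\<bar> + (\<Sum>k\<in>K. \<bar>u t k\<bar> * \<bar>g k\<bar>)))"
    by (intro AE_I2) (auto intro: order_trans[OF _ abs_ge_self])
qed

lemma integrable_cube:
  assumes K: "finite K"
  shows "integrable (gauss K) (\<lambda>g. (\<Sum>t\<in>T. \<bar>\<Sum>k\<in>K. u t k * g k\<bar>) ^ 3)"
proof (rule Bochner_Integration.integrable_bound)
  define U where "U = (\<Sum>t\<in>T. \<Sum>k\<in>K. \<bar>u t k\<bar>)"
  show "integrable (gauss K) (\<lambda>g. U ^ 3 * (\<Sum>k\<in>K. \<bar>g k\<bar>) ^ 3)"
    using gauss_sum_abs_moments(2)[OF K] by (rule integrable_mult_right)
  show "(\<lambda>g. (\<Sum>t\<in>T. \<bar>\<Sum>k\<in>K. u t k * g k\<bar>) ^ 3) \<in> borel_measurable (gauss K)"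
    by (intro borel_measurable_power borel_measurable_sum borel_measurable_abs borel_measurable_times
        borel_measurable_const measurable_gauss_component)
  have "(\<Sum>t\<in>T. \<bar>\<Sum>k\<in>K. u t k * g k\<bar>) ^ 3 \<le> U ^ 3 * (\<Sum>k\<in>K. \<bar>g k\<bar>) ^ 3" for g
  proof -
    have "\<bar>\<Sum>k\<in>K. u t k * g k\<bar> \<le> (\<Sum>k\<in>K. \<bar>u t k\<bar>) * (\<Sum>k\<in>K. \<bar>g k\<bar>)" for t
    proof -
      have "\<bar>\<Sum>k\<in>K. u t k * g k\<bar> \<le> (\<Sum>k\<in>K. \<bar>u t k\<bar> * \<bar>g k\<bar>)"
        using sum_abs[of "\<lambda>k. u t k * g k" K] by (simp add: abs_mult)
      also have "\<dots> \<le> (\<Sum>k\<in>K. \<bar>u t k\<bar> * (\<Sum>k\<in>K. \<bar>g k\<bar>))"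
        using K by (intro sum_mono mult_left_mono member_le_sum) auto
      finally show ?thesis by (simp add: sum_distrib_right)
    qed
    then have "(\<Sum>t\<in>T. \<bar>\<Sum>k\<in>K. u t k * g k\<bar>) \<le> U * (\<Sum>k\<in>K. \<bar>g k\<bar>)"
      unfolding U_def sum_distrib_right[of _ T] by (intro sum_mono)
    then have "(\<Sum>t\<in>T. \<bar>\<Sum>k\<in>K. u t k * g k\<bar>) ^ 3 \<le> (U * (\<Sum>k\<in>K. \<bar>g k\<bar>)) ^ 3"
      by (intro power_mono sum_nonneg) auto
    then show ?thesis by (simp add: power_mult_distrib)
  qed
  then show "AE g in gauss K. norm ((\<Sum>t\<in>T. \<bar>\<Sum>k\<in>K. u t k * g k\<bar>) ^ 3) \<le> norm (U ^ 3 * (\<Sum>k\<in>K. \<bar>g k\<bar>) ^ 3)"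
    by (intro AE_I2) (auto simp: sum_nonneg intro: order_trans[OF _ abs_ge_self])
qed

text \<open>
  The linear term of the expansion has mean zero, so a small Gaussian increment is felt only through
  its covariance, up to third order.
\<close>

lemma expected_increment:
  assumes K: "finite K" and \<delta>: "0 \<le> \<delta>"
  shows "\<bar>(\<integral>g. \<Psi> (\<lambda>t. w t + \<delta> * (\<Sum>k\<in>K. u t k * g k)) \<partial>gauss K) - \<Psi> w
      - \<delta>\<^sup>2 / 2 * (\<Sum>t\<in>T. \<Sum>s\<in>T. D2 w t s * (\<Sum>k\<in>K. u t k * u s k))\<bar>
    \<le> C * \<delta> ^ 3 * (\<integral>g. (\<Sum>t\<in>T. \<bar>\<Sum>k\<in>K. u t k * g k\<bar>) ^ 3 \<partial>gauss K)"
proof -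
  interpret G: prob_space "gauss K" by simp
  let ?V = "\<lambda>g t. \<Sum>k\<in>K. u t k * g k"
  have i0: "integrable (gauss K) (\<lambda>g. \<Psi> (\<lambda>t. w t + \<delta> * ?V g t))"
    using integrable_affine[OF K, of w "\<lambda>t k. \<delta> * u t k"] by (simp add: sum_distrib_left mult.assoc)
  have i1: "integrable (gauss K) (\<lambda>g. \<Sum>t\<in>T. D1 w t * (\<delta> * ?V g t))"
    by (intro Bochner_Integration.integrable_sum integrable_mult_right gauss_linear_moments(1) K)
  have e1: "(\<integral>g. (\<Sum>t\<in>T. D1 w t * (\<delta> * ?V g t)) \<partial>gauss K) = 0"
    using gauss_linear_moments(1,2)[OF K]
    by (subst Bochner_Integration.integral_sum) (simp_all add: integrable_mult_right)
  have i2: "integrable (gauss K) (\<lambda>g. \<Sum>t\<in>T. \<Sum>s\<in>T. D2 w t s * (?V g t * ?V g s))"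
    by (intro Bochner_Integration.integrable_sum integrable_mult_right gauss_linear_moments(3) K)
  have e2: "(\<integral>g. (\<Sum>t\<in>T. \<Sum>s\<in>T. D2 w t s * (?V g t * ?V g s)) \<partial>gauss K)
      = (\<Sum>t\<in>T. \<Sum>s\<in>T. D2 w t s * (\<Sum>k\<in>K. u t k * u s k))"
  proof -
    have "(\<integral>g. (\<Sum>t\<in>T. \<Sum>s\<in>T. D2 w t s * (?V g t * ?V g s)) \<partial>gauss K)
      = (\<Sum>t\<in>T. \<integral>g. (\<Sum>s\<in>T. D2 w t s * (?V g t * ?V g s)) \<partial>gauss K)"
      by (intro Bochner_Integration.integral_sum Bochner_Integration.integrable_sum integrable_mult_right gauss_linear_moments(3) K)
    also have "\<dots> = (\<Sum>t\<in>T. \<Sum>s\<in>T. \<integral>g. D2 w t s * (?V g t * ?V g s) \<partial>gauss K)"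
      by (intro sum.cong refl Bochner_Integration.integral_sum integrable_mult_right gauss_linear_moments(3) K)
    also have "\<dots> = (\<Sum>t\<in>T. \<Sum>s\<in>T. D2 w t s * (\<Sum>k\<in>K. u t k * u s k))"
      by (simp only: integral_mult_right_zero gauss_linear_moments(4)[OF K])
    finally show ?thesis .
  qed
  let ?R = "\<lambda>g. \<Psi> (\<lambda>t. w t + \<delta> * ?V g t) - \<Psi> w - (\<Sum>t\<in>T. D1 w t * (\<delta> * ?V g t))
      - \<delta>\<^sup>2 / 2 * (\<Sum>t\<in>T. \<Sum>s\<in>T. D2 w t s * (?V g t * ?V g s))"
  have iR: "integrable (gauss K) ?R"
    by (intro Bochner_Integration.integrable_diff i0 i1 integrable_mult_right i2 G.integrable_const)
  have "(\<integral>g. ?R g \<partial>gauss K) = (\<integral>g. \<Psi> (\<lambda>t. w t + \<delta> * ?V g t) \<partial>gauss K) - \<Psi> w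
      - \<delta>\<^sup>2 / 2 * (\<Sum>t\<in>T. \<Sum>s\<in>T. D2 w t s * (\<Sum>k\<in>K. u t k * u s k))"
    using i0 i1 i2 by (simp add: integrable_mult_right e1 e2 G.prob_space)
  moreover have "\<bar>\<integral>g. ?R g \<partial>gauss K\<bar> \<le> (\<integral>g. \<bar>?R g\<bar> \<partial>gauss K)"
    using integral_norm_bound[of "gauss K" ?R] by simp
  moreover have "(\<integral>g. \<bar>?R g\<bar> \<partial>gauss K) \<le> (\<integral>g. C * \<delta> ^ 3 * (\<Sum>t\<in>T. \<bar>?V g t\<bar>) ^ 3 \<partial>gauss K)"
  proof (rule integral_mono)
    show "integrable (gauss K) (\<lambda>g. \<bar>?R g\<bar>)" by (rule integrable_abs[OF iR])
    show "integrable (gauss K) (\<lambda>g. C * \<delta> ^ 3 * (\<Sum>t\<in>T. \<bar>?V g t\<bar>) ^ 3)"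
      by (intro integrable_mult_right integrable_cube K)
    fix g
    have "(\<Sum>t\<in>T. \<Sum>s\<in>T. D2 w t s * (\<delta> * ?V g t * (\<delta> * ?V g s))) / 2
        = \<delta>\<^sup>2 / 2 * (\<Sum>t\<in>T. \<Sum>s\<in>T. D2 w t s * (?V g t * ?V g s))"
      by (simp add: sum_distrib_left sum_divide_distrib power2_eq_square algebra_simps)
    moreover have "(\<Sum>t\<in>T. \<bar>\<delta> * ?V g t\<bar>) ^ 3 = \<delta> ^ 3 * (\<Sum>t\<in>T. \<bar>?V g t\<bar>) ^ 3"
      using \<delta> by (simp add: abs_mult sum_distrib_left[symmetric] power_mult_distrib)
    ultimately show "\<bar>?R g\<bar> \<le> C * \<delta> ^ 3 * (\<Sum>t\<in>T. \<bar>?V g t\<bar>) ^ 3"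
      using expansion[of w "\<lambda>t. \<delta> * ?V g t"] by (simp add: mult.assoc)
  qed
  ultimately show ?thesis by simp
qed

text \<open>Exchanging the block \<open>B\<close> for \<open>A\<close> changes the expectation by
  half the Hessian contracted with the covariance difference, averaged along the interpolation.
  \<open>\<kappa>\<close> bounds this contraction from below uniformly in \<open>w\<close>:
  Slepian's inequality takes \<open>\<kappa>\<close> to be 0, concentration takes 2.\<close>

lemma comparison:
  assumes K: "finite K" and AB: "A \<inter> B = {}" "A \<union> B = K"
    and cov: "\<And>w. - \<kappa> \<le> (\<Sum>t\<in>T. \<Sum>s\<in>T. D2 w t s * ((\<Sum>k\<in>A. l t k * l s k) - (\<Sum>k\<in>B. l t k * l s k)))"
  shows "(\<integral>g. \<Psi> (\<lambda>t. \<Sum>k\<in>B. l t k * g k) \<partial>gauss K) - \<kappa> / 2 \<le> (\<integral>g. \<Psi> (\<lambda>t. \<Sum>k\<in>A. l t k * g k) \<partial>gauss K)"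
proof -
  interpret G: prob_space "gauss K" by simp
  \<comment> \<open>\<open>m s\<close> interpolates between the coordinates in \<open>B\<close> at \<open>s = 0\<close> and those in \<open>A\<close> at \<open>s = 1\<close>. In each
    of \<open>N\<close> steps an independent increment of variance \<open>1/N\<close> is moved from \<open>B\<close> to \<open>A\<close>; the error
    \<open>O(N\<^bsup>-3/2\<^esup>)\<close> per step vanishes in total.\<close>
  define m where "m s = (\<integral>g. \<Psi> (\<lambda>t. \<Sum>k\<in>K. l t k * ((if k \<in> A then sqrt s else sqrt (1 - s)) * g k)) \<partial>gauss K)" for s
  \<comment> \<open>Padding the coefficients by zero lets the increments of both blocks be written
    as sums over all of \<open>K\<close>, as \<open>expected_increment\<close> expects.\<close>
  define rest where "rest D t k = (if k \<in> D then l t k else 0)" for D and t :: 't and k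
  have sum_rest: "(\<Sum>k\<in>K. rest D t k * x k) = (\<Sum>k\<in>D. l t k * x k)" if "D \<subseteq> K" for D t x
  proof -
    have "(\<Sum>k\<in>K. rest D t k * x k) = (\<Sum>k\<in>K. if k \<in> D then l t k * x k else 0)"
      unfolding rest_def by (intro sum.cong) auto
    also have "\<dots> = (\<Sum>k\<in>D. l t k * x k)"
      using that K by (simp add: sum.inter_restrict[symmetric] Int_absorb1)
    finally show ?thesis .
  qed
  have cov_rest: "(\<Sum>k\<in>K. rest D t k * rest D s k) = (\<Sum>k\<in>D. l t k * l s k)" if "D \<subseteq> K" for D t s
    unfolding sum_rest[OF that] by (intro sum.cong) (auto simp: rest_def)
  define Q where "Q D = (\<integral>g. (\<Sum>t\<in>T. \<bar>\<Sum>k\<in>K. rest D t k * g k\<bar>) ^ 3 \<partial>gauss K)" for D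
  let ?S = "\<lambda>x t. \<Sum>k\<in>K. l t k * x k"
  have f: "(\<lambda>x. \<Psi> (?S x)) \<in> borel_measurable (PiM K (\<lambda>_. borel))"
    by (intro measurable_affine) measurable
  have int: "integrable (gauss K) (\<lambda>g. \<Psi> (?S (\<lambda>k\<in>K. c k * g k)))" for c
  proof -
    have "?S (\<lambda>k\<in>K. c k * g k) = (\<lambda>t. 0 + (\<Sum>k\<in>K. l t k * c k * g k))" for g
      by (auto intro!: sum.cong ext)
    then show ?thesis using integrable_affine[OF K, of "\<lambda>_. 0" "\<lambda>t k. l t k * c k"] by simp
  qed
  have step: "m ((real j + 1) / real N) - m (real j / real N)
      \<ge> - \<kappa> / (2 * real N) - C * (1 / sqrt (real N)) ^ 3 * (Q A + Q B)" if "j < N" for j N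
  proof -
    define \<delta> where "\<delta> = 1 / sqrt (real N)"
    have N: "0 < real N" using that by simp
    have \<delta>: "0 \<le> \<delta>" "\<delta>\<^sup>2 = 1 / real N" by (auto simp: \<delta>_def power_divide)
    \<comment> \<open>The part common to the interpolations at \<open>j / N\<close> and
      \<open>(j + 1) / N\<close>. An extra variance \<open>1 / N\<close> on \<open>A\<close>
      completes it to the later time, the same on \<open>B\<close> to the earlier time.\<close>
    define c where "c k = (if k \<in> A then sqrt (real j / real N) else sqrt ((real N - 1 - real j) / real N))" for k
    have rewr: "?S (\<lambda>k\<in>K. c k * g k + (if k \<in> D then \<delta> else 0) * h k)
        = (\<lambda>t. ?S (\<lambda>k. c k * g k) t + \<delta> * (\<Sum>k\<in>K. rest D t k * h k))" for D g h
    proof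
      fix t
      have "?S (\<lambda>k\<in>K. c k * g k + (if k \<in> D then \<delta> else 0) * h k) t
          = (\<Sum>k\<in>K. l t k * (c k * g k) + \<delta> * (rest D t k * h k))"
        by (intro sum.cong) (auto simp: rest_def algebra_simps)
      then show "?S (\<lambda>k\<in>K. c k * g k + (if k \<in> D then \<delta> else 0) * h k) t
          = ?S (\<lambda>k. c k * g k) t + \<delta> * (\<Sum>k\<in>K. rest D t k * h k)"
        by (simp add: sum.distrib sum_distrib_left)
    qed
    let ?I = "\<lambda>D g. \<integral>h. \<Psi> (\<lambda>t. ?S (\<lambda>k. c k * g k) t + \<delta> * (\<Sum>k\<in>K. rest D t k * h k)) \<partial>gauss K"
    have conv: "m s = (\<integral>g. ?I D g \<partial>gauss K)
        \<and> integrable (gauss K) (\<lambda>g. ?I D g)"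
      if "\<And>k. k \<in> K \<Longrightarrow> (c k)\<^sup>2 + (if k \<in> D then \<delta> else 0)\<^sup>2 = (if k \<in> A then sqrt s else sqrt (1 - s))\<^sup>2" for s D
    proof -
      let ?c = "\<lambda>k. if k \<in> A then sqrt s else sqrt (1 - s)"
      have "?S (\<lambda>k\<in>K. ?c k * g k) = (\<lambda>t. \<Sum>k\<in>K. l t k * (?c k * g k))" for g
        by (intro ext sum.cong) auto
      then have "m s = (\<integral>g. \<Psi> (?S (\<lambda>k\<in>K. ?c k * g k)) \<partial>gauss K)"
        unfolding m_def by simp
      moreover note gauss_linear_comb_integral[where a = c and b = "\<lambda>k. if k \<in> D then \<delta> else 0" and c = ?c,
          OF K that f int, unfolded rewr]
      ultimately show ?thesis by (intro conjI) (simp_all only:)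
    qed
    have jN: "real j + 1 \<le> real N" using that by linarith
    have sq: "(sqrt (real j / real N))\<^sup>2 = real j / real N"
      "(sqrt ((real N - 1 - real j) / real N))\<^sup>2 = (real N - 1 - real j) / real N"
      "(sqrt ((real j + 1) / real N))\<^sup>2 = (real j + 1) / real N"
      "(sqrt (1 - (real j + 1) / real N))\<^sup>2 = (real N - 1 - real j) / real N"
      "(sqrt (1 - real j / real N))\<^sup>2 = (real N - real j) / real N"
      using jN N by (simp_all add: diff_divide_distrib add_divide_distrib) (simp_all add: field_simps)
    have A: "m ((real j + 1) / real N) = (\<integral>g. ?I A g \<partial>gauss K)"
      "integrable (gauss K) (\<lambda>g. ?I A g)"
    proof -
      have "(c k)\<^sup>2 + (if k \<in> A then \<delta> else 0)\<^sup>2 = (if k \<in> A then sqrt ((real j + 1) / real N) else sqrt (1 - (real j + 1) / real N))\<^sup>2"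
        for k
        unfolding c_def by (cases "k \<in> A", simp_all only: if_True if_False sq \<delta>(2)) (simp_all add: add_divide_distrib)
      from conv[OF this] show "m ((real j + 1) / real N) = (\<integral>g. ?I A g \<partial>gauss K)"
      "integrable (gauss K) (\<lambda>g. ?I A g)"
        by blast+
    qed
    have B: "m (real j / real N) = (\<integral>g. ?I B g \<partial>gauss K)"
      "integrable (gauss K) (\<lambda>g. ?I B g)"
    proof -
      have "(c k)\<^sup>2 + (if k \<in> B then \<delta> else 0)\<^sup>2 = (if k \<in> A then sqrt (real j / real N) else sqrt (1 - real j / real N))\<^sup>2"
        if "k \<in> K" for k
      proof -
        have "k \<in> B \<longleftrightarrow> k \<notin> A" using AB that by auto
        then show ?thesis
          unfolding c_def by (cases "k \<in> A", simp_all only: if_True if_False sq \<delta>(2) not_True_eq_False not_False_eq_True)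
            (simp_all add: add_divide_distrib diff_divide_distrib)
      qed
      from conv[OF this] show "m (real j / real N) = (\<integral>g. ?I B g \<partial>gauss K)"
      "integrable (gauss K) (\<lambda>g. ?I B g)"
        by blast+
    qed
    let ?bd = "- \<kappa> / (2 * real N) - C * \<delta> ^ 3 * (Q A + Q B)"
    \<comment> \<open>Both increments start from the same frozen \<open>w\<close>, so
      \<open>\<Psi> w\<close> cancels and only the difference of the second-order terms
      remains.\<close>
    have low: "?bd \<le> (\<integral>h. \<Psi> (\<lambda>t. w t + \<delta> * (\<Sum>k\<in>K. rest A t k * h k)) \<partial>gauss K)
        - (\<integral>h. \<Psi> (\<lambda>t. w t + \<delta> * (\<Sum>k\<in>K. rest B t k * h k)) \<partial>gauss K)" for w
    proof -
      let ?X = "\<lambda>D. \<Sum>t\<in>T. \<Sum>s\<in>T. D2 w t s * (\<Sum>k\<in>D. l t k * l s k)"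
      have D: "A \<subseteq> K" "B \<subseteq> K" using AB by auto
      have "- \<kappa> \<le> ?X A - ?X B"
        using cov[of w] by (simp add: right_diff_distrib sum_subtractf)
      from mult_left_mono[OF this, of "\<delta>\<^sup>2 / 2"]
      have "- \<kappa> / (2 * real N) \<le> \<delta>\<^sup>2 / 2 * ?X A - \<delta>\<^sup>2 / 2 * ?X B"
        by (simp add: \<delta>(2) right_diff_distrib)
      moreover have "C * \<delta> ^ 3 * (Q A + Q B) = C * \<delta> ^ 3 * Q A + C * \<delta> ^ 3 * Q B"
        by (simp add: distrib_left)
      moreover note expected_increment[OF K \<delta>(1), of w "rest A", folded Q_def, unfolded cov_rest[OF D(1)]]
        expected_increment[OF K \<delta>(1), of w "rest B", folded Q_def, unfolded cov_rest[OF D(2)]]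
      ultimately show ?thesis by linarith
    qed
    have "?bd = (\<integral>g. ?bd \<partial>gauss K)" by (simp add: G.prob_space)
    also have "\<dots> \<le> (\<integral>g. ?I A g
        - ?I B g \<partial>gauss K)"
      by (intro integral_mono low Bochner_Integration.integrable_diff A(2) B(2) G.integrable_const)
    also have "\<dots> = m ((real j + 1) / real N) - m (real j / real N)"
      unfolding A(1) B(1) by (intro Bochner_Integration.integral_diff A(2) B(2))
    finally show ?thesis unfolding \<delta>_def by simp
  qed
  have "m 1 - m 0 \<ge> - \<kappa> / 2 - C * (Q A + Q B) * (1 / sqrt (real N))" if "1 \<le> N" for N
  proof -
    let ?e = "- \<kappa> / (2 * real N) - C * (1 / sqrt (real N)) ^ 3 * (Q A + Q B)"
    have "(\<Sum>j<N. ?e) \<le> (\<Sum>j<N. m (real (Suc j) / real N) - m (real j / real N))"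
      by (intro sum_mono) (use step in \<open>auto simp: add.commute\<close>)
    also have "\<dots> = m 1 - m 0"
      using that by (subst sum_lessThan_telescope[of "\<lambda>j. m (real j / real N)"]) simp
    finally have "real N * ?e \<le> m 1 - m 0" by simp
    moreover have "real N * (1 / sqrt (real N)) ^ 3 = 1 / sqrt (real N)"
      using that by (simp add: power3_eq_cube field_simps)
    moreover have "real N * ?e = - \<kappa> / 2 - (real N * (1 / sqrt (real N)) ^ 3) * (C * (Q A + Q B))"
      using that by (simp add: field_simps)
    ultimately show ?thesis by (simp add: mult.commute)
  qed
  moreover have "(\<lambda>N. - \<kappa> / 2 - C * (Q A + Q B) * (1 / sqrt (real N))) \<longlonglongrightarrow> - \<kappa> / 2 - C * (Q A + Q B) * 0"
    by (intro tendsto_intros filterlim_compose[OF _ filterlim_real_sequentially] tendsto_divide_0[OF tendsto_const]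
        filterlim_at_top_imp_at_infinity filterlim_compose[OF sqrt_at_top filterlim_real_sequentially])
  ultimately have "- \<kappa> / 2 \<le> m 1 - m 0"
    by (intro LIMSEQ_le_const2[of _ "- \<kappa> / 2"]) auto
  moreover have "m 1 = (\<integral>g. \<Psi> (\<lambda>t. \<Sum>k\<in>A. l t k * g k) \<partial>gauss K)"
  proof -
    have "(\<Sum>k\<in>K. l t k * ((if k \<in> A then sqrt 1 else sqrt (1 - 1)) * g k)) = (\<Sum>k\<in>A. l t k * g k)" for t g
      using AB by (subst sum_rest[symmetric]) (auto simp: rest_def intro!: sum.cong)
    then show ?thesis unfolding m_def by simp
  qed
  moreover have "m 0 = (\<integral>g. \<Psi> (\<lambda>t. \<Sum>k\<in>B. l t k * g k) \<partial>gauss K)"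
  proof -
    have "(\<Sum>k\<in>K. l t k * ((if k \<in> A then sqrt 0 else sqrt (1 - 0)) * g k)) = (\<Sum>k\<in>B. l t k * g k)" for t g
      using AB by (subst sum_rest[symmetric]) (auto simp: rest_def intro!: sum.cong)
    then show ?thesis unfolding m_def by simp
  qed
  ultimately show ?thesis by linarith
qed

end

section \<open>Softmax\<close>

text \<open>Applied along the segment from \<open>w\<close> to \<open>w + v\<close>, this yields the
  \<open>expansion\<close> condition. The factor 1/6 of the Lagrange remainder is given
  away.\<close>

lemma taylor_third_order:
  fixes h h1 h2 h3 :: "real \<Rightarrow> real"
  assumes d: "\<And>s. (h has_real_derivative h1 s) (at s)" "\<And>s. (h1 has_real_derivative h2 s) (at s)"
      "\<And>s. (h2 has_real_derivative h3 s) (at s)"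
    and B: "\<And>s. \<bar>h3 s\<bar> \<le> B"
  shows "\<bar>h 1 - h 0 - h1 0 - h2 0 / 2\<bar> \<le> B"
proof -
  let ?diff = "\<lambda>m::nat. if m = 0 then h else if m = 1 then h1 else if m = 2 then h2 else h3"
  have "\<exists>t. 0 < t \<and> t < 1 \<and> h 1 = (\<Sum>m<3. ?diff m 0 / fact m * 1 ^ m) + ?diff 3 t / fact 3 * 1 ^ 3"
  proof (rule Maclaurin)
    show "\<forall>m t. m < 3 \<and> 0 \<le> t \<and> t \<le> 1 \<longrightarrow> (?diff m has_real_derivative ?diff (Suc m) t) (at t)"
      using d by (auto simp: numeral_3_eq_3 numeral_2_eq_2 less_Suc_eq)
  qed auto
  then obtain t where "h 1 = (\<Sum>m<3. ?diff m 0 / fact m * 1 ^ m) + ?diff 3 t / fact 3 * 1 ^ 3"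
    by blast
  then have "h 1 - h 0 - h1 0 - h2 0 / 2 = h3 t / 6"
    by (simp add: numeral_3_eq_3 fact_numeral)
  with B[of t] show ?thesis by simp
qed

definition lse :: "real \<Rightarrow> 't set \<Rightarrow> ('t \<Rightarrow> real) \<Rightarrow> real" where
  "lse \<beta> T w = ln (\<Sum>t\<in>T. exp (\<beta> * w t)) / \<beta>"

definition gibbs :: "real \<Rightarrow> 't set \<Rightarrow> ('t \<Rightarrow> real) \<Rightarrow> 't \<Rightarrow> real" where
  "gibbs \<beta> T w t = exp (\<beta> * w t) / (\<Sum>s\<in>T. exp (\<beta> * w s))"

context
  fixes \<beta> :: real and T :: "'t set"
  assumes \<beta>: "0 < \<beta>" and T: "finite T" "T \<noteq> {}"
begin

lemma partition_sum_pos: "0 < (\<Sum>t\<in>T. exp (\<beta> * w t))"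
  using T by (intro sum_pos) auto

lemma gibbs_nonneg: "0 \<le> gibbs \<beta> T w t"
  unfolding gibbs_def using partition_sum_pos[of w] by (intro divide_nonneg_pos) auto

lemma sum_gibbs: "(\<Sum>t\<in>T. gibbs \<beta> T w t) = 1"
  unfolding gibbs_def using partition_sum_pos[of w] by (simp add: sum_divide_distrib[symmetric])

text \<open>The error depends on the process only through the size of \<open>T\<close>, so for fixed
  finite \<open>T\<close> it disappears as \<open>\<beta>\<close> grows.\<close>

lemma lse_bounds:
  "Max (w ` T) \<le> lse \<beta> T w" "lse \<beta> T w \<le> Max (w ` T) + ln (real (card T)) / \<beta>"
proof -
  have "Max (w ` T) \<in> w ` T" using T by simp
  then obtain t where t: "t \<in> T" "Max (w ` T) = w t" by auto
  have "exp (\<beta> * w t) \<le> (\<Sum>t\<in>T. exp (\<beta> * w t))"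
    using T t by (intro member_le_sum) auto
  then have "ln (exp (\<beta> * w t)) \<le> ln (\<Sum>t\<in>T. exp (\<beta> * w t))"
    by (subst ln_le_cancel_iff) (use partition_sum_pos[of w] in auto)
  then show "Max (w ` T) \<le> lse \<beta> T w"
    using \<beta> by (simp add: t lse_def field_simps)
  have "(\<Sum>s\<in>T. exp (\<beta> * w s)) \<le> (\<Sum>s\<in>T. exp (\<beta> * w t))"
    using \<beta> T by (intro sum_mono) (auto simp: t(2)[symmetric])
  then have "(\<Sum>s\<in>T. exp (\<beta> * w s)) \<le> real (card T) * exp (\<beta> * w t)" by simp
  then have "ln (\<Sum>s\<in>T. exp (\<beta> * w s)) \<le> ln (real (card T) * exp (\<beta> * w t))"
    by (subst ln_le_cancel_iff) (use partition_sum_pos[of w] T in \<open>auto simp: card_gt_0_iff\<close>)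
  also have "\<dots> = ln (real (card T)) + \<beta> * w t"
    using T by (subst ln_mult) (auto simp: card_gt_0_iff)
  finally show "lse \<beta> T w \<le> Max (w ` T) + ln (real (card T)) / \<beta>"
    using \<beta> by (simp add: t lse_def field_simps)
qed

lemma abs_Max_le: "\<bar>Max (w ` T)\<bar> \<le> (\<Sum>t\<in>T. \<bar>w t\<bar>)" for w :: "'t \<Rightarrow> real"
proof -
  have "Max (w ` T) \<in> w ` T" using T by simp
  then obtain t where t: "t \<in> T" "Max (w ` T) = w t" by auto
  show ?thesis unfolding t(2) using T t by (intro member_le_sum) auto
qed

lemma abs_lse_le: "\<bar>lse \<beta> T w\<bar> \<le> ln (real (card T)) / \<beta> + (\<Sum>t\<in>T. \<bar>w t\<bar>)"
proof -
  have "1 \<le> real (card T)" using T by (simp add: Suc_leI card_gt_0_iff)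
  then have "0 \<le> ln (real (card T)) / \<beta>" using \<beta> by simp
  then show ?thesis
    using lse_bounds[of w] abs_Max_le[of w] by (simp add: abs_le_iff)
qed

text \<open>Along a line, the derivatives are, up to powers of \<open>\<beta>\<close>, the first
  three cumulants of \<open>v\<close> under the Gibbs weights. All moments are at most powers of
  \<open>V\<close>, and the constants add the cumulant coefficients: 2 = 1 + 1 and 6 = 1 + 3 +
  2.\<close>

lemma lse_line_derivatives:
  fixes w v :: "'t \<Rightarrow> real"
  assumes V: "(\<Sum>t\<in>T. \<bar>v t\<bar>) \<le> V"
  obtains f1 f2 f3 where
    "\<And>s. ((\<lambda>s. lse \<beta> T (\<lambda>t. w t + s * v t)) has_real_derivative f1 s) (at s)"
    "\<And>s. (f1 has_real_derivative f2 s) (at s)" "\<And>s. (f2 has_real_derivative f3 s) (at s)"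
    "f1 0 = (\<Sum>t\<in>T. gibbs \<beta> T w t * v t)"
    "f2 0 = \<beta> * ((\<Sum>t\<in>T. gibbs \<beta> T w t * (v t)\<^sup>2) - (\<Sum>t\<in>T. gibbs \<beta> T w t * v t)\<^sup>2)"
    "\<And>s. \<bar>f1 s\<bar> \<le> V" "\<And>s. \<bar>f2 s\<bar> \<le> 2 * \<beta> * V\<^sup>2" "\<And>s. \<bar>f3 s\<bar> \<le> 6 * \<beta>\<^sup>2 * V ^ 3"
proof -
  \<comment> \<open>\<open>Z j\<close> is the unnormalized and \<open>m j\<close> the normalized
    \<open>j\<close>-th moment of \<open>v\<close> under the weights at \<open>w + s v\<close>.
    Differentiating \<open>Z j\<close> raises \<open>j\<close> by one and brings out a factor
    \<open>\<beta>\<close>.\<close>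
  define Z where "Z j s = (\<Sum>t\<in>T. v t ^ j * exp (\<beta> * (w t + s * v t)))" for j s
  define m where "m j s = Z j s / Z 0 s" for j s
  have Z0: "0 < Z 0 s" for s
    using partition_sum_pos[of "\<lambda>t. w t + s * v t"] by (simp add: Z_def)
  have dZ: "(Z j has_real_derivative \<beta> * Z (Suc j) s) (at s)" for j s
  proof -
    have "((\<lambda>s. \<Sum>t\<in>T. v t ^ j * exp (\<beta> * (w t + s * v t))) has_real_derivative
        (\<Sum>t\<in>T. v t ^ j * (exp (\<beta> * (w t + s * v t)) * (\<beta> * v t)))) (at s)"
      by (intro DERIV_sum) (auto intro!: derivative_eq_intros)
    moreover have "(\<Sum>t\<in>T. v t ^ j * (exp (\<beta> * (w t + s * v t)) * (\<beta> * v t))) = \<beta> * Z (Suc j) s"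
      unfolding Z_def sum_distrib_left by (intro sum.cong) (auto simp: algebra_simps)
    ultimately show ?thesis unfolding Z_def by simp
  qed
  have m0: "m 0 s = 1" for s using Z0[of s] by (simp add: m_def)
  have dm: "(m j has_real_derivative \<beta> * (m (Suc j) s - m j s * m 1 s)) (at s)" for j s
  proof -
    have "((\<lambda>s. Z j s / Z 0 s) has_real_derivative
        (\<beta> * Z (Suc j) s * Z 0 s - Z j s * (\<beta> * Z (Suc 0) s)) / (Z 0 s * Z 0 s)) (at s)"
      using Z0[of s] by (intro DERIV_divide dZ) auto
    moreover have "(\<beta> * Z (Suc j) s * Z 0 s - Z j s * (\<beta> * Z (Suc 0) s)) / (Z 0 s * Z 0 s)
        = \<beta> * (m (Suc j) s - m j s * m 1 s)"
      using Z0[of s] unfolding m_def by (simp add: field_simps)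
    ultimately show ?thesis unfolding m_def by simp
  qed
  have mb: "\<bar>m j s\<bar> \<le> V ^ j" for j s
  proof -
    have "\<bar>Z j s\<bar> \<le> (\<Sum>t\<in>T. \<bar>v t ^ j * exp (\<beta> * (w t + s * v t))\<bar>)"
      unfolding Z_def by (rule sum_abs)
    also have "\<dots> \<le> (\<Sum>t\<in>T. V ^ j * exp (\<beta> * (w t + s * v t)))"
    proof (intro sum_mono)
      fix t assume "t \<in> T"
      then have "\<bar>v t\<bar> \<le> (\<Sum>t\<in>T. \<bar>v t\<bar>)" using T by (intro member_le_sum) auto
      with V have "\<bar>v t\<bar> \<le> V" by linarith
      then show "\<bar>v t ^ j * exp (\<beta> * (w t + s * v t))\<bar> \<le> V ^ j * exp (\<beta> * (w t + s * v t))"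
        by (simp add: abs_mult power_abs power_mono)
    qed
    also have "\<dots> = V ^ j * Z 0 s" by (simp add: Z_def sum_distrib_left)
    finally show ?thesis using Z0[of s] by (simp add: m_def abs_divide field_simps)
  qed
  define f2 where "f2 s = \<beta> * (m 2 s - m 1 s * m 1 s)" for s
  define f3 where "f3 s = \<beta>\<^sup>2 * (m 3 s - 3 * (m 2 s * m 1 s) + 2 * (m 1 s * m 1 s * m 1 s))" for s
  have V0: "0 \<le> V" using V by (rule order_trans[rotated]) (simp add: sum_nonneg)
  have b: "\<bar>m 1 s\<bar> \<le> V" "\<bar>m 2 s\<bar> \<le> V\<^sup>2" "\<bar>m 3 s\<bar> \<le> V ^ 3" for s
    using mb[of 1 s] mb[of 2 s] mb[of 3 s] by simp_all
  have b11: "\<bar>m 1 s * m 1 s\<bar> \<le> V\<^sup>2" for s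
    unfolding abs_mult power2_eq_square using b V0 by (intro mult_mono) auto
  have b21: "\<bar>m 2 s * m 1 s\<bar> \<le> V ^ 3" for s
    unfolding abs_mult power3_eq_cube using b[unfolded power2_eq_square] V0 by (intro mult_mono) auto
  have b111: "\<bar>m 1 s * m 1 s * m 1 s\<bar> \<le> V ^ 3" for s
    using mult_mono[OF b11[of s] b(1)[of s]] V0 by (simp add: abs_mult power3_eq_cube power2_eq_square)
  show thesis
  proof (rule that)
    show "((\<lambda>s. lse \<beta> T (\<lambda>t. w t + s * v t)) has_real_derivative m 1 s) (at s)" for s
    proof -
      have "((\<lambda>s. ln (Z 0 s) / \<beta>) has_real_derivative (\<beta> * Z (Suc 0) s) / Z 0 s / \<beta>) (at s)"
        by (auto intro!: derivative_eq_intros dZ Z0 simp: field_simps)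
      then show ?thesis using \<beta> by (simp add: m_def lse_def Z_def)
    qed
    show d1: "(m 1 has_real_derivative f2 s) (at s)" for s
      using dm[of 1 s] by (simp add: f2_def numeral_2_eq_2)
    show "(f2 has_real_derivative f3 s) (at s)" for s
    proof -
      have "(f2 has_real_derivative \<beta> * (\<beta> * (m 3 s - m 2 s * m 1 s) - (f2 s * m 1 s + m 1 s * f2 s))) (at s)"
        unfolding f2_def [abs_def]
        using dm[of 2 s] d1[of s, unfolded f2_def] by (auto intro!: derivative_eq_intros simp: numeral_3_eq_3 numeral_2_eq_2)
      moreover have "\<beta> * (\<beta> * (m 3 s - m 2 s * m 1 s) - (f2 s * m 1 s + m 1 s * f2 s)) = f3 s"
        unfolding f2_def f3_def power2_eq_square by algebra
      ultimately show ?thesis by simp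
    qed
    show e1: "m 1 0 = (\<Sum>t\<in>T. gibbs \<beta> T w t * v t)"
      by (simp add: m_def Z_def gibbs_def sum_divide_distrib mult.commute)
    have "m 2 0 = (\<Sum>t\<in>T. gibbs \<beta> T w t * (v t)\<^sup>2)"
      by (simp add: m_def Z_def gibbs_def sum_divide_distrib mult.commute)
    with e1 show "f2 0 = \<beta> * ((\<Sum>t\<in>T. gibbs \<beta> T w t * (v t)\<^sup>2) - (\<Sum>t\<in>T. gibbs \<beta> T w t * v t)\<^sup>2)"
      unfolding f2_def by (simp add: power2_eq_square)
    show "\<bar>m 1 s\<bar> \<le> V" for s by (rule b)
    show "\<bar>f2 s\<bar> \<le> 2 * \<beta> * V\<^sup>2" for s
    proof -
      have "\<bar>m 2 s - m 1 s * m 1 s\<bar> \<le> 2 * V\<^sup>2" using b(2)[of s] b11[of s] by linarith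
      from mult_left_mono[OF this, of \<beta>] show ?thesis using \<beta> by (simp add: f2_def abs_mult)
    qed
    show "\<bar>f3 s\<bar> \<le> 6 * \<beta>\<^sup>2 * V ^ 3" for s
    proof -
      have "\<bar>m 3 s - 3 * (m 2 s * m 1 s) + 2 * (m 1 s * m 1 s * m 1 s)\<bar> \<le> 6 * V ^ 3"
        using b(3)[of s] b21[of s] b111[of s] by linarith
      from mult_left_mono[OF this, of "\<beta>\<^sup>2"] show ?thesis by (simp add: f3_def abs_mult)
    qed
  qed
qed

text \<open>The matrix is \<open>diag p - p p^T\<close>. For Gibbs weights its quadratic form is a
  variance, and \<open>\<beta>\<close> times it is the Hessian of \<open>lse\<close>.\<close>

lemma sum_gibbs_covariance:
  "(\<Sum>t\<in>T. \<Sum>s\<in>T. ((if t = s then p t else 0) - p t * p s) * (v t * v s))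
     = (\<Sum>t\<in>T. p t * (v t)\<^sup>2) - (\<Sum>t\<in>T. p t * v t)\<^sup>2" for p v :: "'t \<Rightarrow> real"
proof -
  have "(\<Sum>s\<in>T. ((if t = s then p t else 0) - p t * p s) * (v t * v s))
      = p t * (v t)\<^sup>2 - (p t * v t) * (\<Sum>s\<in>T. p s * v s)" if "t \<in> T" for t
  proof -
    have "(\<Sum>s\<in>T. ((if t = s then p t else 0) - p t * p s) * (v t * v s))
        = (\<Sum>s\<in>T. (if t = s then p t * (v t)\<^sup>2 else 0) - (p t * v t) * (p s * v s))"
      by (intro sum.cong) (auto simp: power2_eq_square algebra_simps)
    then show ?thesis using T that by (simp add: sum_subtractf sum_distrib_left)
  qed
  then have "(\<Sum>t\<in>T. \<Sum>s\<in>T. ((if t = s then p t else 0) - p t * p s) * (v t * v s))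
      = (\<Sum>t\<in>T. p t * (v t)\<^sup>2 - (p t * v t) * (\<Sum>s\<in>T. p s * v s))"
    by (intro sum.cong) auto
  then show ?thesis by (simp add: sum_subtractf sum_distrib_right[symmetric] power2_eq_square)
qed

lemma measurable_lse:
  "(\<lambda>w. lse \<beta> T (\<lambda>t. w t + c t)) \<in> borel_measurable (PiM T (\<lambda>_. borel))"
  unfolding lse_def
  by (intro borel_measurable_divide borel_measurable_ln borel_measurable_sum borel_measurable_const
      measurable_compose[OF _ borel_measurable_exp] borel_measurable_times borel_measurable_add measurable_component_singleton)

text \<open>The deterministic shift \<open>c\<close> will hold the penalty. The remainder constant
  is the bound on the third derivative along a line, with \<open>V\<close> the sum of the absolute
  increments.\<close>

lemma lindeberg_lse:
  "lindeberg_function T (\<lambda>w. lse \<beta> T (\<lambda>t. w t + c t)) (\<lambda>w. gibbs \<beta> T (\<lambda>t. w t + c t))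
     (\<lambda>w t s. \<beta> * ((if t = s then gibbs \<beta> T (\<lambda>t. w t + c t) t else 0)
        - gibbs \<beta> T (\<lambda>t. w t + c t) t * gibbs \<beta> T (\<lambda>t. w t + c t) s))
     (ln (real (card T)) / \<beta> + (\<Sum>t\<in>T. \<bar>c t\<bar>)) 1 (6 * \<beta>\<^sup>2)"
proof (unfold_locales)
  show "finite T" by (rule T)
  show "(\<lambda>w. lse \<beta> T (\<lambda>t. w t + c t)) \<in> borel_measurable (PiM T (\<lambda>_. borel))"
    by (rule measurable_lse)
  show "lse \<beta> T (\<lambda>t. restrict w T t + c t) = lse \<beta> T (\<lambda>t. w t + c t)" for w
    by (simp add: lse_def)
  show "\<bar>lse \<beta> T (\<lambda>t. w t + c t)\<bar> \<le> ln (real (card T)) / \<beta> + (\<Sum>t\<in>T. \<bar>c t\<bar>) + 1 * (\<Sum>t\<in>T. \<bar>w t\<bar>)" for w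
  proof -
    have "(\<Sum>t\<in>T. \<bar>w t + c t\<bar>) \<le> (\<Sum>t\<in>T. \<bar>w t\<bar> + \<bar>c t\<bar>)"
      by (intro sum_mono abs_triangle_ineq)
    then show ?thesis
      using abs_lse_le[of "\<lambda>t. w t + c t"] by (simp add: sum.distrib)
  qed
  fix w v :: "'t \<Rightarrow> real"
  let ?p = "gibbs \<beta> T (\<lambda>t. w t + c t)"
  obtain f1 f2 f3 where f:
    "\<And>s. ((\<lambda>s. lse \<beta> T (\<lambda>t. (w t + c t) + s * v t)) has_real_derivative f1 s) (at s)"
    "\<And>s. (f1 has_real_derivative f2 s) (at s)" "\<And>s. (f2 has_real_derivative f3 s) (at s)"
    "f1 0 = (\<Sum>t\<in>T. ?p t * v t)"
    "f2 0 = \<beta> * ((\<Sum>t\<in>T. ?p t * (v t)\<^sup>2) - (\<Sum>t\<in>T. ?p t * v t)\<^sup>2)"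
    "\<And>s. \<bar>f3 s\<bar> \<le> 6 * \<beta>\<^sup>2 * (\<Sum>t\<in>T. \<bar>v t\<bar>) ^ 3"
    by (rule lse_line_derivatives[OF order_refl, where v = v and w = "\<lambda>t. w t + c t"]) (rule that; assumption)
  have "f2 0 = (\<Sum>t\<in>T. \<Sum>s\<in>T. \<beta> * ((if t = s then ?p t else 0) - ?p t * ?p s) * (v t * v s))"
    unfolding f(5) sum_gibbs_covariance[symmetric] by (simp add: sum_distrib_left mult.assoc)
  with taylor_third_order[OF f(1-3,6)] f(4)
  show "\<bar>lse \<beta> T (\<lambda>t. w t + v t + c t) - lse \<beta> T (\<lambda>t. w t + c t) - (\<Sum>t\<in>T. ?p t * v t)
      - (\<Sum>t\<in>T. \<Sum>s\<in>T. \<beta> * ((if t = s then ?p t else 0) - ?p t * ?p s) * (v t * v s)) / 2\<bar>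
      \<le> 6 * \<beta>\<^sup>2 * (\<Sum>t\<in>T. \<bar>v t\<bar>) ^ 3"
    by (simp add: add_ac)
qed simp

end

text \<open>\<open>r\<close> is a smooth majorant of the absolute value with \<open>r 0 = 1\<close>.
  The bound 1 on its second derivative is what later determines the constant in the concentration
  estimate.\<close>

lemma sqrt_one_plus_square_derivatives:
  fixes x :: real
  defines "r \<equiv> \<lambda>x::real. sqrt (1 + x\<^sup>2)"
  shows "(r has_real_derivative x / r x) (at x)"
    "((\<lambda>x. x / r x) has_real_derivative 1 / r x ^ 3) (at x)"
    "((\<lambda>x. 1 / r x ^ 3) has_real_derivative - 3 * x / r x ^ 5) (at x)"
    "\<bar>x / r x\<bar> \<le> 1" "\<bar>1 / r x ^ 3\<bar> \<le> 1" "\<bar>- 3 * x / r x ^ 5\<bar> \<le> 3"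
proof -
  have pos: "0 < 1 + x\<^sup>2" for x :: real by (rule add_pos_nonneg) auto
  then have r0: "0 < r x" and r2: "r x * r x = 1 + x\<^sup>2" for x by (auto simp: r_def)
  show d: "(r has_real_derivative x / r x) (at x)" for x
    unfolding r_def using pos[of x] by (auto intro!: derivative_eq_intros simp: field_simps)
  have "((\<lambda>x. x / r x) has_real_derivative (1 * r x - x * (x / r x)) / (r x * r x)) (at x)"
    using r0[of x] by (intro DERIV_divide DERIV_ident d) auto
  moreover have "(1 * r x - x * (x / r x)) / (r x * r x) = 1 / r x ^ 3"
  proof -
    have "(1 * r x - x * (x / r x)) = (r x * r x - x\<^sup>2) / r x"
      using r0[of x] by (simp add: field_simps power2_eq_square)
    also have "\<dots> = 1 / r x" by (simp add: r2)
    finally show ?thesis by (simp add: power3_eq_cube)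
  qed
  ultimately show "((\<lambda>x. x / r x) has_real_derivative 1 / r x ^ 3) (at x)" by simp
  have "((\<lambda>x. 1 / r x ^ 3) has_real_derivative (0 * r x ^ 3 - 1 * (of_nat 3 * ((x / r x) * r x ^ (3 - Suc 0)))) / (r x ^ 3 * r x ^ 3)) (at x)"
    using r0[of x] by (intro DERIV_divide DERIV_const DERIV_power d) auto
  moreover have "(0 * r x ^ 3 - 1 * (of_nat 3 * ((x / r x) * r x ^ (3 - Suc 0)))) / (r x ^ 3 * r x ^ 3) = - 3 * x / r x ^ 5"
    using r0[of x] by (simp add: field_simps eval_nat_numeral)
  ultimately show "((\<lambda>x. 1 / r x ^ 3) has_real_derivative - 3 * x / r x ^ 5) (at x)" by simp
  have r1: "1 \<le> r x" unfolding r_def by simp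
  have xr: "\<bar>x\<bar> \<le> r x" unfolding r_def by (rule real_le_rsqrt) simp
  show "\<bar>x / r x\<bar> \<le> 1" using r0[of x] xr by (simp add: abs_divide)
  show "\<bar>1 / r x ^ 3\<bar> \<le> 1" using r0[of x] one_le_power[OF r1, of 3] by (simp add: abs_divide)
  have "\<bar>x\<bar> \<le> r x * r x ^ 4"
    using xr one_le_power[OF r1, of 4] r0[of x] by (metis less_eq_real_def mult.right_neutral mult_left_mono order_trans)
  then show "\<bar>- 3 * x / r x ^ 5\<bar> \<le> 3"
    using r0[of x] by (simp add: abs_divide abs_mult divide_le_eq eval_nat_numeral)
qed


text \<open>The third derivative of \<open>r (d s)\<close> is
  \<open>r''' d1^3 + 3 r'' d1 d2 + r' d3\<close>; with the bounds 3, 1, 1 on the derivatives of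
  \<open>r\<close> this gives the three terms of the remainder.\<close>

lemma sqrt_line_derivatives:
  fixes d :: "real \<Rightarrow> real"
  defines "r \<equiv> \<lambda>x::real. sqrt (1 + x\<^sup>2)"
  assumes d: "\<And>s. (d has_real_derivative d1 s) (at s)" "\<And>s. (d1 has_real_derivative d2 s) (at s)"
      "\<And>s. (d2 has_real_derivative d3 s) (at s)"
    and b: "\<And>s. \<bar>d1 s\<bar> \<le> B1" "\<And>s. \<bar>d2 s\<bar> \<le> B2" "\<And>s. \<bar>d3 s\<bar> \<le> B3"
  shows "\<bar>r (d 1) - r (d 0) - d 0 / r (d 0) * d1 0
      - ((d1 0)\<^sup>2 / r (d 0) ^ 3 + d 0 / r (d 0) * d2 0) / 2\<bar> \<le> 3 * B1 ^ 3 + 3 * B1 * B2 + B3"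
proof -
  have r: "(r has_real_derivative x / r x) (at x)"
    "((\<lambda>x. x / r x) has_real_derivative 1 / r x ^ 3) (at x)"
    "((\<lambda>x. 1 / r x ^ 3) has_real_derivative - 3 * x / r x ^ 5) (at x)"
    "\<bar>x / r x\<bar> \<le> 1" "\<bar>1 / r x ^ 3\<bar> \<le> 1" "\<bar>- 3 * x / r x ^ 5\<bar> \<le> 3" for x
    unfolding r_def by (rule sqrt_one_plus_square_derivatives)+
  have B0: "0 \<le> B1" "0 \<le> B2" using b(1,2)[of 0] by linarith+
  let ?h1 = "\<lambda>s. d s / r (d s) * d1 s"
  let ?h2 = "\<lambda>s. 1 / r (d s) ^ 3 * (d1 s)\<^sup>2 + d s / r (d s) * d2 s"
  let ?h3 = "\<lambda>s. - 3 * d s / r (d s) ^ 5 * (d1 s) ^ 3 + 3 * (1 / r (d s) ^ 3 * (d1 s * d2 s)) + d s / r (d s) * d3 s"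
  have "\<bar>r (d 1) - r (d 0) - ?h1 0 - ?h2 0 / 2\<bar> \<le> 3 * B1 ^ 3 + 3 * B1 * B2 + B3"
  proof (rule taylor_third_order[where h = "\<lambda>s. r (d s)" and ?h1.0 = ?h1 and ?h2.0 = ?h2 and ?h3.0 = ?h3])
    fix s
    show "((\<lambda>s. r (d s)) has_real_derivative ?h1 s) (at s)"
      by (rule DERIV_chain2[OF r(1) d(1)])
    have c1: "((\<lambda>s. d s / r (d s)) has_real_derivative 1 / r (d s) ^ 3 * d1 s) (at s)"
      by (rule DERIV_chain2[OF r(2) d(1)])
    have c2: "((\<lambda>s. 1 / r (d s) ^ 3) has_real_derivative - 3 * d s / r (d s) ^ 5 * d1 s) (at s)"
      by (rule DERIV_chain2[OF r(3) d(1)])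
    have sq: "((\<lambda>s. (d1 s)\<^sup>2) has_real_derivative 2 * d1 s * d2 s) (at s)"
      by (rule DERIV_cong[OF DERIV_power[OF d(2)]]) simp
    show "(?h1 has_real_derivative ?h2 s) (at s)"
      by (rule DERIV_cong[OF DERIV_mult[OF c1 d(2)]]) (simp add: power2_eq_square algebra_simps)
    show "(?h2 has_real_derivative ?h3 s) (at s)"
      by (rule DERIV_cong[OF DERIV_add[OF DERIV_mult[OF c2 sq] DERIV_mult[OF c1 d(3)]]])
        (simp add: power2_eq_square power3_eq_cube algebra_simps)
    have "\<bar>- 3 * d s / r (d s) ^ 5 * (d1 s) ^ 3\<bar> \<le> 3 * B1 ^ 3"
      unfolding abs_mult[of _ "(d1 s) ^ 3"] using r(6) power_mono[OF b(1)[of s], of 3] by (intro mult_mono) (auto simp: power_abs)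
    moreover have "\<bar>1 / r (d s) ^ 3 * (d1 s * d2 s)\<bar> \<le> 1 * (B1 * B2)"
      unfolding abs_mult using r(5) b B0 by (intro mult_mono) auto
    moreover have "\<bar>d s / r (d s) * d3 s\<bar> \<le> 1 * B3"
      unfolding abs_mult using r(4) b(3) by (intro mult_mono) auto
    ultimately show "\<bar>?h3 s\<bar> \<le> 3 * B1 ^ 3 + 3 * B1 * B2 + B3" by linarith
  qed
  then show ?thesis by simp
qed

section \<open>Slepian's inequality and concentration of Gaussian maxima\<close>

text \<open>Summing over \<open>A\<close> while \<open>g\<close> may live on a larger index set lets
  two processes built on disjoint blocks share one Gaussian family.\<close>

definition gmax :: "'t set \<Rightarrow> 'k set \<Rightarrow> ('t \<Rightarrow> 'k \<Rightarrow> real) \<Rightarrow> ('t \<Rightarrow> real) \<Rightarrow> ('k \<Rightarrow> real) \<Rightarrow> real" where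
  "gmax T A l c g = Max ((\<lambda>t. (\<Sum>k\<in>A. l t k * g k) + c t) ` T)"

lemma measurable_gmax:
  assumes "finite T" "A \<subseteq> K"
  shows "gmax T A l c \<in> borel_measurable (PiM K (\<lambda>_. borel))"
proof -
  have "(\<lambda>g. (\<Sum>k\<in>A. l t k * g k) + c t) \<in> borel_measurable (PiM K (\<lambda>_. borel))" for t
    using assms(2) by (intro borel_measurable_add borel_measurable_sum borel_measurable_times borel_measurable_const
        measurable_component_singleton) auto
  then show ?thesis unfolding gmax_def [abs_def]
    using assms(1) by (intro borel_measurable_Max) auto
qed

lemma integrable_gmax:
  assumes K: "finite K" "A \<subseteq> K" and T: "finite T" "T \<noteq> {}"
  shows "integrable (gauss K) (gmax T A l c)"
proof (rule Bochner_Integration.integrable_bound)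
  interpret G: prob_space "gauss K" by simp
  show "integrable (gauss K) (\<lambda>g. \<Sum>t\<in>T. (\<Sum>k\<in>A. \<bar>l t k\<bar> * \<bar>g k\<bar>) + \<bar>c t\<bar>)"
    using gauss_moments(3)[OF K(1), of _ 1] K(2)
    by (intro Bochner_Integration.integrable_add G.integrable_const integrable_mult_right
        Bochner_Integration.integrable_sum) auto
  show "gmax T A l c \<in> borel_measurable (gauss K)"
    using measurable_gmax[OF T(1) K(2)] by (simp add: measurable_cong_sets[OF sets_gauss refl])
  have "\<bar>gmax T A l c g\<bar> \<le> (\<Sum>t\<in>T. (\<Sum>k\<in>A. \<bar>l t k\<bar> * \<bar>g k\<bar>) + \<bar>c t\<bar>)" for g
  proof -
    have "\<bar>(\<Sum>k\<in>A. l t k * g k) + c t\<bar> \<le> (\<Sum>k\<in>A. \<bar>l t k\<bar> * \<bar>g k\<bar>) + \<bar>c t\<bar>" for t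
      using sum_abs[of "\<lambda>k. l t k * g k" A] abs_triangle_ineq[of "\<Sum>k\<in>A. l t k * g k" "c t"]
      by (simp add: abs_mult)
    then have "(\<Sum>t\<in>T. \<bar>(\<Sum>k\<in>A. l t k * g k) + c t\<bar>) \<le> (\<Sum>t\<in>T. (\<Sum>k\<in>A. \<bar>l t k\<bar> * \<bar>g k\<bar>) + \<bar>c t\<bar>)"
      by (intro sum_mono)
    with abs_Max_le[OF zero_less_one T, of "\<lambda>t. (\<Sum>k\<in>A. l t k * g k) + c t"] show ?thesis
      unfolding gmax_def by linarith
  qed
  then show "AE g in gauss K. norm (gmax T A l c g) \<le> norm (\<Sum>t\<in>T. (\<Sum>k\<in>A. \<bar>l t k\<bar> * \<bar>g k\<bar>) + \<bar>c t\<bar>)"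
    by (intro AE_I2) (auto intro: order_trans[OF _ abs_ge_self])
qed

text \<open>The off-diagonal entries of the Hessian of \<open>lse\<close> are
  \<open>- \<beta>\<close> times a product of Gibbs weights, hence at most 0, and they meet
  covariance differences that are at most 0; the diagonal is cancelled by the equal variances. So
  \<open>comparison\<close> holds with error 0 for every \<open>\<beta>\<close>, and the softmax
  error vanishes in the limit.\<close>

lemma slepian:
  assumes K: "finite K" and AB: "A \<inter> B = {}" "A \<union> B = K" and T: "finite T" "T \<noteq> {}"
    and var: "\<And>t. t \<in> T \<Longrightarrow> (\<Sum>k\<in>A. l t k * l t k) = (\<Sum>k\<in>B. l t k * l t k)"
    and cov: "\<And>t s. t \<in> T \<Longrightarrow> s \<in> T \<Longrightarrow> (\<Sum>k\<in>A. l t k * l s k) \<le> (\<Sum>k\<in>B. l t k * l s k)"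
  shows "(\<integral>g. gmax T B l c g \<partial>gauss K) \<le> (\<integral>g. gmax T A l c g \<partial>gauss K)"
proof -
  interpret G: prob_space "gauss K" by simp
  have sub: "A \<subseteq> K" "B \<subseteq> K" using AB by auto
  have bound: "(\<integral>g. gmax T B l c g \<partial>gauss K) - ln (real (card T)) / \<beta> \<le> (\<integral>g. gmax T A l c g \<partial>gauss K)" if \<beta>: "0 < \<beta>" for \<beta> :: real
  proof -
    let ?\<Psi> = "\<lambda>w. lse \<beta> T (\<lambda>t. w t + c t)"
    let ?p = "\<lambda>w. gibbs \<beta> T (\<lambda>t. w t + c t)"
    interpret L: lindeberg_function T ?\<Psi> ?p
      "\<lambda>w t s. \<beta> * ((if t = s then ?p w t else 0) - ?p w t * ?p w s)"
      "ln (real (card T)) / \<beta> + (\<Sum>t\<in>T. \<bar>c t\<bar>)" 1 "6 * \<beta>\<^sup>2"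
      by (rule lindeberg_lse[OF \<beta> T])
    have int: "integrable (gauss K) (\<lambda>g. ?\<Psi> (\<lambda>t. \<Sum>k\<in>D. l t k * g k))" if "D \<subseteq> K" for D
    proof -
      have "(\<Sum>k\<in>K. (if k \<in> D then l t k else 0) * g k) = (\<Sum>k\<in>D. l t k * g k)" for t g
        using that K by (intro sum.mono_neutral_cong_right) auto
      then show ?thesis
        using L.integrable_affine[OF K, of "\<lambda>_. 0" "\<lambda>t k. if k \<in> D then l t k else 0"] by simp
    qed
    have "(\<integral>g. ?\<Psi> (\<lambda>t. \<Sum>k\<in>B. l t k * g k) \<partial>gauss K) - 0 / 2 \<le> (\<integral>g. ?\<Psi> (\<lambda>t. \<Sum>k\<in>A. l t k * g k) \<partial>gauss K)"
    proof (rule L.comparison[OF K AB])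
      fix w
      have "0 \<le> \<beta> * ((if t = s then ?p w t else 0) - ?p w t * ?p w s) * ((\<Sum>k\<in>A. l t k * l s k) - (\<Sum>k\<in>B. l t k * l s k))"
        if "t \<in> T" "s \<in> T" for t s
      proof (cases "t = s")
        case True
        then show ?thesis using var[OF that(1)] by simp
      next
        case False
        have "0 \<le> ?p w t * ?p w s" by (intro mult_nonneg_nonneg gibbs_nonneg[OF \<beta> T])
        then show ?thesis using False cov[OF that] \<beta> by (intro mult_nonpos_nonpos) (auto simp: mult_nonneg_nonpos)
      qed
      then show "- 0 \<le> (\<Sum>t\<in>T. \<Sum>s\<in>T. \<beta> * ((if t = s then ?p w t else 0) - ?p w t * ?p w s) * ((\<Sum>k\<in>A. l t k * l s k) - (\<Sum>k\<in>B. l t k * l s k)))"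
        by (auto intro!: sum_nonneg)
    qed
    moreover have "(\<integral>g. gmax T B l c g \<partial>gauss K) \<le> (\<integral>g. ?\<Psi> (\<lambda>t. \<Sum>k\<in>B. l t k * g k) \<partial>gauss K)"
      unfolding gmax_def
      by (intro integral_mono int sub lse_bounds(1)[OF \<beta> T] integrable_gmax[OF K sub(2) T, unfolded gmax_def [abs_def]])
    moreover have "(\<integral>g. ?\<Psi> (\<lambda>t. \<Sum>k\<in>A. l t k * g k) \<partial>gauss K) \<le> (\<integral>g. gmax T A l c g + ln (real (card T)) / \<beta> \<partial>gauss K)"
      unfolding gmax_def
      by (intro integral_mono int sub lse_bounds(2)[OF \<beta> T] Bochner_Integration.integrable_add G.integrable_const
          integrable_gmax[OF K sub(1) T, unfolded gmax_def [abs_def]])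
    moreover have "(\<integral>g. gmax T A l c g + ln (real (card T)) / \<beta> \<partial>gauss K) = (\<integral>g. gmax T A l c g \<partial>gauss K) + ln (real (card T)) / \<beta>"
      using integrable_gmax[OF K sub(1) T, of l c] by (simp add: G.prob_space)
    ultimately show ?thesis by linarith
  qed
  have "(\<lambda>n. (\<integral>g. gmax T B l c g \<partial>gauss K) - ln (real (card T)) / real n) \<longlonglongrightarrow> (\<integral>g. gmax T B l c g \<partial>gauss K) - 0"
    by (intro tendsto_intros tendsto_divide_0[OF tendsto_const] filterlim_at_top_imp_at_infinity filterlim_real_sequentially)
  moreover have "\<exists>N. \<forall>n\<ge>N. (\<integral>g. gmax T B l c g \<partial>gauss K) - ln (real (card T)) / real n \<le> (\<integral>g. gmax T A l c g \<partial>gauss K)"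
    using bound by (intro exI[of _ 1]) auto
  ultimately show ?thesis using LIMSEQ_le_const2 by fastforce
qed

section \<open>A smoothed distance between two copies of a Gaussian maximum\<close>

lemma sum_times_bool: "(\<Sum>x\<in>T \<times> (UNIV :: bool set). f x) = (\<Sum>t\<in>T. f (t, False)) + (\<Sum>t\<in>T. f (t, True))"
proof -
  have "(\<Sum>x\<in>T \<times> (UNIV :: bool set). f x) = (\<Sum>t\<in>T. \<Sum>b\<in>UNIV. f (t, b))"
    by (simp add: sum.cartesian_product)
  then show ?thesis by (simp add: UNIV_bool sum.distrib add.commute)
qed

text \<open>
  The smooth substitute for \<open>|x - y|\<close>, where \<open>x\<close> and \<open>y\<close> are softmaxima of two copies of the process,
  told apart by the boolean index. Its expectation is compared for two independent and two equal copies.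
\<close>

definition pair_test :: "real \<Rightarrow> 't set \<Rightarrow> ('t \<Rightarrow> real) \<Rightarrow> ('t \<times> bool \<Rightarrow> real) \<Rightarrow> real" where
  "pair_test \<beta> T c w =
     sqrt (1 + (lse \<beta> T (\<lambda>t. w (t, False) + c t) - lse \<beta> T (\<lambda>t. w (t, True) + c t))\<^sup>2)"

context
  fixes \<beta> :: real and T :: "'t set" and c :: "'t \<Rightarrow> real"
  assumes \<beta>: "0 < \<beta>" and T: "finite T" "T \<noteq> {}"
begin

definition pdiff :: "('t \<times> bool \<Rightarrow> real) \<Rightarrow> real" where
  "pdiff w = lse \<beta> T (\<lambda>t. w (t, False) + c t) - lse \<beta> T (\<lambda>t. w (t, True) + c t)"

definition pgibbs :: "('t \<times> bool \<Rightarrow> real) \<Rightarrow> bool \<Rightarrow> 't \<Rightarrow> real" where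
  "pgibbs w b = gibbs \<beta> T (\<lambda>t. w (t, b) + c t)"

definition pD1 :: "('t \<times> bool \<Rightarrow> real) \<Rightarrow> 't \<times> bool \<Rightarrow> real" where
  "pD1 w = (\<lambda>(t, b). pdiff w / sqrt (1 + (pdiff w)\<^sup>2) * (if b then - 1 else 1) * pgibbs w b t)"

text \<open>The Hessian of \<open>r (pdiff w)\<close> by the chain rule: \<open>r''\<close> times
  the outer product of the gradient of \<open>pdiff\<close>, whose sign changes between the copies,
  plus \<open>r'\<close> times the Hessian of \<open>pdiff\<close>, which is block diagonal in the
  boolean and enters with a minus sign on the copy \<open>True\<close>.\<close>

definition pD2 :: "('t \<times> bool \<Rightarrow> real) \<Rightarrow> 't \<times> bool \<Rightarrow> 't \<times> bool \<Rightarrow> real" where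
  "pD2 w = (\<lambda>(t, b) (s, b').
     (if b = b' then 1 else - 1) * (1 / sqrt (1 + (pdiff w)\<^sup>2) ^ 3) * pgibbs w b t * pgibbs w b' s
     + (if b = b' then pdiff w / sqrt (1 + (pdiff w)\<^sup>2) * (if b then - 1 else 1) * \<beta> *
          ((if t = s then pgibbs w b t else 0) - pgibbs w b t * pgibbs w b s) else 0))"

lemma sum_pD2:
  defines "S \<equiv> \<lambda>w v b. \<Sum>t\<in>T. pgibbs w b t * v (t, b)"
  shows "(\<Sum>x\<in>T \<times> UNIV. \<Sum>y\<in>T \<times> UNIV. pD2 w x y * (v x * v y))
    = (S w v False - S w v True)\<^sup>2 / sqrt (1 + (pdiff w)\<^sup>2) ^ 3
      + pdiff w / sqrt (1 + (pdiff w)\<^sup>2) *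
        (\<beta> * ((\<Sum>t\<in>T. pgibbs w False t * (v (t, False))\<^sup>2) - (S w v False)\<^sup>2)
         - \<beta> * ((\<Sum>t\<in>T. pgibbs w True t * (v (t, True))\<^sup>2) - (S w v True)\<^sup>2))"
proof -
  define k1 where "k1 = pdiff w / sqrt (1 + (pdiff w)\<^sup>2)"
  define k2 where "k2 = 1 / sqrt (1 + (pdiff w)\<^sup>2) ^ 3"
  let ?p = "pgibbs w"
  have prod: "(\<Sum>t\<in>T. \<Sum>s\<in>T. k2 * ?p b t * ?p b' s * (v (t, b) * v (s, b'))) = k2 * (S w v b * S w v b')" for b b'
    unfolding S_def sum_product by (simp add: sum_distrib_left algebra_simps)
  have cov: "(\<Sum>t\<in>T. \<Sum>s\<in>T. k1 * \<beta> * ((if t = s then ?p b t else 0) - ?p b t * ?p b s) * (v (t, b) * v (s, b)))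
      = k1 * \<beta> * ((\<Sum>t\<in>T. ?p b t * (v (t, b))\<^sup>2) - (S w v b)\<^sup>2)" for b
    unfolding S_def sum_gibbs_covariance[OF \<beta> T, of "?p b" "\<lambda>t. v (t, b)", symmetric]
    by (simp add: sum_distrib_left mult.assoc)
  have same: "(\<Sum>t\<in>T. \<Sum>s\<in>T. pD2 w (t, b) (s, b) * (v (t, b) * v (s, b)))
      = k2 * (S w v b * S w v b) + (if b then - 1 else 1) * (k1 * \<beta> * ((\<Sum>t\<in>T. ?p b t * (v (t, b))\<^sup>2) - (S w v b)\<^sup>2))" for b
  proof -
    have "(\<Sum>t\<in>T. \<Sum>s\<in>T. pD2 w (t, b) (s, b) * (v (t, b) * v (s, b)))
        = (\<Sum>t\<in>T. \<Sum>s\<in>T. k2 * ?p b t * ?p b s * (v (t, b) * v (s, b))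
           + (if b then - 1 else 1) * (k1 * \<beta> * ((if t = s then ?p b t else 0) - ?p b t * ?p b s) * (v (t, b) * v (s, b))))"
      unfolding pD2_def k1_def k2_def by (intro sum.cong refl) (simp add: algebra_simps)
    also have "\<dots> = (\<Sum>t\<in>T. \<Sum>s\<in>T. k2 * ?p b t * ?p b s * (v (t, b) * v (s, b)))
        + (if b then - 1 else 1) * (\<Sum>t\<in>T. \<Sum>s\<in>T. k1 * \<beta> * ((if t = s then ?p b t else 0) - ?p b t * ?p b s) * (v (t, b) * v (s, b)))"
      by (simp only: sum.distrib sum_distrib_left)
    finally show ?thesis unfolding prod cov .
  qed
  have cross: "(\<Sum>t\<in>T. \<Sum>s\<in>T. pD2 w (t, b) (s, \<not> b) * (v (t, b) * v (s, \<not> b))) = - (k2 * (S w v b * S w v (\<not> b)))" for b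
    unfolding prod[symmetric] sum_negf[symmetric] by (simp add: pD2_def k2_def)
  have "(\<Sum>x\<in>T \<times> UNIV. \<Sum>y\<in>T \<times> UNIV. pD2 w x y * (v x * v y))
     = (\<Sum>t\<in>T. \<Sum>s\<in>T. pD2 w (t, False) (s, False) * (v (t, False) * v (s, False)))
     + (\<Sum>t\<in>T. \<Sum>s\<in>T. pD2 w (t, False) (s, True) * (v (t, False) * v (s, True)))
     + ((\<Sum>t\<in>T. \<Sum>s\<in>T. pD2 w (t, True) (s, False) * (v (t, True) * v (s, False)))
     + (\<Sum>t\<in>T. \<Sum>s\<in>T. pD2 w (t, True) (s, True) * (v (t, True) * v (s, True))))"
    by (simp only: sum_times_bool sum.distrib)
  also have "\<dots> = k2 * (S w v False - S w v True)\<^sup>2 + k1 * (\<beta> * ((\<Sum>t\<in>T. ?p False t * (v (t, False))\<^sup>2) - (S w v False)\<^sup>2)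
         - \<beta> * ((\<Sum>t\<in>T. ?p True t * (v (t, True))\<^sup>2) - (S w v True)\<^sup>2))"
    using same[of False] same[of True] cross[of False] cross[of True]
    by (simp add: power2_diff) (simp add: power2_eq_square algebra_simps)
  finally show ?thesis unfolding k1_def k2_def by simp
qed

text \<open>The remainder constant is that of \<open>sqrt_line_derivatives\<close> with
  \<open>B1 = 2 V\<close>, \<open>B2 = 4 \<beta> V^2\<close> and
  \<open>B3 = 12 \<beta>^2 V^3\<close>, twice the bounds for one softmax; every term is then cubic
  in \<open>V\<close>. The growth bound uses that \<open>r x\<close> is at most
  \<open>1 + |x|\<close>.\<close>

lemma lindeberg_pair_test:
  "lindeberg_function (T \<times> UNIV) (pair_test \<beta> T c) pD1 pD2
     (1 + 2 * (ln (real (card T)) / \<beta> + (\<Sum>t\<in>T. \<bar>c t\<bar>))) 1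
     (3 * 2 ^ 3 + 3 * 2 * (4 * \<beta>) + 12 * \<beta>\<^sup>2)"
proof (unfold_locales)
  show "finite (T \<times> (UNIV :: bool set))" using T by simp
  have m: "(\<lambda>w. lse \<beta> T (\<lambda>t. w (t, b) + c t)) \<in> borel_measurable (PiM (T \<times> UNIV) (\<lambda>_. borel))" for b :: bool
    unfolding lse_def
    by (intro borel_measurable_divide borel_measurable_ln borel_measurable_sum borel_measurable_const
        measurable_compose[OF _ borel_measurable_exp] borel_measurable_times borel_measurable_add measurable_component_singleton) auto
  show "pair_test \<beta> T c \<in> borel_measurable (PiM (T \<times> UNIV) (\<lambda>_. borel))"
    unfolding pair_test_def [abs_def]
    by (intro measurable_compose[OF _ borel_measurable_sqrt] borel_measurable_add borel_measurable_const borel_measurable_power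
        borel_measurable_diff m)
  show "pair_test \<beta> T c (restrict w (T \<times> UNIV)) = pair_test \<beta> T c w" for w
    by (simp add: pair_test_def lse_def)
  show "\<bar>pair_test \<beta> T c w\<bar> \<le> 1 + 2 * (ln (real (card T)) / \<beta> + (\<Sum>t\<in>T. \<bar>c t\<bar>)) + 1 * (\<Sum>x\<in>T \<times> UNIV. \<bar>w x\<bar>)" for w
  proof -
    have "\<bar>lse \<beta> T (\<lambda>t. w (t, b) + c t)\<bar> \<le> ln (real (card T)) / \<beta> + ((\<Sum>t\<in>T. \<bar>w (t, b)\<bar>) + (\<Sum>t\<in>T. \<bar>c t\<bar>))" for b
    proof -
      have "(\<Sum>t\<in>T. \<bar>w (t, b) + c t\<bar>) \<le> (\<Sum>t\<in>T. \<bar>w (t, b)\<bar> + \<bar>c t\<bar>)"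
        by (intro sum_mono abs_triangle_ineq)
      then show ?thesis
        using abs_lse_le[OF \<beta> T, of "\<lambda>t. w (t, b) + c t"] by (simp add: sum.distrib)
    qed
    moreover define q where "q = ln (real (card T)) / \<beta>"
    ultimately have "\<bar>lse \<beta> T (\<lambda>t. w (t, b) + c t)\<bar> \<le> q + ((\<Sum>t\<in>T. \<bar>w (t, b)\<bar>) + (\<Sum>t\<in>T. \<bar>c t\<bar>))" for b
      by simp
    from this[of False] this[of True]
    have P: "\<bar>pdiff w\<bar> \<le> 2 * (q + (\<Sum>t\<in>T. \<bar>c t\<bar>)) + (\<Sum>x\<in>T \<times> UNIV. \<bar>w x\<bar>)"
      unfolding pdiff_def sum_times_bool by (simp add: abs_le_iff)
    have "sqrt (1 + (pdiff w)\<^sup>2) \<le> 1 + \<bar>pdiff w\<bar>"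
      by (rule real_le_lsqrt) (auto simp: power2_sum)
    then have "sqrt (1 + (pdiff w)\<^sup>2) \<le> 1 + 2 * (q + (\<Sum>t\<in>T. \<bar>c t\<bar>)) + 1 * (\<Sum>x\<in>T \<times> UNIV. \<bar>w x\<bar>)"
      using P by linarith
    then show ?thesis
      unfolding pair_test_def pdiff_def[symmetric] q_def by simp
  qed
  fix w v :: "'t \<times> bool \<Rightarrow> real"
  define V where "V = (\<Sum>x\<in>T \<times> UNIV. \<bar>v x\<bar>)"
  have V: "(\<Sum>t\<in>T. \<bar>v (t, b)\<bar>) \<le> V" for b
    unfolding V_def sum_times_bool by (cases b) (auto intro!: sum_nonneg)
  obtain f1 f2 f3 where f:
    "\<And>s. ((\<lambda>s. lse \<beta> T (\<lambda>t. (w (t, False) + c t) + s * v (t, False))) has_real_derivative f1 s) (at s)"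
    "\<And>s. (f1 has_real_derivative f2 s) (at s)" "\<And>s. (f2 has_real_derivative f3 s) (at s)"
    "f1 0 = (\<Sum>t\<in>T. pgibbs w False t * v (t, False))"
    "f2 0 = \<beta> * ((\<Sum>t\<in>T. pgibbs w False t * (v (t, False))\<^sup>2) - (\<Sum>t\<in>T. pgibbs w False t * v (t, False))\<^sup>2)"
    "\<And>s. \<bar>f1 s\<bar> \<le> V" "\<And>s. \<bar>f2 s\<bar> \<le> 2 * \<beta> * V\<^sup>2" "\<And>s. \<bar>f3 s\<bar> \<le> 6 * \<beta>\<^sup>2 * V ^ 3"
    by (rule lse_line_derivatives[OF \<beta> T V[of False], where w = "\<lambda>t. w (t, False) + c t", folded pgibbs_def])
      (rule that; assumption)
  obtain g1 g2 g3 where g: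
    "\<And>s. ((\<lambda>s. lse \<beta> T (\<lambda>t. (w (t, True) + c t) + s * v (t, True))) has_real_derivative g1 s) (at s)"
    "\<And>s. (g1 has_real_derivative g2 s) (at s)" "\<And>s. (g2 has_real_derivative g3 s) (at s)"
    "g1 0 = (\<Sum>t\<in>T. pgibbs w True t * v (t, True))"
    "g2 0 = \<beta> * ((\<Sum>t\<in>T. pgibbs w True t * (v (t, True))\<^sup>2) - (\<Sum>t\<in>T. pgibbs w True t * v (t, True))\<^sup>2)"
    "\<And>s. \<bar>g1 s\<bar> \<le> V" "\<And>s. \<bar>g2 s\<bar> \<le> 2 * \<beta> * V\<^sup>2" "\<And>s. \<bar>g3 s\<bar> \<le> 6 * \<beta>\<^sup>2 * V ^ 3"
    by (rule lse_line_derivatives[OF \<beta> T V[of True], where w = "\<lambda>t. w (t, True) + c t", folded pgibbs_def])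
      (rule that; assumption)
  define d where "d s = pdiff (\<lambda>x. w x + s * v x)" for s
  have d: "(d has_real_derivative f1 s - g1 s) (at s)" for s
    using DERIV_diff[OF f(1) g(1)] unfolding d_def [abs_def] pdiff_def by (simp add: add_ac)
  have b: "\<bar>f1 s - g1 s\<bar> \<le> 2 * V" "\<bar>f2 s - g2 s\<bar> \<le> 4 * \<beta> * V\<^sup>2" "\<bar>f3 s - g3 s\<bar> \<le> 12 * \<beta>\<^sup>2 * V ^ 3" for s
    using f(6-8)[of s] g(6-8)[of s] by linarith+
  have t: "\<bar>sqrt (1 + (d 1)\<^sup>2) - sqrt (1 + (d 0)\<^sup>2) - d 0 / sqrt (1 + (d 0)\<^sup>2) * (f1 0 - g1 0)
      - ((f1 0 - g1 0)\<^sup>2 / sqrt (1 + (d 0)\<^sup>2) ^ 3 + d 0 / sqrt (1 + (d 0)\<^sup>2) * (f2 0 - g2 0)) / 2\<bar>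
      \<le> 3 * (2 * V) ^ 3 + 3 * (2 * V) * (4 * \<beta> * V\<^sup>2) + 12 * \<beta>\<^sup>2 * V ^ 3"
    by (rule sqrt_line_derivatives[OF d DERIV_diff[OF f(2) g(2)] DERIV_diff[OF f(3) g(3)] b])
  have d0: "d 0 = pdiff w" by (simp add: d_def)
  have e1: "sqrt (1 + (d 1)\<^sup>2) = pair_test \<beta> T c (\<lambda>x. w x + v x)"
    by (simp add: d_def pair_test_def pdiff_def)
  have e0: "sqrt (1 + (d 0)\<^sup>2) = pair_test \<beta> T c w"
    by (simp add: d0 pair_test_def pdiff_def)
  have l1: "d 0 / sqrt (1 + (d 0)\<^sup>2) * (f1 0 - g1 0) = (\<Sum>x\<in>T \<times> UNIV. pD1 w x * v x)"
    unfolding sum_times_bool pD1_def f(4) g(4) d0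
    by (simp add: sum_distrib_left right_diff_distrib sum_negf mult.assoc)
  have q: "(f1 0 - g1 0)\<^sup>2 / sqrt (1 + (d 0)\<^sup>2) ^ 3 + d 0 / sqrt (1 + (d 0)\<^sup>2) * (f2 0 - g2 0)
      = (\<Sum>x\<in>T \<times> UNIV. \<Sum>y\<in>T \<times> UNIV. pD2 w x y * (v x * v y))"
    unfolding sum_pD2 d0 f(4,5) g(4,5) ..
  have "3 * (2 * V) ^ 3 + 3 * (2 * V) * (4 * \<beta> * V\<^sup>2) + 12 * \<beta>\<^sup>2 * V ^ 3
      = (3 * 2 ^ 3 + 3 * 2 * (4 * \<beta>) + 12 * \<beta>\<^sup>2) * V ^ 3"
    by (simp add: power2_eq_square power3_eq_cube algebra_simps)
  then show "\<bar>pair_test \<beta> T c (\<lambda>x. w x + v x) - pair_test \<beta> T c w - (\<Sum>x\<in>T \<times> UNIV. pD1 w x * v x)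
      - (\<Sum>x\<in>T \<times> UNIV. \<Sum>y\<in>T \<times> UNIV. pD2 w x y * (v x * v y)) / 2\<bar>
      \<le> (3 * 2 ^ 3 + 3 * 2 * (4 * \<beta>) + 12 * \<beta>\<^sup>2) * (\<Sum>x\<in>T \<times> UNIV. \<bar>v x\<bar>) ^ 3"
    using t unfolding e1 l1 q unfolding e0 V_def by simp
qed simp

end


text \<open>Slots 1 and 2 carry the independent copies. Slot 0 is integrated out here; it is
  reserved for the shared copy in \<open>gmax_abs_diff_unit\<close>.\<close>

lemma gauss_two_copies:
  fixes K :: "'k set"
  assumes K: "finite K"
  shows "distr (gauss (K \<times> {0, 1, 2 :: nat})) (gauss K \<Otimes>\<^sub>M gauss K)
      (\<lambda>g. (\<lambda>k\<in>K. g (k, 1), \<lambda>k\<in>K. g (k, 2))) = gauss K \<Otimes>\<^sub>M gauss K"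
proof -
  interpret S: product_sigma_finite "\<lambda>_ :: 'k \<times> nat. stdN" by (rule product_sigma_finite_stdN)
  interpret G: prob_space "gauss K" by simp
  \<comment> \<open>The slots are distributed over two factors so that 1 and 2 are separated; slot 0
    joins the first factor to make the union exhaust the index set.\<close>
  let ?I = "K \<times> {0, 1 :: nat}" and ?J = "K \<times> {2 :: nat}"
  have IJ: "?I \<union> ?J = K \<times> {0, 1, 2}" by auto
  have mg: "distr (gauss ?I \<Otimes>\<^sub>M gauss ?J) (gauss (?I \<union> ?J)) (merge ?I ?J) = gauss (?I \<union> ?J)"
    unfolding gauss_def using K by (intro S.distr_merge) auto
  have proj: "(\<lambda>g. \<lambda>k\<in>K. g (k, i)) \<in> measurable (gauss L) (gauss K)"
    if "K \<times> {i} \<subseteq> L" for L :: "('k \<times> nat) set" and i :: nat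
    unfolding measurable_cong_sets[OF refl sets_gauss] using that by (intro measurable_restrict measurable_gauss_component) auto
  have law: "distr (gauss L) (gauss K) (\<lambda>g. \<lambda>k\<in>K. g (k, i)) = gauss K" if "K \<times> {i} \<subseteq> L" for L :: "('k \<times> nat) set" and i :: nat
  proof -
    have "distr (gauss L) (gauss K) (\<lambda>g. \<lambda>k\<in>K. g (k, i)) = distr (gauss L) (PiM K (\<lambda>_. borel)) (\<lambda>g. \<lambda>k\<in>K. g (k, i))"
      by (intro distr_cong) (auto simp: sets_gauss)
    also have "\<dots> = gauss K"
      using that by (intro gauss_reindex) (auto simp: inj_on_def)
    finally show ?thesis .
  qed
  have phi: "(\<lambda>g. (\<lambda>k\<in>K. g (k, 1), \<lambda>k\<in>K. g (k, 2))) \<in> measurable (gauss (?I \<union> ?J)) (gauss K \<Otimes>\<^sub>M gauss K)"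
    by (intro measurable_Pair proj) auto
  have mm: "merge ?I ?J \<in> measurable (gauss ?I \<Otimes>\<^sub>M gauss ?J) (gauss (?I \<union> ?J))"
    unfolding gauss_def by (rule measurable_merge)
  have "distr (gauss (?I \<union> ?J)) (gauss K \<Otimes>\<^sub>M gauss K) (\<lambda>g. (\<lambda>k\<in>K. g (k, 1), \<lambda>k\<in>K. g (k, 2)))
      = distr (gauss ?I \<Otimes>\<^sub>M gauss ?J) (gauss K \<Otimes>\<^sub>M gauss K)
          ((\<lambda>g. (\<lambda>k\<in>K. g (k, 1), \<lambda>k\<in>K. g (k, 2))) \<circ> merge ?I ?J)"
    by (subst mg[symmetric]) (rule distr_distr[OF phi mm])
  also have "\<dots> = distr (gauss ?I \<Otimes>\<^sub>M gauss ?J) (gauss K \<Otimes>\<^sub>M gauss K) (\<lambda>(x, y). (\<lambda>k\<in>K. x (k, 1), \<lambda>k\<in>K. y (k, 2)))"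
    by (intro distr_cong refl) (auto simp: merge_def fun_eq_iff)
  also have "\<dots> = distr (gauss ?I) (gauss K) (\<lambda>g. \<lambda>k\<in>K. g (k, 1)) \<Otimes>\<^sub>M distr (gauss ?J) (gauss K) (\<lambda>g. \<lambda>k\<in>K. g (k, 2))"
    using law[of 2 ?J] G.sigma_finite_measure_axioms by (intro pair_measure_distr[symmetric] proj) auto
  also have "\<dots> = gauss K \<Otimes>\<^sub>M gauss K"
  proof -
    have "K \<times> {1} \<subseteq> ?I" by auto
    from law[OF this] law[OF order_refl, of 2] show ?thesis by (simp only:)
  qed
  finally show ?thesis unfolding IJ .
qed

text \<open>The comparison runs between two equal copies, where the test function is constantly 1,
  and two independent ones. Covariances within a copy agree, so only the two cross blocks of the
  Hessian matter. Each is \<open>- r''\<close> times a product of Gibbs weights of total mass 1, and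
  \<open>r''\<close> and the covariances are at most 1 in modulus. Hence \<open>\<kappa>\<close> is
  2, and the expectation rises from 1 by at most 1.\<close>

lemma gmax_abs_diff_unit:
  fixes T :: "'t set" and K :: "'k set"
  assumes K: "finite K" and T: "finite T" "T \<noteq> {}"
    and cov: "\<And>t s. t \<in> T \<Longrightarrow> s \<in> T \<Longrightarrow> \<bar>\<Sum>k\<in>K. l t k * l s k\<bar> \<le> 1"
  shows "(\<integral>g. \<bar>gmax T K l c (\<lambda>k\<in>K. g (k, 1)) - gmax T K l c (\<lambda>k\<in>K. g (k, 2))\<bar> \<partial>gauss (K \<times> {0, 1, 2 :: nat})) \<le> 2"
    (is "?E \<le> 2")
proof -
  let ?K3 = "K \<times> {0, 1, 2 :: nat}"
  interpret G: prob_space "gauss ?K3" by simp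
  \<comment> \<open>On the block with slot 0 both copies read the same Gaussians; on the block with
    slots 1 and 2 the copy \<open>False\<close> reads slot 1 and the copy \<open>True\<close> slot
    2.\<close>
  define l' where "l' = (\<lambda>(t, b) (k, i). if i = 0 \<or> i = (if b then 2 else 1 :: nat) then l t k else 0)"
  have fin3: "finite ?K3" using K by simp
  have sumA: "(\<Sum>x\<in>K \<times> {0}. f x) = (\<Sum>k\<in>K. f (k, 0))" for f :: "'k \<times> nat \<Rightarrow> real"
  proof -
    have "(\<Sum>x\<in>K \<times> {0}. f x) = (\<Sum>k\<in>K. \<Sum>i\<in>{0}. f (k, i))" by (subst sum.cartesian_product) simp
    then show ?thesis by simp
  qed
  have sumB: "(\<Sum>x\<in>K \<times> {1, 2}. f x) = (\<Sum>k\<in>K. f (k, 1) + f (k, 2))" for f :: "'k \<times> nat \<Rightarrow> real"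
  proof -
    have "(\<Sum>x\<in>K \<times> {1, 2}. f x) = (\<Sum>k\<in>K. \<Sum>i\<in>{1, 2}. f (k, i))" by (subst sum.cartesian_product) simp
    then show ?thesis by simp
  qed
  define \<Gamma> where "\<Gamma> t s = (\<Sum>k\<in>K. l t k * l s k)" for t s
  have covA: "(\<Sum>k\<in>K \<times> {0}. l' (t, b) k * l' (s, b') k) = \<Gamma> t s" for t s b b'
    unfolding sumA \<Gamma>_def by (simp add: l'_def)
  have covB: "(\<Sum>k\<in>K \<times> {1, 2}. l' (t, b) k * l' (s, b') k) = (if b = b' then \<Gamma> t s else 0)" for t s b b'
    unfolding sumB \<Gamma>_def by (auto simp: l'_def)
  have bound: "?E \<le> 2 + ln (real (card T)) / \<beta>" if \<beta>: "0 < \<beta>" for \<beta> :: real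
  proof -
    interpret L: lindeberg_function "T \<times> (UNIV :: bool set)" "pair_test \<beta> T c" "pD1 \<beta> T c" "pD2 \<beta> T c"
      "1 + 2 * (ln (real (card T)) / \<beta> + (\<Sum>t\<in>T. \<bar>c t\<bar>))" 1 "3 * 2 ^ 3 + 3 * 2 * (4 * \<beta>) + 12 * \<beta>\<^sup>2"
      by (rule lindeberg_pair_test[OF \<beta> T])
    let ?W = "\<lambda>D g x. \<Sum>k\<in>D. l' x k * g k"
    have "(\<integral>g. pair_test \<beta> T c (?W (K \<times> {1, 2}) g) \<partial>gauss ?K3) - 2 / 2 \<le> (\<integral>g. pair_test \<beta> T c (?W (K \<times> {0}) g) \<partial>gauss ?K3)"
    proof (rule L.comparison[OF fin3])
      fix w
      let ?D = "pD2 \<beta> T c w" and ?p = "pgibbs \<beta> T c w"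
      have p: "0 \<le> ?p b t" "(\<Sum>t\<in>T. ?p b t) = 1" for b t
        unfolding pgibbs_def[OF \<beta> T] by (rule gibbs_nonneg[OF \<beta> T] sum_gibbs[OF \<beta> T])+
      have low: "- (?p b t * ?p (\<not> b) s) \<le> ?D (t, b) (s, \<not> b) * \<Gamma> t s" if "t \<in> T" "s \<in> T" for t s b
      proof -
        define k where "k = 1 / sqrt (1 + (pdiff \<beta> T c w)\<^sup>2) ^ 3"
        have k: "0 \<le> k" "\<bar>k\<bar> \<le> 1" using sqrt_one_plus_square_derivatives(5)[of "pdiff \<beta> T c w"] by (simp_all add: k_def)
        have pp: "0 \<le> ?p b t * ?p (\<not> b) s" by (intro mult_nonneg_nonneg p)
        have "\<bar>k * \<Gamma> t s\<bar> \<le> 1 * 1" unfolding abs_mult using k cov[OF that] unfolding \<Gamma>_def by (intro mult_mono) auto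
        then have "(k * \<Gamma> t s) * (?p b t * ?p (\<not> b) s) \<le> 1 * (?p b t * ?p (\<not> b) s)"
          by (intro mult_right_mono pp) simp
        moreover have "?D (t, b) (s, \<not> b) * \<Gamma> t s = - ((k * \<Gamma> t s) * (?p b t * ?p (\<not> b) s))"
          by (simp add: pD2_def[OF \<beta> T] k_def algebra_simps)
        ultimately show ?thesis by simp
      qed
      have "(\<Sum>x\<in>T \<times> UNIV. \<Sum>y\<in>T \<times> UNIV. ?D x y * ((\<Sum>k\<in>K \<times> {0}. l' x k * l' y k) - (\<Sum>k\<in>K \<times> {1, 2}. l' x k * l' y k)))
          = (\<Sum>t\<in>T. \<Sum>s\<in>T. ?D (t, False) (s, True) * \<Gamma> t s) + (\<Sum>t\<in>T. \<Sum>s\<in>T. ?D (t, True) (s, False) * \<Gamma> t s)"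
        unfolding sum_times_bool covA covB by (simp add: sum.distrib)
      moreover have "- 1 \<le> (\<Sum>t\<in>T. \<Sum>s\<in>T. ?D (t, b) (s, \<not> b) * \<Gamma> t s)" for b
      proof -
        have "(\<Sum>t\<in>T. \<Sum>s\<in>T. - (?p b t * ?p (\<not> b) s)) \<le> (\<Sum>t\<in>T. \<Sum>s\<in>T. ?D (t, b) (s, \<not> b) * \<Gamma> t s)"
          by (intro sum_mono low)
        moreover have "(\<Sum>t\<in>T. \<Sum>s\<in>T. - (?p b t * ?p (\<not> b) s)) = - 1"
          by (simp add: sum_negf sum_product[symmetric] p)
        ultimately show ?thesis by simp
      qed
      note this[of False] this[of True]
      ultimately show "- 2 \<le> (\<Sum>x\<in>T \<times> UNIV. \<Sum>y\<in>T \<times> UNIV. ?D x y * ((\<Sum>k\<in>K \<times> {0}. l' x k * l' y k) - (\<Sum>k\<in>K \<times> {1, 2}. l' x k * l' y k)))"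
        by simp
    qed auto
    moreover have "pair_test \<beta> T c (?W (K \<times> {0}) g) = 1" for g
      unfolding pair_test_def sumA by (simp add: l'_def)
    ultimately have 2: "(\<integral>g. pair_test \<beta> T c (?W (K \<times> {1, 2}) g) \<partial>gauss ?K3) \<le> 2"
      using G.prob_space by simp
    have int: "integrable (gauss ?K3) (\<lambda>g. pair_test \<beta> T c (?W (K \<times> {1, 2}) g))"
    proof -
      have "(\<Sum>k\<in>?K3. (if k \<in> K \<times> {1, 2} then l' x k else 0) * g k) = ?W (K \<times> {1, 2}) g x" for x g
        using K by (intro sum.mono_neutral_cong_right) auto
      then show ?thesis
        using L.integrable_affine[OF fin3, of "\<lambda>_. 0" "\<lambda>x k. if k \<in> K \<times> {1, 2} then l' x k else 0"] by simp
    qed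
    have "\<bar>gmax T K l c (\<lambda>k\<in>K. g (k, 1)) - gmax T K l c (\<lambda>k\<in>K. g (k, 2))\<bar>
        \<le> pair_test \<beta> T c (?W (K \<times> {1, 2}) g) + ln (real (card T)) / \<beta>" for g
    proof -
      let ?w = "\<lambda>i t. (\<Sum>k\<in>K. l t k * g (k, i)) + c t"
      have "pair_test \<beta> T c (?W (K \<times> {1, 2}) g) = sqrt (1 + (lse \<beta> T (?w 1) - lse \<beta> T (?w 2))\<^sup>2)"
        unfolding pair_test_def sumB by (simp add: l'_def)
      moreover have "\<bar>x\<bar> \<le> sqrt (1 + x\<^sup>2)" for x :: real by (rule real_le_rsqrt) simp
      ultimately have "\<bar>lse \<beta> T (?w 1) - lse \<beta> T (?w 2)\<bar> \<le> pair_test \<beta> T c (?W (K \<times> {1, 2}) g)"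
        by simp
      moreover note lse_bounds[OF \<beta> T, of "?w 1"] lse_bounds[OF \<beta> T, of "?w 2"]
      ultimately show ?thesis by (simp add: gmax_def)
    qed
    then have "?E \<le> (\<integral>g. pair_test \<beta> T c (?W (K \<times> {1, 2}) g) + ln (real (card T)) / \<beta> \<partial>gauss ?K3)"
      by (intro integral_mono' Bochner_Integration.integrable_add int G.integrable_const)
        (auto intro: order_trans[OF abs_ge_zero])
    also have "\<dots> = (\<integral>g. pair_test \<beta> T c (?W (K \<times> {1, 2}) g) \<partial>gauss ?K3) + ln (real (card T)) / \<beta>"
      by (subst Bochner_Integration.integral_add[OF int G.integrable_const]) (use G.prob_space in simp)
    finally show ?thesis using 2 by simp
  qed
  have "(\<lambda>n. 2 + ln (real (card T)) / real n) \<longlonglongrightarrow> 2 + 0"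
    by (intro tendsto_intros tendsto_divide_0[OF tendsto_const] filterlim_at_top_imp_at_infinity filterlim_real_sequentially)
  moreover have "\<exists>N. \<forall>n\<ge>N. ?E \<le> 2 + ln (real (card T)) / real n"
    using bound by (intro exI[of _ 1]) auto
  ultimately show ?thesis using LIMSEQ_le_const by fastforce
qed

text \<open>The smoothing \<open>r\<close> has a fixed unit scale. Dividing the process by
  \<open>a\<close> first makes the bound proportional to \<open>a\<close>, the scale of the standard
  deviations.\<close>

lemma gmax_concentration:
  fixes T :: "'t set" and K :: "'k set"
  assumes K: "finite K" and T: "finite T" "T \<noteq> {}" and a: "0 < a"
    and cov: "\<And>t s. t \<in> T \<Longrightarrow> s \<in> T \<Longrightarrow> \<bar>\<Sum>k\<in>K. l t k * l s k\<bar> \<le> a\<^sup>2"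
  shows "(\<integral>z. \<bar>gmax T K l c (fst z) - gmax T K l c (snd z)\<bar> \<partial>(gauss K \<Otimes>\<^sub>M gauss K)) \<le> 2 * a"
proof -
  define l' where "l' t k = l t k / a" for t k
  define c' where "c' t = c t / a" for t
  have sc: "gmax T K l c g = a * gmax T K l' c' g" for g
  proof -
    have "(\<Sum>k\<in>K. l t k * g k) + c t = a * ((\<Sum>k\<in>K. l' t k * g k) + c' t)" for t
      using a by (simp add: l'_def c'_def distrib_left sum_distrib_left)
    then have "gmax T K l c g = Max ((\<lambda>x. a * x) ` (\<lambda>t. (\<Sum>k\<in>K. l' t k * g k) + c' t) ` T)"
      unfolding gmax_def image_image by simp
    also have "\<dots> = a * Max ((\<lambda>t. (\<Sum>k\<in>K. l' t k * g k) + c' t) ` T)"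
      using T a by (intro mono_Max_commute[symmetric] monoI) auto
    finally show ?thesis by (simp add: gmax_def)
  qed
  let ?f = "\<lambda>z. \<bar>gmax T K l' c' (fst z) - gmax T K l' c' (snd z)\<bar>"
  let ?phi = "\<lambda>g. (\<lambda>k\<in>K. g (k, 1), \<lambda>k\<in>K. g (k, 2))"
  have m: "gmax T K l' c' \<in> borel_measurable (gauss K)"
    using measurable_gmax[OF T(1) order_refl] by (simp add: measurable_cong_sets[OF sets_gauss refl])
  have f: "?f \<in> borel_measurable (gauss K \<Otimes>\<^sub>M gauss K)"
    by (intro borel_measurable_abs borel_measurable_diff measurable_compose[OF measurable_fst m] measurable_compose[OF measurable_snd m])
  have "(\<lambda>g. \<lambda>k\<in>K. g (k, i)) \<in> measurable (gauss (K \<times> {0, 1, 2})) (gauss K)" if "i \<in> {0, 1, 2}" for i :: nat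
    unfolding measurable_cong_sets[OF refl sets_gauss] using that by (intro measurable_restrict measurable_gauss_component) auto
  then have phi: "?phi \<in> measurable (gauss (K \<times> {0, 1, 2 :: nat})) (gauss K \<Otimes>\<^sub>M gauss K)"
    by (intro measurable_Pair) auto
  have "(\<integral>z. ?f z \<partial>(gauss K \<Otimes>\<^sub>M gauss K)) = (\<integral>g. ?f (?phi g) \<partial>gauss (K \<times> {0, 1, 2 :: nat}))"
    using integral_distr[OF phi f] unfolding gauss_two_copies[OF K] .
  also have "\<dots> \<le> 2"
  proof -
    have "\<bar>\<Sum>k\<in>K. l' t k * l' s k\<bar> \<le> 1" if "t \<in> T" "s \<in> T" for t s
    proof -
      have "(\<Sum>k\<in>K. l' t k * l' s k) = (\<Sum>k\<in>K. l t k * l s k) / a\<^sup>2"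
        by (simp add: l'_def sum_divide_distrib power2_eq_square)
      then show ?thesis using cov[OF that] a by simp
    qed
    from gmax_abs_diff_unit[OF K T this] show ?thesis by simp
  qed
  finally have "a * (\<integral>z. ?f z \<partial>(gauss K \<Otimes>\<^sub>M gauss K)) \<le> a * 2" using a by (intro mult_left_mono) auto
  moreover have "\<bar>gmax T K l c x - gmax T K l c y\<bar> = a * \<bar>gmax T K l' c' x - gmax T K l' c' y\<bar>" for x y
    unfolding sc right_diff_distrib[symmetric] abs_mult using a by simp
  ultimately show ?thesis by simp
qed

section \<open>Maxima over the unit sphere\<close>

text \<open>Relative density in \<open>S\<close>. It is applied to the sphere inside all functions
  from \<open>nat\<close> to \<open>real\<close> with the product topology, which is second
  countable.\<close>

lemma countable_dense_subset_exists:
  fixes S :: "'a::second_countable_topology set"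
  obtains D where "countable D" "D \<subseteq> S" "\<And>U. open U \<Longrightarrow> U \<inter> S \<noteq> {} \<Longrightarrow> U \<inter> D \<noteq> {}"
proof -
  obtain B :: "'a set set" where B: "countable B" "topological_basis B"
    using ex_countable_basis by blast
  define D where "D = (\<lambda>b. SOME x. x \<in> b \<inter> S) ` {b \<in> B. b \<inter> S \<noteq> {}}"
  have pick: "(SOME x. x \<in> b \<inter> S) \<in> b \<inter> S" if "b \<inter> S \<noteq> {}" for b
  proof -
    have "\<exists>x. x \<in> b \<inter> S" using that by blast
    then show ?thesis by (rule someI_ex)
  qed
  show thesis
  proof (rule that[of D])
    have "countable {b \<in> B. b \<inter> S \<noteq> {}}"
      by (rule countable_subset[OF _ B(1)]) blast
    then show "countable D" unfolding D_def by (rule countable_image)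
    show "D \<subseteq> S" unfolding D_def using pick by blast
    fix U :: "'a set" assume "open U" "U \<inter> S \<noteq> {}"
    then obtain x where x: "x \<in> U" "x \<in> S" by blast
    obtain b where b: "b \<in> B" "x \<in> b" "b \<subseteq> U"
      by (rule topological_basisE[OF B(2) \<open>open U\<close> x(1)])
    then have ne: "b \<inter> S \<noteq> {}" using x by blast
    then have "(SOME x. x \<in> b \<inter> S) \<in> D" unfolding D_def using b(1) by blast
    with b(3) pick[OF ne] show "U \<inter> D \<noteq> {}" by blast
  qed
qed

section \<open>The objective as a shifted Gaussian process on the sphere of radius sqrt n\<close>

definition sphere_n :: "nat \<Rightarrow> (nat \<Rightarrow> real) set" where
  "sphere_n n = {x \<in> euclid n. (\<Sum>i=1..n. (x i)\<^sup>2) = real n}"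

definition idx :: "nat \<Rightarrow> (nat \<times> nat) set" where
  "idx n = {1..n} \<times> {1..n}"

definition coef :: "nat \<Rightarrow> (nat \<Rightarrow> real) \<Rightarrow> nat \<times> nat \<Rightarrow> real" where
  "coef n x k = x (fst k) * x (snd k) / real n powr (3 / 2)"

definition pen :: "real \<Rightarrow> nat \<Rightarrow> real \<Rightarrow> (nat \<Rightarrow> real) \<Rightarrow> real" where
  "pen p n t x = - t * (\<Sum>i=1..n. \<bar>x i\<bar> powr p) / real n"

abbreviation gmax_on :: "real \<Rightarrow> nat \<Rightarrow> real \<Rightarrow> (nat \<Rightarrow> real) set \<Rightarrow> (nat \<times> nat \<Rightarrow> real) \<Rightarrow> real" where
  "gmax_on p n t T \<equiv> gmax T (idx n) (coef n) (pen p n t)"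

abbreviation array :: "(nat \<times> nat \<Rightarrow> real) \<Rightarrow> nat \<Rightarrow> nat \<Rightarrow> real" where
  "array G \<equiv> \<lambda>i j. G (i, j)"

text \<open>The parameter \<open>u\<close> is fixed to 1; the other values reduce to it by \<open>L_max_sphere_eq\<close> below.\<close>

definition phi :: "real \<Rightarrow> nat \<Rightarrow> real \<Rightarrow> (nat \<times> nat \<Rightarrow> real) \<Rightarrow> real" where
  "phi p n t G = L_max_sphere (array G) n p 1 t"

lemma finite_idx [simp]: "finite (idx n)"
  by (simp add: idx_def)

lemma quad_form_eq: "quad_form (array G) n x = (\<Sum>k\<in>idx n. x (fst k) * x (snd k) * G k)"
proof -
  have "quad_form (array G) n x = (\<Sum>i=1..n. \<Sum>j=1..n. x i * x j * G (i, j))"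
    unfolding quad_form_def sum_distrib_right by (intro sum.cong refl) (simp add: mult_ac)
  then show ?thesis unfolding idx_def by (simp add: sum.cartesian_product case_prod_unfold)
qed

lemma normalized_norm_powr:
  assumes "q \<noteq> 0"
  shows "normalized_norm n q x powr q = (\<Sum>i=1..n. \<bar>x i\<bar> powr q) / real n"
proof -
  have "0 \<le> 1 / real n * (\<Sum>i=1..n. \<bar>x i\<bar> powr q)"
    by (intro mult_nonneg_nonneg sum_nonneg) auto
  then have "(1 / real n * (\<Sum>i=1..n. \<bar>x i\<bar> powr q)) powr 1 = 1 / real n * (\<Sum>i=1..n. \<bar>x i\<bar> powr q)"
    by (simp only: powr_one)
  then show ?thesis unfolding normalized_norm_def powr_powr using assms by simp
qed

lemma normalized_norm_square:
  "(normalized_norm n 2 x)\<^sup>2 = (\<Sum>i=1..n. (x i)\<^sup>2) / real n"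
proof -
  have "(normalized_norm n 2 x)\<^sup>2 = normalized_norm n 2 x powr 2"
    by (simp add: normalized_norm_def)
  then show ?thesis using normalized_norm_powr[of 2 n x] by (simp add: powr_numeral)
qed

lemma objective_eq:
  assumes "p \<noteq> 0"
  shows "objective (array G) n p t x = (\<Sum>k\<in>idx n. coef n x k * G k) + pen p n t x"
proof -
  have "(\<Sum>k\<in>idx n. coef n x k * G k) = (\<Sum>k\<in>idx n. x (fst k) * x (snd k) * G k) / real n powr (3 / 2)"
    by (simp add: coef_def sum_divide_distrib)
  then show ?thesis
    unfolding objective_def quad_form_eq normalized_norm_powr[OF assms] pen_def by simp
qed

lemma sphere_n_eq:
  assumes "1 \<le> n"
  shows "{x \<in> euclid n. (normalized_norm n 2 x)\<^sup>2 = 1} = sphere_n n"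
  using assms unfolding normalized_norm_square sphere_n_def by (auto simp: field_simps)

lemma continuous_objective:
  assumes "0 < p"
  shows "continuous_on UNIV (objective A n p t)"
proof -
  have eq: "objective A n p t = (\<lambda>x. (\<Sum>k\<in>idx n. coef n x k * A (fst k) (snd k)) + pen p n t x)"
    using objective_eq[of p "\<lambda>k. A (fst k) (snd k)" n t] assms by auto
  have c: "continuous_on UNIV (\<lambda>x :: nat \<Rightarrow> real. x i)" for i by simp
  have "continuous_on UNIV (\<lambda>x :: nat \<Rightarrow> real. \<bar>x i\<bar> powr p)" for i
    by (rule continuous_on_powr'[OF continuous_on_rabs[OF c] continuous_on_const]) (use assms in auto)
  then show ?thesis
    unfolding eq coef_def pen_def divide_inverse
    by (intro continuous_on_add continuous_on_sum continuous_on_mult continuous_on_const c) auto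
qed

text \<open>Extensional functions take the value \<open>undefined\<close> outside
  \<open>{1..n}\<close>, so the ball is a closed part of a product of compact intervals and
  singletons, and Tychonoff's theorem applies.\<close>

lemma compact_euclid_ball: "compact {x \<in> euclid n. (\<Sum>i=1..n. (x i)\<^sup>2) \<le> r}"
proof -
  let ?B = "PiE UNIV (\<lambda>i. if i \<in> {1..n} then {- sqrt r..sqrt r} else {undefined})"
  have "compactin (product_topology (\<lambda>i. euclidean) UNIV) ?B"
    unfolding compactin_PiE by auto
  then have B: "compact ?B" by (simp add: euclidean_product_topology)
  have "{x \<in> euclid n. (\<Sum>i=1..n. (x i)\<^sup>2) \<le> r} = ?B \<inter> {x. (\<Sum>i=1..n. (x i)\<^sup>2) \<le> r}"
  proof -
    have "x \<in> euclid n \<longleftrightarrow> x \<in> ?B" if x: "(\<Sum>i=1..n. (x i)\<^sup>2) \<le> r" for x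
    proof -
      have b: "\<bar>x i\<bar> \<le> sqrt r" if "i \<in> {1..n}" for i
      proof (rule real_le_rsqrt)
        have "(x i)\<^sup>2 \<le> (\<Sum>i=1..n. (x i)\<^sup>2)" using that by (intro member_le_sum) auto
        with x show "\<bar>x i\<bar>\<^sup>2 \<le> r" by simp
      qed
      have "x \<in> ?B \<longleftrightarrow> (\<forall>i. i \<notin> {1..n} \<longrightarrow> x i = undefined)"
      proof
        assume "x \<in> ?B"
        then have "x i \<in> (if i \<in> {1..n} then {- sqrt r..sqrt r} else {undefined})" for i
          by (rule PiE_mem) simp
        then show "\<forall>i. i \<notin> {1..n} \<longrightarrow> x i = undefined" by (metis singletonD)
      next
        assume u: "\<forall>i. i \<notin> {1..n} \<longrightarrow> x i = undefined"
        show "x \<in> ?B"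
        proof (rule PiE_I)
          fix i
          show "x i \<in> (if i \<in> {1..n} then {- sqrt r..sqrt r} else {undefined})"
            using b[of i] u by (simp add: abs_le_iff minus_le_iff)
        qed simp
      qed
      moreover have "x \<in> euclid n \<longleftrightarrow> (\<forall>i. i \<notin> {1..n} \<longrightarrow> x i = undefined)"
        unfolding euclid_def PiE_iff extensional_def by simp
      ultimately show ?thesis by (rule trans[OF _ sym, rotated])
    qed
    then show ?thesis by blast
  qed
  moreover have "closed {x :: nat \<Rightarrow> real. (\<Sum>i=1..n. (x i)\<^sup>2) \<le> r}"
    by (intro closed_Collect_le continuous_on_sum continuous_on_power continuous_on_const) simp
  ultimately show ?thesis using compact_Int_closed[OF B] by simp
qed

lemma compact_sphere_n: "compact (sphere_n n)"
proof -
  have "closed {x :: nat \<Rightarrow> real. (\<Sum>i=1..n. (x i)\<^sup>2) = real n}"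
    by (intro closed_Collect_eq continuous_on_sum continuous_on_power continuous_on_const) simp
  from compact_Int_closed[OF compact_euclid_ball[of n "real n"] this] show ?thesis
    by (rule back_subst[of compact]) (auto simp: sphere_n_def)
qed

lemma const_in_sphere_n: "(\<lambda>i\<in>{1..n}. 1) \<in> sphere_n n"
  by (auto simp: sphere_n_def euclid_def)

lemma max_over_eqI:
  assumes "x \<in> S" "\<And>y. y \<in> S \<Longrightarrow> f y \<le> f x"
  shows "max_over f S = f x"
  unfolding max_over_def using assms by (intro Greatest_equality) auto

text \<open>Compactness makes the \<open>GREATEST\<close> inside \<open>max_over\<close> a true
  maximum; this is the access to \<open>phi\<close> in the estimates that follow.\<close>

lemma phi_attained:
  assumes n: "1 \<le> n" and p: "0 < p"
  obtains x where "x \<in> sphere_n n" "phi p n t G = objective (array G) n p t x"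
    "\<And>y. y \<in> sphere_n n \<Longrightarrow> objective (array G) n p t y \<le> phi p n t G"
proof -
  obtain x where x: "x \<in> sphere_n n" "\<And>y. y \<in> sphere_n n \<Longrightarrow> objective (array G) n p t y \<le> objective (array G) n p t x"
    using continuous_attains_sup[OF compact_sphere_n _ continuous_on_subset[OF continuous_objective[OF p] subset_UNIV]]
      const_in_sphere_n by blast
  have "phi p n t G = objective (array G) n p t x"
    unfolding phi_def L_max_sphere_def sphere_n_eq[OF n]
    by (rule max_over_eqI[where f = "objective (array G) n p t", OF x])
  with x show thesis by (intro that) auto
qed

text \<open>These bounds are crude in \<open>n\<close>; they only supply dominating functions for a
  fixed dimension.\<close>

lemma sphere_n_bounds:
  assumes x: "x \<in> sphere_n n" and n: "1 \<le> n" and p: "0 < p"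
  shows "k \<in> idx n \<Longrightarrow> \<bar>coef n x k\<bar> \<le> 1" and "\<bar>pen p n t x\<bar> \<le> \<bar>t\<bar> * sqrt (real n) powr p"
proof -
  have xi: "\<bar>x i\<bar> \<le> sqrt (real n)" if "i \<in> {1..n}" for i
  proof (rule real_le_rsqrt)
    have "(x i)\<^sup>2 \<le> (\<Sum>i=1..n. (x i)\<^sup>2)" using that by (intro member_le_sum) auto
    with x show "\<bar>x i\<bar>\<^sup>2 \<le> real n" by (simp add: sphere_n_def)
  qed
  show "\<bar>coef n x k\<bar> \<le> 1" if "k \<in> idx n"
  proof -
    have "\<bar>x (fst k)\<bar> * \<bar>x (snd k)\<bar> \<le> sqrt (real n) * sqrt (real n)"
      using that by (intro mult_mono xi) (auto simp: idx_def)
    also have "\<dots> = real n powr 1" by simp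
    also have "\<dots> \<le> real n powr (3 / 2)" using n by (intro powr_mono) auto
    finally show ?thesis using n by (simp add: coef_def abs_mult divide_le_eq)
  qed
  have "(\<Sum>i=1..n. \<bar>x i\<bar> powr p) \<le> (\<Sum>i=1..n. sqrt (real n) powr p)"
    using p by (intro sum_mono powr_mono2 xi) auto
  then have "\<bar>t\<bar> * ((\<Sum>i=1..n. \<bar>x i\<bar> powr p) / real n) \<le> \<bar>t\<bar> * sqrt (real n) powr p"
    using n by (intro mult_left_mono) (auto simp: divide_le_eq mult.commute)
  then show "\<bar>pen p n t x\<bar> \<le> \<bar>t\<bar> * sqrt (real n) powr p"
    by (simp add: pen_def abs_mult abs_divide sum_nonneg)
qed

lemma objective_bound:
  assumes x: "x \<in> sphere_n n" and n: "1 \<le> n" and p: "0 < p"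
  shows "\<bar>objective (array G) n p t x\<bar> \<le> (\<Sum>k\<in>idx n. \<bar>G k\<bar>) + \<bar>t\<bar> * sqrt (real n) powr p"
proof -
  have "\<bar>\<Sum>k\<in>idx n. coef n x k * G k\<bar> \<le> (\<Sum>k\<in>idx n. \<bar>coef n x k * G k\<bar>)" by (rule sum_abs)
  also have "\<dots> \<le> (\<Sum>k\<in>idx n. 1 * \<bar>G k\<bar>)"
    unfolding abs_mult by (intro sum_mono mult_right_mono sphere_n_bounds(1)[OF x n p]) auto
  finally show ?thesis
    using sphere_n_bounds(2)[OF x n p, of t] p by (subst objective_eq) (auto simp: abs_le_iff)
qed

lemma gmax_objective:
  assumes "p \<noteq> 0"
  shows "gmax_on p n t T G = Max (objective (array G) n p t ` T)"
  unfolding gmax_def by (simp add: objective_eq[OF assms])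

lemma gmax_bound:
  assumes T: "finite T" "T \<noteq> {}" "T \<subseteq> sphere_n n" and n: "1 \<le> n" and p: "0 < p"
  shows "\<bar>gmax_on p n t T G\<bar> \<le> (\<Sum>k\<in>idx n. \<bar>G k\<bar>) + \<bar>t\<bar> * sqrt (real n) powr p"
    and "gmax_on p n t T G \<le> phi p n t G"
proof -
  have p0: "p \<noteq> 0" using p by simp
  have "Max (objective (array G) n p t ` T) \<in> objective (array G) n p t ` T" using T by simp
  then obtain x where x: "x \<in> T" "gmax_on p n t T G = objective (array G) n p t x"
    unfolding gmax_objective[OF p0] by auto
  then have xs: "x \<in> sphere_n n" using T by auto
  show "\<bar>gmax_on p n t T G\<bar> \<le> (\<Sum>k\<in>idx n. \<bar>G k\<bar>) + \<bar>t\<bar> * sqrt (real n) powr p"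
    unfolding x(2) by (rule objective_bound[OF xs n p])
  show "gmax_on p n t T G \<le> phi p n t G"
    unfolding x(2) using phi_attained[OF n p, of t G] xs by metis
qed

lemma phi_bound:
  assumes n: "1 \<le> n" and p: "0 < p"
  shows "\<bar>phi p n t G\<bar> \<le> (\<Sum>k\<in>idx n. \<bar>G k\<bar>) + \<bar>t\<bar> * sqrt (real n) powr p"
  using phi_attained[OF n p, of t G] objective_bound[OF _ n p, of _ G t] by metis

text \<open>The sets are initial segments of an enumerated dense subset of the sphere. Strict
  superlevel sets of the continuous objective are open, so they are met by some segment. The sets do
  not depend on \<open>t\<close> or \<open>G\<close>, which gives measurability and access to
  comparison results for finite index sets.\<close>

lemma phi_finite_approx:
  assumes n: "1 \<le> n" and p: "0 < p"
  obtains T where "\<And>k :: nat. finite (T k)" "\<And>k. T k \<noteq> {}" "\<And>k. T k \<subseteq> sphere_n n"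
    "\<And>t G. (\<lambda>k. gmax_on p n t (T k) G) \<longlonglongrightarrow> phi p n t G"
proof -
  obtain D where D: "countable D" "D \<subseteq> sphere_n n" "\<And>U. open U \<Longrightarrow> U \<inter> sphere_n n \<noteq> {} \<Longrightarrow> U \<inter> D \<noteq> {}"
    using countable_dense_subset_exists by blast
  have "D \<noteq> {}" using D(3)[of UNIV] const_in_sphere_n by auto
  then obtain d :: "nat \<Rightarrow> nat \<Rightarrow> real" where d: "D = range d"
    using uncountable_def D(1) by blast
  define T where "T k = d ` {..k}" for k
  have T: "finite (T k)" "T k \<noteq> {}" "T k \<subseteq> sphere_n n" for k
    using D(2) d by (auto simp: T_def)
  have "(\<lambda>k. gmax_on p n t (T k) G) \<longlonglongrightarrow> phi p n t G" for t G
  proof (rule LIMSEQ_I)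
    fix r :: real assume r: "0 < r"
    obtain x where x: "x \<in> sphere_n n" "phi p n t G = objective (array G) n p t x"
      using phi_attained[OF n p] by metis
    let ?U = "{y. phi p n t G - r < objective (array G) n p t y}"
    have "open ?U" by (intro open_Collect_less continuous_on_const continuous_objective p)
    moreover have "x \<in> ?U \<inter> sphere_n n" using x r by simp
    ultimately obtain j where j: "d j \<in> ?U" using D(3)[of ?U] d by blast
    have "norm (gmax_on p n t (T k) G - phi p n t G) < r" if "j \<le> k" for k
    proof -
      have "d j \<in> T k" using that by (auto simp: T_def)
      then have "objective (array G) n p t (d j) \<le> gmax_on p n t (T k) G"
        using p T(1)[of k] by (subst gmax_objective) auto
      with j gmax_bound(2)[OF T n p, of k t G] show ?thesis by simp
    qed
    then show "\<exists>no. \<forall>k\<ge>no. norm (gmax_on p n t (T k) G - phi p n t G) < r" by blast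
  qed
  with T show thesis by (rule that)
qed

lemma phi_restrict:
  assumes p: "0 < p"
  shows "phi p n t (restrict G (idx n)) = phi p n t G"
proof -
  have "objective (array (restrict G (idx n))) n p t = objective (array G) n p t"
  proof
    fix x
    have "p \<noteq> 0" using p by simp
    then show "objective (array (restrict G (idx n))) n p t x = objective (array G) n p t x"
      unfolding objective_eq[OF \<open>p \<noteq> 0\<close>] by simp
  qed
  then show ?thesis by (simp add: phi_def L_max_sphere_def)
qed

lemma measurable_phi:
  assumes n: "1 \<le> n" and p: "0 < p"
  shows "phi p n t \<in> borel_measurable (PiM (idx n) (\<lambda>_. borel))"
proof -
  obtain T where T: "\<And>k :: nat. finite (T k)"
    "\<And>t G. (\<lambda>k. gmax_on p n t (T k) G) \<longlonglongrightarrow> phi p n t G"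
    using phi_finite_approx[OF n p] by metis
  show ?thesis
    by (rule borel_measurable_LIMSEQ_real[OF T(2)]) (rule measurable_gmax[OF T(1) order_refl])
qed

lemma integrable_bound_idx:
  "integrable (gauss (idx n)) (\<lambda>G. (\<Sum>k\<in>idx n. \<bar>G k\<bar>) + c)"
proof -
  interpret G: prob_space "gauss (idx n)" by simp
  show ?thesis
    by (intro Bochner_Integration.integrable_add gauss_sum_abs_moments(1) G.integrable_const) simp
qed

lemma measurable_phi_gauss:
  assumes n: "1 \<le> n" and p: "0 < p"
  shows "phi p n t \<in> borel_measurable (gauss (idx n))"
  using measurable_phi[OF n p] by (simp add: measurable_cong_sets[OF sets_gauss refl])

lemma integrable_phi:
  assumes n: "1 \<le> n" and p: "0 < p"
  shows "integrable (gauss (idx n)) (phi p n t)"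
proof (rule Bochner_Integration.integrable_bound[OF integrable_bound_idx measurable_phi_gauss[OF n p]])
  show "AE G in gauss (idx n). norm (phi p n t G) \<le> norm ((\<Sum>k\<in>idx n. \<bar>G k\<bar>) + \<bar>t\<bar> * sqrt (real n) powr p)"
    using phi_bound[OF n p, of t] by (intro AE_I2) (auto intro: order_trans[OF _ abs_ge_self])
qed

text \<open>Integrability is proved on the three-slot family, where each summand is a single
  Gaussian coordinate, and transported by \<open>gauss_two_copies\<close>.\<close>

lemma integrable_pair_bound:
  "integrable (gauss (idx n) \<Otimes>\<^sub>M gauss (idx n))
     (\<lambda>z. ((\<Sum>k\<in>idx n. \<bar>fst z k\<bar>) + c) + ((\<Sum>k\<in>idx n. \<bar>snd z k\<bar>) + c))"
proof -
  let ?b = "\<lambda>G. (\<Sum>k\<in>idx n. \<bar>G k\<bar>) + c"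
  let ?K3 = "idx n \<times> {0, 1, 2 :: nat}"
  interpret G3: prob_space "gauss ?K3" by simp
  let ?phi = "\<lambda>g. (\<lambda>k\<in>idx n. g (k, 1), \<lambda>k\<in>idx n. g (k, 2))"
  have "(\<lambda>g. \<lambda>k\<in>idx n. g (k, i)) \<in> measurable (gauss ?K3) (gauss (idx n))" if "i \<in> {0, 1, 2}" for i :: nat
    unfolding measurable_cong_sets[OF refl sets_gauss] using that by (intro measurable_restrict measurable_gauss_component) auto
  then have phi: "?phi \<in> measurable (gauss ?K3) (gauss (idx n) \<Otimes>\<^sub>M gauss (idx n))"
    by (intro measurable_Pair) auto
  have b: "?b \<in> borel_measurable (gauss (idx n))"
    by (rule borel_measurable_integrable[OF integrable_bound_idx])
  have m: "(\<lambda>z. ?b (fst z) + ?b (snd z)) \<in> borel_measurable (gauss (idx n) \<Otimes>\<^sub>M gauss (idx n))"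
    by (intro borel_measurable_add[of "\<lambda>z. ?b (fst z)" _ "\<lambda>z. ?b (snd z)"] measurable_compose[OF measurable_fst b] measurable_compose[OF measurable_snd b])
  have I: "integrable (gauss ?K3) (\<lambda>g. \<bar>g (k, i)\<bar>)" if "k \<in> idx n" "i \<in> {0, 1, 2}" for k and i :: nat
    using gauss_moments(3)[of ?K3 "(k, i)" 1] that by simp
  have "integrable (gauss ?K3) (\<lambda>g. ((\<Sum>k\<in>idx n. \<bar>g (k, 1)\<bar>) + c)
      + ((\<Sum>k\<in>idx n. \<bar>g (k, 2)\<bar>) + c))"
    by (intro Bochner_Integration.integrable_add Bochner_Integration.integrable_sum G3.integrable_const I) auto
  then have "integrable (gauss ?K3) (\<lambda>g. ?b (fst (?phi g)) + ?b (snd (?phi g)))"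
    by (rule back_subst[of "integrable (gauss ?K3)"]) simp
  then have "integrable (distr (gauss ?K3) (gauss (idx n) \<Otimes>\<^sub>M gauss (idx n)) ?phi) (\<lambda>z. ?b (fst z) + ?b (snd z))"
    unfolding integrable_distr_eq[OF phi m] .
  then show ?thesis unfolding gauss_two_copies[OF finite_idx] .
qed

definition Ephi :: "real \<Rightarrow> nat \<Rightarrow> real \<Rightarrow> real" where
  "Ephi p n t = (\<integral>G. phi p n t G \<partial>gauss (idx n))"

text \<open>Dominated convergence; the bound from \<open>gmax_bound\<close> is the same for all
  finite sets, so it dominates both the single maxima and the differences of two copies.\<close>

lemma Ephi_finite_approx:
  assumes n: "1 \<le> n" and p: "0 < p"
  obtains T where "\<And>k :: nat. finite (T k)" "\<And>k. T k \<noteq> {}" "\<And>k. T k \<subseteq> sphere_n n"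
    "(\<lambda>k. \<integral>G. gmax_on p n t (T k) G \<partial>gauss (idx n)) \<longlonglongrightarrow> Ephi p n t"
    "(\<lambda>k. \<integral>z. \<bar>gmax_on p n t (T k) (fst z) - gmax_on p n t (T k) (snd z)\<bar>
        \<partial>(gauss (idx n) \<Otimes>\<^sub>M gauss (idx n)))
      \<longlonglongrightarrow> (\<integral>z. \<bar>phi p n t (fst z) - phi p n t (snd z)\<bar> \<partial>(gauss (idx n) \<Otimes>\<^sub>M gauss (idx n)))"
proof -
  obtain T where T: "\<And>k :: nat. finite (T k)" "\<And>k. T k \<noteq> {}" "\<And>k. T k \<subseteq> sphere_n n"
    "\<And>t G. (\<lambda>k. gmax_on p n t (T k) G) \<longlonglongrightarrow> phi p n t G"
    using phi_finite_approx[OF n p] by metis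
  let ?g = "\<lambda>k. gmax_on p n t (T k)"
  let ?P = "gauss (idx n) \<Otimes>\<^sub>M gauss (idx n)"
  let ?b = "\<lambda>G. (\<Sum>k\<in>idx n. \<bar>G k\<bar>) + \<bar>t\<bar> * sqrt (real n) powr p"
  have mg: "?g k \<in> borel_measurable (gauss (idx n))" for k
    using measurable_gmax[OF T(1) order_refl] by (simp add: measurable_cong_sets[OF sets_gauss refl])
  note mp = measurable_phi_gauss[OF n p, of t]
  have gb: "\<bar>?g k G\<bar> \<le> ?b G" for k G by (rule gmax_bound(1)[OF T(1-3) n p])
  have b1: "(\<lambda>k. \<integral>G. ?g k G \<partial>gauss (idx n)) \<longlonglongrightarrow> Ephi p n t"
    unfolding Ephi_def
    by (rule integral_dominated_convergence[where w = ?b, OF mp mg integrable_bound_idx])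
      (use T(4) gb in auto)
  have ib: "integrable ?P (\<lambda>z. ?b (fst z) + ?b (snd z))"
    by (rule integrable_pair_bound)
  have b2: "(\<lambda>k. \<integral>z. \<bar>?g k (fst z) - ?g k (snd z)\<bar> \<partial>?P) \<longlonglongrightarrow> (\<integral>z. \<bar>phi p n t (fst z) - phi p n t (snd z)\<bar> \<partial>?P)"
  proof (rule integral_dominated_convergence[where w = "\<lambda>z. ?b (fst z) + ?b (snd z)", OF _ _ ib])
    show "(\<lambda>z. \<bar>phi p n t (fst z) - phi p n t (snd z)\<bar>) \<in> borel_measurable ?P"
      by (intro borel_measurable_abs borel_measurable_diff measurable_compose[OF measurable_fst mp] measurable_compose[OF measurable_snd mp])
    show "(\<lambda>z. \<bar>?g k (fst z) - ?g k (snd z)\<bar>) \<in> borel_measurable ?P" for k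
      by (intro borel_measurable_abs borel_measurable_diff measurable_compose[OF measurable_fst mg] measurable_compose[OF measurable_snd mg])
    show "AE z in ?P. (\<lambda>k. \<bar>?g k (fst z) - ?g k (snd z)\<bar>) \<longlonglongrightarrow> \<bar>phi p n t (fst z) - phi p n t (snd z)\<bar>"
      by (intro AE_I2 tendsto_rabs tendsto_diff T(4))
    have "norm \<bar>?g k x - ?g k y\<bar> \<le> ?b x + ?b y" for k x y
      using gb[of k x] gb[of k y] by simp
    then show "AE z in ?P. norm \<bar>?g k (fst z) - ?g k (snd z)\<bar> \<le> ?b (fst z) + ?b (snd z)" for k
      by (intro AE_I2)
  qed
  show thesis by (rule that[OF T(1-3) b1 b2])
qed

section \<open>Superadditivity and the limit of the expectations\<close>

text \<open>Fekete's lemma; the limit is the supremum of the quotients. Indices start at 1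
  throughout, and nothing is known about \<open>a 0\<close>.\<close>

lemma superadditive_quotient_convergent:
  fixes a :: "nat \<Rightarrow> real"
  assumes super: "\<And>m n. 1 \<le> m \<Longrightarrow> 1 \<le> n \<Longrightarrow> a m + a n \<le> a (m + n)"
    and bound: "\<And>n. 1 \<le> n \<Longrightarrow> a n \<le> C * real n"
  shows "convergent (\<lambda>n. a n / real n)"
proof -
  define L where "L = (SUP n\<in>{1..}. a n / real n)"
  have bdd: "bdd_above ((\<lambda>n. a n / real n) ` {1..})"
    using bound by (intro bdd_aboveI2[of _ _ C]) (auto simp: divide_le_eq)
  have upper: "a n / real n \<le> L" if "1 \<le> n" for n
    unfolding L_def using that by (intro cSUP_upper bdd) auto
  have mult: "real q * a m + a r \<le> a (q * m + r)" if "1 \<le> m" "1 \<le> r" for q m r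
  proof (induction q)
    case (Suc q)
    have "real (Suc q) * a m + a r \<le> a m + a (q * m + r)" using Suc by (simp add: algebra_simps)
    also have "\<dots> \<le> a (m + (q * m + r))" using that by (intro super) auto
    finally show ?case by (simp add: add_ac)
  qed simp
  have "(\<lambda>n. a n / real n) \<longlonglongrightarrow> L"
  proof (rule LIMSEQ_I)
    fix e :: real assume e: "0 < e"
    have "\<exists>m\<in>{1..}. L - e / 2 < a m / real m"
      using e less_cSUP_iff[of "{1 :: nat..}" "\<lambda>n. a n / real n" "L - e / 2"] bdd unfolding L_def by auto
    then obtain m where m: "1 \<le> m" "L - e / 2 < a m / real m" by auto
    \<comment> \<open>\<open>D\<close> covers both losses in the division with remainder: the value
      \<open>a r\<close>, and the at most \<open>|a m|\<close> by which \<open>q * a m\<close>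
      differs from \<open>n * (a m / m)\<close>.\<close>
    define D where "D = \<bar>a m\<bar> + (\<Sum>r=1..m. \<bar>a r\<bar>)"
    obtain N where N: "2 * D / e < real N"
      using reals_Archimedean2 by blast
    have "norm (a n / real n - L) < e" if n: "Suc N \<le> n" for n
    proof -
      have n1: "1 \<le> n" using n by simp
      \<comment> \<open>The shift by one keeps the remainder in \<open>{1..m}\<close> instead of
        \<open>{0..m - 1}\<close>, so that \<open>a 0\<close> never occurs.\<close>
      define q where "q = (n - 1) div m"
      define r where "r = (n - 1) mod m + 1"
      have qr: "n = q * m + r" using n1 by (simp add: q_def r_def)
      have r: "1 \<le> r" "r \<le> m" using m by (auto simp: r_def Suc_leI)
      have "real q * a m + a r \<le> a n" unfolding qr by (rule mult[OF m(1) r(1)])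
      moreover have "\<bar>a r\<bar> \<le> (\<Sum>r=1..m. \<bar>a r\<bar>)" using r by (intro member_le_sum) auto
      moreover have "real q * a m = real n * (a m / real m) - real r * (a m / real m)"
        using m by (simp add: qr field_simps)
      moreover have "real r * (a m / real m) \<le> \<bar>a m\<bar>"
      proof -
        have "real r * (a m / real m) \<le> real r * (\<bar>a m\<bar> / real m)"
          by (intro mult_left_mono divide_right_mono) auto
        also have "\<dots> \<le> real m * (\<bar>a m\<bar> / real m)"
          using r by (intro mult_right_mono) auto
        finally show ?thesis using m by simp
      qed
      ultimately have "real n * (a m / real m) - D \<le> a n" unfolding D_def by linarith
      then have "(real n * (a m / real m) - D) / real n \<le> a n / real n"
        by (rule divide_right_mono) simp
      then have "a m / real m - D / real n \<le> a n / real n"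
        using n1 by (simp add: diff_divide_distrib)
      moreover have "D / real n < e / 2"
      proof -
        have "2 * D / e < real n" using N n by linarith
        then show ?thesis using e n1 by (simp add: field_simps)
      qed
      ultimately show ?thesis using m(2) upper[OF n1] by simp
    qed
    then show "\<exists>no. \<forall>n\<ge>no. norm (a n / real n - L) < e" by blast
  qed
  then show ?thesis by (rule convergentI)
qed

section \<open>Concatenation of vectors and covariances on the sphere\<close>

definition cat :: "nat \<Rightarrow> nat \<Rightarrow> (nat \<Rightarrow> real) \<Rightarrow> (nat \<Rightarrow> real) \<Rightarrow> nat \<Rightarrow> real" where
  "cat n1 n2 x y = (\<lambda>i\<in>{1..n1 + n2}. if i \<le> n1 then x i else y (i - n1))"

lemma sum_cat:
  "(\<Sum>i=1..n1 + n2. h (cat n1 n2 x y i) (cat n1 n2 x' y' i))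
     = (\<Sum>i=1..n1. h (x i) (x' i)) + (\<Sum>i=1..n2. h (y i) (y' i) :: real)"
proof -
  have split: "(\<Sum>i=1..n1 + n2. f i) = (\<Sum>i=1..n1. f i) + (\<Sum>i=1..n2. f (n1 + i))" for f :: "nat \<Rightarrow> real"
    by (induction n2) (simp_all add: add.assoc)
  show ?thesis unfolding split by (simp add: cat_def)
qed

lemma cat_in_sphere_n:
  assumes "x \<in> sphere_n n1" "y \<in> sphere_n n2"
  shows "cat n1 n2 x y \<in> sphere_n (n1 + n2)"
  using assms sum_cat[of "\<lambda>a b. a\<^sup>2" n1 n2 x y x y] by (simp add: sphere_n_def) (simp add: euclid_def cat_def)

lemma pen_cat:
  assumes "1 \<le> n1" "1 \<le> n2"
  shows "real (n1 + n2) * pen p (n1 + n2) t (cat n1 n2 x y) = real n1 * pen p n1 t x + real n2 * pen p n2 t y"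
  using assms sum_cat[of "\<lambda>a b. \<bar>a\<bar> powr p" n1 n2 x y x y]
  by (simp add: pen_def distrib_left del: of_nat_add)

text \<open>The coefficients form a rank one array, so the double sum factors into a square. This is
  the covariance on which all comparisons below rest.\<close>

lemma sum_coef_mult:
  assumes "1 \<le> n"
  shows "(\<Sum>k\<in>idx n. coef n x k * coef n y k) = (\<Sum>i=1..n. x i * y i)\<^sup>2 / real n ^ 3"
proof -
  have "real n powr (3 / 2) * real n powr (3 / 2) = real n ^ 3"
    using assms by (simp add: powr_add[symmetric] powr_numeral)
  then have "(\<Sum>k\<in>idx n. coef n x k * coef n y k) = (\<Sum>k\<in>idx n. (x (fst k) * y (fst k)) * (x (snd k) * y (snd k))) / real n ^ 3"
    by (simp add: coef_def sum_divide_distrib mult_ac)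
  also have "(\<Sum>k\<in>idx n. (x (fst k) * y (fst k)) * (x (snd k) * y (snd k))) = (\<Sum>i=1..n. x i * y i)\<^sup>2"
    unfolding idx_def power2_eq_square sum_product by (simp add: sum.cartesian_product case_prod_unfold)
  finally show ?thesis .
qed

lemma inner_sphere_n:
  assumes "x \<in> sphere_n n" "y \<in> sphere_n n"
  shows "\<bar>\<Sum>i=1..n. x i * y i\<bar> \<le> real n"
proof -
  have "\<bar>\<Sum>i=1..n. x i * y i\<bar> \<le> (\<Sum>i=1..n. \<bar>x i * y i\<bar>)" by (rule sum_abs)
  also have "\<dots> \<le> (\<Sum>i=1..n. ((x i)\<^sup>2 + (y i)\<^sup>2) / 2)"
  proof (rule sum_mono)
    fix i
    have "0 \<le> (\<bar>x i\<bar> - \<bar>y i\<bar>)\<^sup>2" by simp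
    then show "\<bar>x i * y i\<bar> \<le> ((x i)\<^sup>2 + (y i)\<^sup>2) / 2" by (simp add: power2_diff abs_mult)
  qed
  also have "\<dots> = real n"
    using assms by (simp add: sphere_n_def sum_divide_distrib[symmetric] sum.distrib)
  finally show ?thesis .
qed

lemma self_inner_sphere_n: "x \<in> sphere_n n \<Longrightarrow> (\<Sum>i=1..n. x i * x i) = real n"
  by (simp add: sphere_n_def power2_eq_square)

text \<open>On the sphere \<open>|<x, y>|\<close> is at most \<open>n\<close>, so covariances are at
  most \<open>1/n\<close> and \<open>gmax_concentration\<close> applies with
  \<open>a = 1 / sqrt n\<close>. Averaging over the second copy inside the absolute value then
  replaces it by the mean.\<close>

lemma phi_concentration:
  assumes n: "1 \<le> n" and p: "0 < p"
  shows "(\<integral>G. \<bar>phi p n t G - Ephi p n t\<bar> \<partial>gauss (idx n)) \<le> 2 / sqrt (real n)"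
proof -
  interpret G: prob_space "gauss (idx n)" by simp
  interpret Q: pair_prob_space "gauss (idx n)" "gauss (idx n)" ..
  let ?P = "gauss (idx n) \<Otimes>\<^sub>M gauss (idx n)"
  let ?f = "phi p n t"
  obtain T where T: "\<And>k :: nat. finite (T k)" "\<And>k. T k \<noteq> {}" "\<And>k. T k \<subseteq> sphere_n n"
    "(\<lambda>k. \<integral>z. \<bar>gmax_on p n t (T k) (fst z) - gmax_on p n t (T k) (snd z)\<bar> \<partial>?P)
      \<longlonglongrightarrow> (\<integral>z. \<bar>?f (fst z) - ?f (snd z)\<bar> \<partial>?P)"
    by (rule Ephi_finite_approx[OF n p, of t]) (rule that; assumption)
  have "(\<integral>z. \<bar>gmax_on p n t (T k) (fst z) - gmax_on p n t (T k) (snd z)\<bar> \<partial>?P)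
      \<le> 2 * (1 / sqrt (real n))" for k
  proof (rule gmax_concentration[OF finite_idx T(1,2)])
    show "0 < 1 / sqrt (real n)" using n by simp
    fix x y assume "x \<in> T k" "y \<in> T k"
    then have xy: "x \<in> sphere_n n" "y \<in> sphere_n n" using T(3) by auto
    have "(\<Sum>i=1..n. x i * y i)\<^sup>2 \<le> (real n)\<^sup>2"
      using power_mono[OF inner_sphere_n[OF xy], of 2] by simp
    then have "(\<Sum>i=1..n. x i * y i)\<^sup>2 / real n ^ 3 \<le> (real n)\<^sup>2 / real n ^ 3"
      by (rule divide_right_mono) simp
    also have "\<dots> = (1 / sqrt (real n))\<^sup>2"
      using n by (simp add: power_divide power2_eq_square power3_eq_cube)
    finally show "\<bar>\<Sum>k\<in>idx n. coef n x k * coef n y k\<bar> \<le> (1 / sqrt (real n))\<^sup>2"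
      unfolding sum_coef_mult[OF n] by simp
  qed
  then have le: "(\<integral>z. \<bar>?f (fst z) - ?f (snd z)\<bar> \<partial>?P) \<le> 2 * (1 / sqrt (real n))"
    by (intro LIMSEQ_le_const2[OF T(4)]) auto
  note mp = measurable_phi_gauss[OF n p, of t]
  have int: "integrable ?P (\<lambda>z. \<bar>?f (fst z) - ?f (snd z)\<bar>)"
  proof (rule Bochner_Integration.integrable_bound[OF integrable_pair_bound])
    show "(\<lambda>z. \<bar>?f (fst z) - ?f (snd z)\<bar>) \<in> borel_measurable ?P"
      by (intro borel_measurable_abs borel_measurable_diff measurable_compose[OF measurable_fst mp] measurable_compose[OF measurable_snd mp])
    have "norm \<bar>?f x - ?f y\<bar> \<le> norm (((\<Sum>k\<in>idx n. \<bar>x k\<bar>) + \<bar>t\<bar> * sqrt (real n) powr p) + ((\<Sum>k\<in>idx n. \<bar>y k\<bar>) + \<bar>t\<bar> * sqrt (real n) powr p))" for x y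
      using phi_bound[OF n p, of t x] phi_bound[OF n p, of t y] by simp
    then show "AE z in ?P. norm \<bar>?f (fst z) - ?f (snd z)\<bar>
       \<le> norm (((\<Sum>k\<in>idx n. \<bar>fst z k\<bar>) + \<bar>t\<bar> * sqrt (real n) powr p) + ((\<Sum>k\<in>idx n. \<bar>snd z k\<bar>) + \<bar>t\<bar> * sqrt (real n) powr p))"
      by (intro AE_I2)
  qed
  have int': "integrable ?P (\<lambda>(x, y). \<bar>?f x - ?f y\<bar>)" using int by (simp add: case_prod_unfold)
  have ip: "integrable (gauss (idx n)) ?f" by (rule integrable_phi[OF n p])
  have "(\<integral>x. \<bar>?f x - Ephi p n t\<bar> \<partial>gauss (idx n)) \<le> (\<integral>x. (\<integral>y. \<bar>?f x - ?f y\<bar> \<partial>gauss (idx n)) \<partial>gauss (idx n))"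
  proof (rule integral_mono)
    show "integrable (gauss (idx n)) (\<lambda>x. \<bar>?f x - Ephi p n t\<bar>)"
      by (intro integrable_abs Bochner_Integration.integrable_diff ip G.integrable_const)
    show "integrable (gauss (idx n)) (\<lambda>x. \<integral>y. \<bar>?f x - ?f y\<bar> \<partial>gauss (idx n))"
      using Q.integrable_fst'[OF int] by simp
    fix x
    have i: "integrable (gauss (idx n)) (\<lambda>y. ?f x - ?f y)"
      by (intro Bochner_Integration.integrable_diff ip G.integrable_const)
    have "(\<integral>y. ?f x - ?f y \<partial>gauss (idx n)) = ?f x - Ephi p n t"
      unfolding Ephi_def using ip by (simp add: G.prob_space)
    then show "\<bar>?f x - Ephi p n t\<bar> \<le> (\<integral>y. \<bar>?f x - ?f y\<bar> \<partial>gauss (idx n))"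
      using integral_norm_bound[of "gauss (idx n)" "\<lambda>y. ?f x - ?f y"] by simp
  qed
  also have "\<dots> = (\<integral>z. \<bar>?f (fst z) - ?f (snd z)\<bar> \<partial>?P)"
    using Q.integral_fst'[OF int] by simp
  finally show ?thesis using le by simp
qed

text \<open>With \<open>s = <x, y>\<close>, the padded quadratic process has covariance
  \<open>s^2 / n^3 + 1 / n\<close> and the linear one \<open>2 s / n^2\<close>. The gap is the
  square \<open>(s - n)^2 / n^3\<close>, zero on the diagonal; this determines the coefficient
  \<open>sqrt 2\<close>.\<close>

lemma Ephi_0_le:
  assumes n: "1 \<le> n" and p: "0 < p"
  shows "Ephi p n 0 \<le> sqrt 2"
proof -
  obtain T where T: "\<And>k :: nat. finite (T k)" "\<And>k. T k \<noteq> {}" "\<And>k. T k \<subseteq> sphere_n n"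
    "(\<lambda>k. \<integral>G. gmax_on p n 0 (T k) G \<partial>gauss (idx n)) \<longlonglongrightarrow> Ephi p n 0"
    by (rule Ephi_finite_approx[OF n p, of 0]) (rule that; assumption)
  have "(\<integral>G. gmax_on p n 0 T G \<partial>gauss (idx n)) \<le> sqrt 2"
    if T: "finite T" "T \<noteq> {}" "T \<subseteq> sphere_n n" for T
  proof -
    \<comment> \<open>The extra independent coordinate \<open>(1, 0, 0)\<close> equalizes the variances; having mean zero, it does
      not change the expected maximum.\<close>
    define A where "A = Pair (0 :: nat) ` idx n \<union> {(1, (0, 0))}"
    define B where "B = (\<lambda>i. (2 :: nat, (i, 0 :: nat))) ` {1..n}"
    define K where "K = A \<union> B"
    interpret G: prob_space "gauss K" by simp
    define l where "l x k = (if fst k = 0 then coef n x (snd k) else if fst k = 1 then 1 / sqrt (real n)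
        else sqrt 2 * x (fst (snd k)) / real n)" for x and k :: "nat \<times> nat \<times> nat"
    have fin: "finite A" "finite B" "finite K" by (auto simp: A_def B_def K_def)
    have AB: "A \<inter> B = {}" "A \<union> B = K" by (auto simp: A_def B_def K_def)
    have sA: "(\<Sum>k\<in>A. h k) = (\<Sum>k\<in>idx n. h (0, k)) + h (1, (0, 0))" for h :: "_ \<Rightarrow> real"
      unfolding A_def by (subst sum.union_disjoint) (auto simp: sum.reindex inj_on_def)
    have sB: "(\<Sum>k\<in>B. h k) = (\<Sum>i=1..n. h (2, (i, 0)))" for h :: "_ \<Rightarrow> real"
      unfolding B_def by (subst sum.reindex) (auto simp: inj_on_def)
    have cA: "(\<Sum>k\<in>A. l x k * l y k) = (\<Sum>i=1..n. x i * y i)\<^sup>2 / real n ^ 3 + 1 / real n" for x y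
      unfolding sA using sum_coef_mult[OF n, of x y] by (simp add: l_def)
    have cB: "(\<Sum>k\<in>B. l x k * l y k) = 2 * (\<Sum>i=1..n. x i * y i) / (real n)\<^sup>2" for x y
      unfolding sB by (simp add: l_def sum_distrib_left sum_divide_distrib power2_eq_square mult_ac)
    \<comment> \<open>The blocks exchange their roles in \<open>slepian\<close>: the linear process
      on \<open>B\<close> has the smaller covariances and therefore the larger expected
      maximum.\<close>
    have "(\<integral>g. gmax T A l (\<lambda>_. 0) g \<partial>gauss K) \<le> (\<integral>g. gmax T B l (\<lambda>_. 0) g \<partial>gauss K)"
    proof (rule slepian[OF fin(3) _ _ T(1,2)])
      show "B \<inter> A = {}" "B \<union> A = K" using AB by auto
      fix x assume "x \<in> T"
      then have "(\<Sum>i=1..n. x i * x i) = real n" using T(3) self_inner_sphere_n by auto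
      then show "(\<Sum>k\<in>B. l x k * l x k) = (\<Sum>k\<in>A. l x k * l x k)"
        unfolding cA cB using n by (simp add: power2_eq_square power3_eq_cube)
    next
      fix x y :: "nat \<Rightarrow> real"
      define s where "s = (\<Sum>i=1..n. x i * y i)"
      have "0 \<le> (s - real n)\<^sup>2 / real n ^ 3" by simp
      also have "\<dots> = (s\<^sup>2 / real n ^ 3 + 1 / real n) - 2 * s / (real n)\<^sup>2"
        using n by (simp add: field_simps power2_eq_square power3_eq_cube)
      finally show "(\<Sum>k\<in>B. l x k * l y k) \<le> (\<Sum>k\<in>A. l x k * l y k)"
        unfolding cA cB s_def by simp
    qed
    moreover have "(\<integral>g. gmax T A l (\<lambda>_. 0) g \<partial>gauss K) = (\<integral>G. gmax_on p n 0 T G \<partial>gauss (idx n))"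
    proof -
      let ?g = "\<lambda>g. gmax_on p n 0 T (\<lambda>k\<in>idx n. g (0, k))"
      have inj: "inj_on (Pair (0 :: nat)) (idx n)" "Pair 0 ` idx n \<subseteq> K" by (auto simp: inj_on_def K_def A_def)
      note mg = measurable_gmax[OF T(1) order_refl, of "idx n" "coef n" "pen p n 0"]
      note ig = integrable_gmax[OF finite_idx order_refl T(1,2), of n "coef n" "pen p n 0"]
      have k1: "(1, (0, 0)) \<in> K" by (simp add: K_def A_def)
      have "gmax T A l (\<lambda>_. 0) g = ?g g + g (1, (0, 0)) / sqrt (real n)" for g
      proof -
        have "gmax T A l (\<lambda>_. 0) g = Max ((\<lambda>x. (\<Sum>k\<in>idx n. coef n x k * g (0, k)) + g (1, (0, 0)) / sqrt (real n)) ` T)"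
          unfolding gmax_def sA by (simp add: l_def)
        also have "\<dots> = Max ((\<lambda>x. (\<Sum>k\<in>idx n. coef n x k * g (0, k))) ` T) + g (1, (0, 0)) / sqrt (real n)"
          by (rule Max_add_commute[OF T(1,2)])
        finally show ?thesis by (simp add: gmax_def pen_def)
      qed
      then have "(\<integral>g. gmax T A l (\<lambda>_. 0) g \<partial>gauss K) = (\<integral>g. ?g g + g (1, (0, 0)) / sqrt (real n) \<partial>gauss K)"
        by simp
      also have "\<dots> = (\<integral>g. ?g g \<partial>gauss K) + (\<integral>g. g (1, (0, 0)) / sqrt (real n) \<partial>gauss K)"
        by (intro Bochner_Integration.integral_add integral_gauss_reindex(2)[OF inj mg ig] integrable_divide gauss_moments(1)[OF fin(3) k1])
      also have "(\<integral>g. g (1, (0, 0)) / sqrt (real n) \<partial>gauss K) = 0"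
        using gauss_moments(2)[OF fin(3) k1] by simp
      also have "(\<integral>g. ?g g \<partial>gauss K) = (\<integral>G. gmax_on p n 0 T G \<partial>gauss (idx n))"
        by (rule integral_gauss_reindex(1)[OF inj mg])
      finally show ?thesis by simp
    qed
    moreover have "(\<integral>g. gmax T B l (\<lambda>_. 0) g \<partial>gauss K) \<le> sqrt 2"
    proof -
      \<comment> \<open>The bound \<open>x y \<le> (x^2 + y^2) / 2\<close> in each coordinate,
        together with the fixed norm of \<open>x\<close>, gives a majorant free of \<open>x\<close>
        whose expectation is exactly \<open>sqrt 2\<close>.\<close>
      let ?b = "\<lambda>g. sqrt 2 / (2 * real n) * (real n + (\<Sum>i=1..n. g (2, (i, 0)) * g (2, (i, 0))))"
      have kB: "(2, (i, 0)) \<in> K" if "i \<in> {1..n}" for i using that by (simp add: K_def B_def)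
      have le: "gmax T B l (\<lambda>_. 0) g \<le> ?b g" for g
      proof -
        have "(\<Sum>k\<in>B. l x k * g k) + 0 \<le> ?b g" if "x \<in> T" for x
        proof -
          have x: "(\<Sum>i=1..n. (x i)\<^sup>2) = real n" using T(3) that by (auto simp: sphere_n_def)
          have "(\<Sum>i=1..n. x i * g (2, (i, 0))) \<le> (\<Sum>i=1..n. ((x i)\<^sup>2 + (g (2, (i, 0)))\<^sup>2) / 2)"
          proof (rule sum_mono)
            fix i
            have "0 \<le> (x i - g (2, (i, 0)))\<^sup>2" by simp
            then show "x i * g (2, (i, 0)) \<le> ((x i)\<^sup>2 + (g (2, (i, 0)))\<^sup>2) / 2" by (simp add: power2_diff)
          qed
          also have "\<dots> = (real n + (\<Sum>i=1..n. g (2, (i, 0)) * g (2, (i, 0)))) / 2"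
            unfolding sum_divide_distrib[symmetric] sum.distrib x by (simp add: power2_eq_square)
          finally have "sqrt 2 / real n * (\<Sum>i=1..n. x i * g (2, (i, 0))) \<le> sqrt 2 / real n * ((real n + (\<Sum>i=1..n. g (2, (i, 0)) * g (2, (i, 0)))) / 2)"
            by (intro mult_left_mono) auto
          moreover have "(\<Sum>k\<in>B. l x k * g k) = sqrt 2 / real n * (\<Sum>i=1..n. x i * g (2, (i, 0)))"
            unfolding sB by (simp add: l_def sum_distrib_left mult.assoc)
          ultimately show ?thesis by simp
        qed
        then show ?thesis unfolding gmax_def using T by (subst Max_le_iff) auto
      qed
      have ib: "integrable (gauss K) ?b"
        by (intro integrable_mult_right Bochner_Integration.integrable_add G.integrable_const Bochner_Integration.integrable_sum
            gauss_moments(4)[OF fin(3)] kB)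
      have "B \<subseteq> K" by (simp add: K_def)
      then have "(\<integral>g. gmax T B l (\<lambda>_. 0) g \<partial>gauss K) \<le> (\<integral>g. ?b g \<partial>gauss K)"
        by (intro integral_mono integrable_gmax fin T ib le)
      also have "\<dots> = sqrt 2 / (2 * real n) * (real n + (\<Sum>i=1..n. 1))"
      proof -
        have "(\<integral>g. (real n + (\<Sum>i=1..n. g (2, (i, 0)) * g (2, (i, 0)))) \<partial>gauss K)
            = (\<integral>g. real n \<partial>gauss K) + (\<integral>g. (\<Sum>i=1..n. g (2, (i, 0)) * g (2, (i, 0))) \<partial>gauss K)"
          by (intro Bochner_Integration.integral_add G.integrable_const Bochner_Integration.integrable_sum gauss_moments(4)[OF fin(3)] kB)
        also have "(\<integral>g. real n \<partial>gauss K) = real n" using G.prob_space by simp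
        also have "(\<integral>g. (\<Sum>i=1..n. g (2, (i, 0)) * g (2, (i, 0))) \<partial>gauss K) = (\<Sum>i=1..n. \<integral>g. g (2, (i, 0)) * g (2, (i, 0)) \<partial>gauss K)"
          by (intro Bochner_Integration.integral_sum gauss_moments(4)[OF fin(3)] kB)
        also have "\<dots> = (\<Sum>i=1..n. 1)"
        proof (rule sum.cong[OF refl])
          fix i assume "i \<in> {1..n}"
          from gauss_moments(5)[OF fin(3) kB[OF this] kB[OF this]]
          show "(\<integral>g. g (2, (i, 0)) * g (2, (i, 0)) \<partial>gauss K) = 1" by simp
        qed
        finally show ?thesis by (simp only: integral_mult_right_zero)
      qed
      also have "\<dots> = sqrt 2" using n by simp
      finally show ?thesis .
    qed
    ultimately show ?thesis by simp
  qed
  then show ?thesis using T by (intro LIMSEQ_le_const2[OF T(4)]) auto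
qed


lemma Ephi_superadditive:
  assumes n1: "1 \<le> n1" and n2: "1 \<le> n2" and p: "0 < p"
  shows "real n1 * Ephi p n1 t + real n2 * Ephi p n2 t \<le> real (n1 + n2) * Ephi p (n1 + n2) t"
proof -
  let ?n = "n1 + n2"
  have n: "1 \<le> ?n" using n1 by simp
  \<comment> \<open>In \<open>core\<close> the tag 0 marks the matrix of size \<open>n1 + n2\<close>, the tags 1 and 2 the independent smaller
    matrices. Slepian's inequality applies since
    \<open>(a + b)\<^sup>2 / (n1 + n2) \<le> a\<^sup>2 / n1 + b\<^sup>2 / n2\<close>, with equality for \<open>a = n1\<close> and \<open>b = n2\<close>.\<close>
  have core: "real n1 * (\<integral>G. gmax_on p n1 t T1 G \<partial>gauss (idx n1))
      + real n2 * (\<integral>G. gmax_on p n2 t T2 G \<partial>gauss (idx n2)) \<le> real ?n * Ephi p ?n t"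
    if T1: "finite T1" "T1 \<noteq> {}" "T1 \<subseteq> sphere_n n1" and T2: "finite T2" "T2 \<noteq> {}" "T2 \<subseteq> sphere_n n2" for T1 T2
  proof -
    define A where "A = Pair (0 :: nat) ` idx ?n"
    define B where "B = Pair (1 :: nat) ` idx n1 \<union> Pair 2 ` idx n2"
    define K where "K = A \<union> B"
    \<comment> \<open>The factors \<open>n1 + n2\<close>, \<open>n1\<close> and \<open>n2\<close>
      pass from \<open>phi\<close> to \<open>n\<close> times \<open>phi\<close>, the quantity that
      is superadditive; \<open>c\<close> is scaled in the same way.\<close>
    define l where "l z k = (if fst k = 0 then real ?n * coef ?n (cat n1 n2 (fst z) (snd z)) (snd k)
        else if fst k = 1 then real n1 * coef n1 (fst z) (snd k) else real n2 * coef n2 (snd z) (snd k))"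
      for z and k :: "nat \<times> nat \<times> nat"
    define c where "c z = real n1 * pen p n1 t (fst z) + real n2 * pen p n2 t (snd z)" for z
    define T where "T = T1 \<times> T2"
    have T: "finite T" "T \<noteq> {}" using T1 T2 by (auto simp: T_def)
    have fin: "finite A" "finite B" "finite K" by (auto simp: A_def B_def K_def)
    have AB: "A \<inter> B = {}" "A \<union> B = K" by (auto simp: A_def B_def K_def)
    have sub: "A \<subseteq> K" "B \<subseteq> K" by (auto simp: K_def)
    have sA: "(\<Sum>k\<in>A. h k) = (\<Sum>k\<in>idx ?n. h (0, k))" for h :: "_ \<Rightarrow> real"
      unfolding A_def by (subst sum.reindex) (auto simp: inj_on_def)
    have sB: "(\<Sum>k\<in>B. h k) = (\<Sum>k\<in>idx n1. h (1, k)) + (\<Sum>k\<in>idx n2. h (2, k))" for h :: "_ \<Rightarrow> real"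
      unfolding B_def by (subst sum.union_disjoint) (auto simp: sum.reindex inj_on_def)
    have scale: "real m * real m * (s / real m ^ 3) = s / real m" if "1 \<le> m" for m s
      using that by (simp add: field_simps power3_eq_cube)
    have cA: "(\<Sum>k\<in>A. l (x, y) k * l (x', y') k)
        = ((\<Sum>i=1..n1. x i * x' i) + (\<Sum>i=1..n2. y i * y' i))\<^sup>2 / real ?n" for x y x' y'
    proof -
      have "(\<Sum>k\<in>A. l (x, y) k * l (x', y') k)
          = real ?n * real ?n * (\<Sum>k\<in>idx ?n. coef ?n (cat n1 n2 x y) k * coef ?n (cat n1 n2 x' y') k)"
        unfolding sA by (simp add: l_def sum_distrib_left mult_ac del: of_nat_add)
      then show ?thesis
        unfolding sum_coef_mult[OF n] scale[OF n] sum_cat[of "\<lambda>a b. a * b"] .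
    qed
    have cB: "(\<Sum>k\<in>B. l (x, y) k * l (x', y') k)
        = (\<Sum>i=1..n1. x i * x' i)\<^sup>2 / real n1 + (\<Sum>i=1..n2. y i * y' i)\<^sup>2 / real n2" for x y x' y'
    proof -
      have "(\<Sum>k\<in>B. l (x, y) k * l (x', y') k)
          = real n1 * real n1 * (\<Sum>k\<in>idx n1. coef n1 x k * coef n1 x' k)
          + real n2 * real n2 * (\<Sum>k\<in>idx n2. coef n2 y k * coef n2 y' k)"
        unfolding sB by (simp add: l_def sum_distrib_left mult_ac)
      then show ?thesis unfolding sum_coef_mult[OF n1] sum_coef_mult[OF n2] scale[OF n1] scale[OF n2] .
    qed
    have "(\<integral>g. gmax T B l c g \<partial>gauss K) \<le> (\<integral>g. gmax T A l c g \<partial>gauss K)"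
    proof (rule slepian[OF fin(3) AB T])
      fix z assume "z \<in> T"
      then obtain x y where z: "z = (x, y)" "x \<in> sphere_n n1" "y \<in> sphere_n n2"
        using T1 T2 by (auto simp: T_def)
      show "(\<Sum>k\<in>A. l z k * l z k) = (\<Sum>k\<in>B. l z k * l z k)"
        unfolding z(1) cA cB self_inner_sphere_n[OF z(2)] self_inner_sphere_n[OF z(3)]
        using n1 n2 by (simp add: power2_eq_square)
    next
      fix z z' :: "(nat \<Rightarrow> real) \<times> (nat \<Rightarrow> real)"
      obtain x y x' y' where z: "z = (x, y)" "z' = (x', y')" by (metis surj_pair)
      have convex: "(a + b)\<^sup>2 / real ?n \<le> a\<^sup>2 / real n1 + b\<^sup>2 / real n2" for a b :: real
      proof -
        have "0 \<le> (real n2 * a - real n1 * b)\<^sup>2 / (real n1 * real n2 * real ?n)" by simp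
        also have "\<dots> = a\<^sup>2 / real n1 + b\<^sup>2 / real n2 - (a + b)\<^sup>2 / real ?n"
          using n1 n2 by (simp add: field_simps power2_eq_square)
        finally show ?thesis by simp
      qed
      show "(\<Sum>k\<in>A. l z k * l z' k) \<le> (\<Sum>k\<in>B. l z k * l z' k)"
        unfolding z cA cB by (rule convex)
    qed
    moreover have "(\<integral>g. gmax T A l c g \<partial>gauss K) \<le> real ?n * Ephi p ?n t"
    proof -
      have inj: "inj_on (Pair (0 :: nat)) (idx ?n)" "Pair 0 ` idx ?n \<subseteq> K" by (auto simp: inj_on_def K_def A_def)
      \<comment> \<open>Concatenated vectors lie on the sphere of dimension \<open>n1 + n2\<close>,
        so a maximum over them is bounded by the maximum over that whole sphere.\<close>
      have le: "gmax T A l c g \<le> real ?n * phi p ?n t (\<lambda>k\<in>idx ?n. g (0, k))" for g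
      proof -
        have "(\<Sum>k\<in>A. l z k * g k) + c z \<le> real ?n * phi p ?n t (\<lambda>k\<in>idx ?n. g (0, k))" if "z \<in> T" for z
        proof -
          obtain x y where z: "z = (x, y)" "x \<in> sphere_n n1" "y \<in> sphere_n n2"
            using T1 T2 \<open>z \<in> T\<close> by (auto simp: T_def)
          let ?w = "cat n1 n2 x y"
          have p0: "p \<noteq> 0" using p by simp
          have "(\<Sum>k\<in>A. l z k * g k) + c z = real ?n * ((\<Sum>k\<in>idx ?n. coef ?n ?w k * g (0, k)) + pen p ?n t ?w)"
            unfolding sA distrib_left pen_cat[OF n1 n2]
            by (simp add: l_def c_def z(1) sum_distrib_left mult.assoc del: of_nat_add)
          also have "(\<Sum>k\<in>idx ?n. coef ?n ?w k * g (0, k)) + pen p ?n t ?w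
              = objective (array (\<lambda>k\<in>idx ?n. g (0, k))) ?n p t ?w"
            unfolding objective_eq[OF p0] by simp
          also have "\<dots> \<le> phi p ?n t (\<lambda>k\<in>idx ?n. g (0, k))"
            using phi_attained[OF n p, of t "\<lambda>k\<in>idx ?n. g (0, k)"] cat_in_sphere_n[OF z(2,3)] by metis
          finally show ?thesis by (simp add: mult_left_mono)
        qed
        then show ?thesis unfolding gmax_def using T by (subst Max_le_iff) auto
      qed
      have i: "integrable (gauss K) (\<lambda>g. phi p ?n t (\<lambda>k\<in>idx ?n. g (0, k)))"
        by (rule integral_gauss_reindex(2)[OF inj measurable_phi[OF n p] integrable_phi[OF n p]])
      have "(\<integral>g. gmax T A l c g \<partial>gauss K) \<le> (\<integral>g. real ?n * phi p ?n t (\<lambda>k\<in>idx ?n. g (0, k)) \<partial>gauss K)"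
        by (intro integral_mono integrable_gmax fin sub T integrable_mult_right i le)
      also have "\<dots> = real ?n * Ephi p ?n t"
        unfolding Ephi_def integral_mult_right_zero
        by (simp only: integral_gauss_reindex(1)[OF inj measurable_phi[OF n p]])
      finally show ?thesis .
    qed
    moreover have "real n1 * (\<integral>G. gmax_on p n1 t T1 G \<partial>gauss (idx n1))
      + real n2 * (\<integral>G. gmax_on p n2 t T2 G \<partial>gauss (idx n2)) \<le> (\<integral>g. gmax T B l c g \<partial>gauss K)"
    proof -
      have inj1: "inj_on (Pair (1 :: nat)) (idx n1)" "Pair 1 ` idx n1 \<subseteq> K" by (auto simp: inj_on_def K_def B_def)
      have inj2: "inj_on (Pair (2 :: nat)) (idx n2)" "Pair 2 ` idx n2 \<subseteq> K" by (auto simp: inj_on_def K_def B_def)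
      let ?g1 = "\<lambda>g. gmax_on p n1 t T1 (\<lambda>k\<in>idx n1. g (1, k))"
      let ?g2 = "\<lambda>g. gmax_on p n2 t T2 (\<lambda>k\<in>idx n2. g (2, k))"
      note m1 = measurable_gmax[OF T1(1) order_refl, of "idx n1" "coef n1" "pen p n1 t"]
        and i1 = integrable_gmax[OF finite_idx order_refl T1(1,2), of n1 "coef n1" "pen p n1 t"]
      note m2 = measurable_gmax[OF T2(1) order_refl, of "idx n2" "coef n2" "pen p n2 t"]
        and i2 = integrable_gmax[OF finite_idx order_refl T2(1,2), of n2 "coef n2" "pen p n2 t"]
      note r1 = integral_gauss_reindex[OF inj1 m1] and r2 = integral_gauss_reindex[OF inj2 m2]
      \<comment> \<open>On the block \<open>B\<close> the process is a sum of a function of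
        \<open>x\<close> and a function of \<open>y\<close>; the two maximizers can be combined into
        one point of the product.\<close>
      have le: "real n1 * ?g1 g + real n2 * ?g2 g \<le> gmax T B l c g" for g
      proof -
        have "?g1 g \<in> (\<lambda>x. (\<Sum>k\<in>idx n1. coef n1 x k * (\<lambda>k\<in>idx n1. g (1, k)) k) + pen p n1 t x) ` T1"
          unfolding gmax_def using T1 by (intro Max_in) auto
        then obtain x where x: "x \<in> T1" "?g1 g = (\<Sum>k\<in>idx n1. coef n1 x k * g (1, k)) + pen p n1 t x"
          by auto
        have "?g2 g \<in> (\<lambda>x. (\<Sum>k\<in>idx n2. coef n2 x k * (\<lambda>k\<in>idx n2. g (2, k)) k) + pen p n2 t x) ` T2"
          unfolding gmax_def using T2 by (intro Max_in) auto
        then obtain y where y: "y \<in> T2" "?g2 g = (\<Sum>k\<in>idx n2. coef n2 y k * g (2, k)) + pen p n2 t y"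
          by auto
        have "real n1 * ?g1 g + real n2 * ?g2 g = (\<Sum>k\<in>B. l (x, y) k * g k) + c (x, y)"
          unfolding x(2) y(2) sB by (simp add: l_def c_def distrib_left sum_distrib_left mult.assoc)
        also have "\<dots> \<le> gmax T B l c g"
          unfolding gmax_def using T x(1) y(1) by (intro Max_ge) (auto simp: T_def)
        finally show ?thesis .
      qed
      have "real n1 * (\<integral>G. gmax_on p n1 t T1 G \<partial>gauss (idx n1))
        + real n2 * (\<integral>G. gmax_on p n2 t T2 G \<partial>gauss (idx n2))
        = (\<integral>g. real n1 * ?g1 g \<partial>gauss K) + (\<integral>g. real n2 * ?g2 g \<partial>gauss K)"
        unfolding integral_mult_right_zero by (simp only: r1(1) r2(1))
      also have "\<dots> = (\<integral>g. real n1 * ?g1 g + real n2 * ?g2 g \<partial>gauss K)"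
        by (intro Bochner_Integration.integral_add[symmetric] integrable_mult_right r1(2)[OF i1] r2(2)[OF i2])
      also have "\<dots> \<le> (\<integral>g. gmax T B l c g \<partial>gauss K)"
        by (intro integral_mono integrable_gmax fin sub T Bochner_Integration.integrable_add integrable_mult_right r1(2)[OF i1] r2(2)[OF i2] le)
      finally show ?thesis .
    qed
    ultimately show ?thesis by linarith
  qed
  obtain T1 where T1: "\<And>k :: nat. finite (T1 k)" "\<And>k. T1 k \<noteq> {}" "\<And>k. T1 k \<subseteq> sphere_n n1"
    "(\<lambda>k. \<integral>G. gmax_on p n1 t (T1 k) G \<partial>gauss (idx n1)) \<longlonglongrightarrow> Ephi p n1 t"
    by (rule Ephi_finite_approx[OF n1 p, of t]) (rule that; assumption)
  obtain T2 where T2: "\<And>k :: nat. finite (T2 k)" "\<And>k. T2 k \<noteq> {}" "\<And>k. T2 k \<subseteq> sphere_n n2"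
    "(\<lambda>k. \<integral>G. gmax_on p n2 t (T2 k) G \<partial>gauss (idx n2)) \<longlonglongrightarrow> Ephi p n2 t"
    by (rule Ephi_finite_approx[OF n2 p, of t]) (rule that; assumption)
  show ?thesis
    by (rule LIMSEQ_le_const2[OF tendsto_add[OF tendsto_mult_left[OF T1(4)] tendsto_mult_left[OF T2(4)]]])
      (use core[OF T1(1-3) T2(1-3)] in blast)
qed

section \<open>Dependence on the penalty parameter and the limit function\<close>

lemma phi_antimono:
  assumes n: "1 \<le> n" and p: "0 < p" and st: "s \<le> t"
  shows "phi p n t G \<le> phi p n s G"
proof -
  have p0: "p \<noteq> 0" using p by simp
  obtain x where x: "x \<in> sphere_n n" "phi p n t G = objective (array G) n p t x"
    using phi_attained[OF n p, of t G] by metis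
  have "s * ((\<Sum>i=1..n. \<bar>x i\<bar> powr p) / real n) \<le> t * ((\<Sum>i=1..n. \<bar>x i\<bar> powr p) / real n)"
    using st by (intro mult_right_mono divide_nonneg_nonneg sum_nonneg) auto
  then have "objective (array G) n p t x \<le> objective (array G) n p s x"
    unfolding objective_eq[OF p0] pen_def by simp
  also have "\<dots> \<le> phi p n s G" using phi_attained[OF n p, of s G] x(1) by metis
  finally show ?thesis using x by simp
qed

lemma Ephi_antimono:
  assumes n: "1 \<le> n" and p: "0 < p" and st: "s \<le> t"
  shows "Ephi p n t \<le> Ephi p n s"
  unfolding Ephi_def by (intro integral_mono integrable_phi n p phi_antimono st)

text \<open>For each fixed \<open>x\<close> the objective is affine in the parameter, and a maximum
  of affine functions is convex.\<close>

lemma phi_convex: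
  assumes n: "1 \<le> n" and p: "0 < p" and \<theta>: "0 \<le> \<theta>" "\<theta> \<le> 1"
  shows "phi p n ((1 - \<theta>) * s + \<theta> * t) G \<le> (1 - \<theta>) * phi p n s G + \<theta> * phi p n t G"
proof -
  have p0: "p \<noteq> 0" using p by simp
  obtain x where x: "x \<in> sphere_n n" "phi p n ((1 - \<theta>) * s + \<theta> * t) G = objective (array G) n p ((1 - \<theta>) * s + \<theta> * t) x"
    using phi_attained[OF n p, of "(1 - \<theta>) * s + \<theta> * t" G] by metis
  have "objective (array G) n p ((1 - \<theta>) * s + \<theta> * t) x
      = (1 - \<theta>) * objective (array G) n p s x + \<theta> * objective (array G) n p t x"
    unfolding objective_eq[OF p0] pen_def by (simp add: divide_inverse algebra_simps)
  also have "\<dots> \<le> (1 - \<theta>) * phi p n s G + \<theta> * phi p n t G"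
  proof (intro add_mono mult_left_mono)
    show "objective (array G) n p s x \<le> phi p n s G" using phi_attained[OF n p, of s G] x(1) by metis
    show "objective (array G) n p t x \<le> phi p n t G" using phi_attained[OF n p, of t G] x(1) by metis
  qed (use \<theta> in auto)
  finally show ?thesis using x by simp
qed

lemma Ephi_convex:
  assumes n: "1 \<le> n" and p: "0 < p" and \<theta>: "0 \<le> \<theta>" "\<theta> \<le> 1"
  shows "Ephi p n ((1 - \<theta>) * s + \<theta> * t) \<le> (1 - \<theta>) * Ephi p n s + \<theta> * Ephi p n t"
proof -
  have "Ephi p n ((1 - \<theta>) * s + \<theta> * t) \<le> (\<integral>G. (1 - \<theta>) * phi p n s G + \<theta> * phi p n t G \<partial>gauss (idx n))"
    unfolding Ephi_def
    by (intro integral_mono integrable_phi n p phi_convex \<theta> Bochner_Integration.integrable_add integrable_mult_right)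
  also have "\<dots> = (1 - \<theta>) * Ephi p n s + \<theta> * Ephi p n t"
    unfolding Ephi_def using integrable_phi[OF n p] by simp
  finally show ?thesis .
qed

definition Phi :: "real \<Rightarrow> real \<Rightarrow> real" where
  "Phi p t = lim (\<lambda>n. Ephi p n t)"

text \<open>The linear upper bound required by Fekete's lemma comes from the value at 0 by
  monotonicity, hence the restriction to \<open>0 \<le> t\<close>.\<close>

lemma Ephi_tendsto:
  assumes p: "0 < p" and t: "0 \<le> t"
  shows "(\<lambda>n. Ephi p n t) \<longlonglongrightarrow> Phi p t"
proof -
  have "convergent (\<lambda>n. real n * Ephi p n t / real n)"
  proof (rule superadditive_quotient_convergent)
    show "real m * Ephi p m t + real n * Ephi p n t \<le> real (m + n) * Ephi p (m + n) t" if "1 \<le> m" "1 \<le> n" for m n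
      by (rule Ephi_superadditive[OF that p])
    show "real n * Ephi p n t \<le> sqrt 2 * real n" if "1 \<le> n" for n
      using mult_left_mono[OF order_trans[OF Ephi_antimono[OF that p t] Ephi_0_le[OF that p]], of "real n"]
      by (simp add: mult.commute)
  qed
  then obtain L where "(\<lambda>n. real n * Ephi p n t / real n) \<longlonglongrightarrow> L" by (auto simp: convergent_def)
  then have "(\<lambda>n. Ephi p n t) \<longlonglongrightarrow> L"
    by (rule Lim_transform_eventually) (auto simp: eventually_sequentially intro!: exI[of _ 1])
  then show ?thesis unfolding Phi_def by (simp add: limI)
qed

lemma Phi_convex_on: "0 < p \<Longrightarrow> convex_on {0<..} (Phi p)"
proof (rule convex_onI)
  fix \<theta> s t :: real
  assume p: "0 < p" and a: "0 < \<theta>" "\<theta> < 1" "s \<in> {0<..}" "t \<in> {0<..}"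
  have "(\<lambda>n. (1 - \<theta>) * Ephi p n s + \<theta> * Ephi p n t) \<longlonglongrightarrow> (1 - \<theta>) * Phi p s + \<theta> * Phi p t"
    using a p by (intro tendsto_intros Ephi_tendsto) auto
  moreover have "(\<lambda>n. Ephi p n ((1 - \<theta>) * s + \<theta> * t)) \<longlonglongrightarrow> Phi p ((1 - \<theta>) * s + \<theta> * t)"
    using a p by (intro Ephi_tendsto) auto
  ultimately show "Phi p ((1 - \<theta>) *\<^sub>R s + \<theta> *\<^sub>R t) \<le> (1 - \<theta>) * Phi p s + \<theta> * Phi p t"
    using Ephi_convex[of _ p \<theta> s t] p a by (intro LIMSEQ_le) (auto intro!: exI[of _ 1])
qed simp

lemma Phi_continuous_on: "0 < p \<Longrightarrow> continuous_on {0<..} (Phi p)"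
  by (intro convex_on_continuous Phi_convex_on) auto

section \<open>Scaling\<close>

text \<open>Bernoulli's inequality for real exponents, read off Young's inequality for
  \<open>y\<close> and 1 with conjugate exponents \<open>q\<close> and
  \<open>q / (q - 1)\<close>.\<close>

lemma powr_ge_tangent:
  fixes y q :: real
  assumes "1 < q" "0 \<le> y"
  shows "1 + q * (y - 1) \<le> y powr q"
proof -
  have "y * 1 \<le> y powr q / q + 1 powr (q / (q - 1)) / (q / (q - 1))"
    using assms by (intro Youngs_inequality) (auto simp: field_simps)
  then have "q * y \<le> q * (y powr q / q + 1 powr (q / (q - 1)) / (q / (q - 1)))"
    using assms by (intro mult_left_mono) auto
  also have "\<dots> = y powr q + (q - 1)" using assms by (simp add: distrib_left)
  finally show ?thesis by (simp add: algebra_simps)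
qed

lemma objective_alt:
  assumes "p \<noteq> 0"
  shows "objective (array G) n p t x
    = (\<Sum>k\<in>idx n. x (fst k) * x (snd k) * G k) / real n powr (3 / 2) - t * (\<Sum>i=1..n. \<bar>x i\<bar> powr p) / real n"
  unfolding objective_def quad_form_eq normalized_norm_powr[OF assms] by simp

text \<open>The tangent bound with \<open>q = p / 2\<close> at each squared coordinate; the linear
  terms cancel in the sum because the squares have mean 1. The condition \<open>1 < q\<close> is
  \<open>2 < p\<close>.\<close>

lemma sphere_n_power_mean:
  assumes x: "x \<in> sphere_n n" and n: "1 \<le> n" and p: "2 < p"
  shows "1 \<le> (\<Sum>i=1..n. \<bar>x i\<bar> powr p) / real n"
proof -
  have e: "\<bar>x i\<bar> powr p = ((x i)\<^sup>2) powr (p / 2)" for i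
  proof -
    have "(x i)\<^sup>2 = \<bar>x i\<bar> powr 2" by (simp add: powr_numeral)
    then show ?thesis unfolding \<open>(x i)\<^sup>2 = \<bar>x i\<bar> powr 2\<close> powr_powr by simp
  qed
  have "real n = (\<Sum>i=1..n. 1 + p / 2 * ((x i)\<^sup>2 - 1))"
    using x unfolding sum.distrib sum_distrib_left[symmetric] sum_subtractf by (simp add: sphere_n_def)
  also have "\<dots> \<le> (\<Sum>i=1..n. \<bar>x i\<bar> powr p)"
    unfolding e using p by (intro sum_mono powr_ge_tangent) auto
  finally show ?thesis using n by simp
qed

lemma phi_decay:
  assumes n: "1 \<le> n" and p: "2 < p" and t: "0 \<le> t"
  shows "phi p n t G \<le> phi p n 0 G - t"
proof -
  have p': "0 < p" "p \<noteq> 0" using p by auto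
  obtain x where x: "x \<in> sphere_n n" "phi p n t G = objective (array G) n p t x"
    using phi_attained[OF n p'(1), of t G] by metis
  have "t * 1 \<le> t * ((\<Sum>i=1..n. \<bar>x i\<bar> powr p) / real n)"
    using t by (intro mult_left_mono sphere_n_power_mean[OF x(1) n p])
  then have "objective (array G) n p t x \<le> objective (array G) n p 0 x - t"
    unfolding objective_alt[OF p'(2)] by simp
  also have "\<dots> \<le> phi p n 0 G - t" using phi_attained[OF n p'(1), of 0 G] x(1) by (metis diff_right_mono)
  finally show ?thesis using x by simp
qed

lemma Phi_le:
  assumes p: "2 < p" and t: "0 \<le> t"
  shows "Phi p t \<le> sqrt 2 - t"
proof (rule LIMSEQ_le_const2[OF Ephi_tendsto])
  have "Ephi p n t \<le> sqrt 2 - t" if n: "1 \<le> n" for n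
  proof -
    interpret G: prob_space "gauss (idx n)" by simp
    have p0: "0 < p" using p by simp
    have "Ephi p n t \<le> (\<integral>G. phi p n 0 G - t \<partial>gauss (idx n))"
      unfolding Ephi_def
      by (intro integral_mono integrable_phi n p0 phi_decay p t Bochner_Integration.integrable_diff G.integrable_const)
    also have "\<dots> = Ephi p n 0 - t"
      unfolding Ephi_def using integrable_phi[OF n p0] by (simp add: G.prob_space)
    finally show ?thesis using Ephi_0_le[OF n p0] by simp
  qed
  then show "\<exists>N. \<forall>n\<ge>N. Ephi p n t \<le> sqrt 2 - t" by blast
qed (use p t in auto)

lemma Phi_antimono:
  assumes p: "0 < p" and st: "0 \<le> s" "s \<le> t"
  shows "Phi p t \<le> Phi p s"
proof (rule LIMSEQ_le[OF Ephi_tendsto Ephi_tendsto])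
  show "\<exists>N. \<forall>n\<ge>N. Ephi p n t \<le> Ephi p n s"
    using Ephi_antimono[OF _ p st(2)] by blast
qed (use p st in auto)

text \<open>One map for two purposes: zero padding into a larger dimension and, for
  \<open>m = n\<close>, multiplication by \<open>r\<close> within extensional functions.\<close>

definition embed :: "nat \<Rightarrow> nat \<Rightarrow> real \<Rightarrow> (nat \<Rightarrow> real) \<Rightarrow> nat \<Rightarrow> real" where
  "embed m n r x = (\<lambda>i\<in>{1..n}. if i \<le> m then r * x i else 0)"

lemma embed_in_euclid: "embed m n r x \<in> euclid n"
  by (simp add: embed_def euclid_def)

lemma sum_embed:
  fixes h :: "real \<Rightarrow> real"
  assumes "m \<le> n" "h 0 = 0"
  shows "(\<Sum>i=1..n. h (embed m n r x i)) = (\<Sum>i=1..m. h (r * x i))"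
  using assms by (intro sum.mono_neutral_cong_right) (auto simp: embed_def)

lemma objective_embed:
  assumes mn: "m \<le> n" and p: "0 < p" and r: "0 \<le> r"
  shows "objective (array G) n p t (embed m n r x)
    = r\<^sup>2 * (\<Sum>k\<in>idx m. x (fst k) * x (snd k) * G k) / real n powr (3 / 2)
      - t * (r powr p * (\<Sum>i=1..m. \<bar>x i\<bar> powr p)) / real n"
proof -
  have p0: "p \<noteq> 0" using p by simp
  have "(\<Sum>i=1..n. \<bar>embed m n r x i\<bar> powr p) = (\<Sum>i=1..m. \<bar>r * x i\<bar> powr p)"
    by (rule sum_embed[OF mn]) simp
  also have "\<dots> = r powr p * (\<Sum>i=1..m. \<bar>x i\<bar> powr p)"
    using r by (simp add: abs_mult powr_mult sum_distrib_left)
  finally have 1: "(\<Sum>i=1..n. \<bar>embed m n r x i\<bar> powr p) = r powr p * (\<Sum>i=1..m. \<bar>x i\<bar> powr p)" .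
  have "(\<Sum>k\<in>idx n. embed m n r x (fst k) * embed m n r x (snd k) * G k)
      = (\<Sum>k\<in>idx m. (r * x (fst k)) * (r * x (snd k)) * G k)"
    using mn by (intro sum.mono_neutral_cong_right) (auto simp: idx_def embed_def)
  also have "\<dots> = r\<^sup>2 * (\<Sum>k\<in>idx m. x (fst k) * x (snd k) * G k)"
    by (simp add: sum_distrib_left power2_eq_square mult_ac)
  finally show ?thesis unfolding objective_alt[OF p0] 1 by simp
qed

lemma sum_square_embed:
  "m \<le> n \<Longrightarrow> (\<Sum>i=1..n. (embed m n r x i)\<^sup>2) = r\<^sup>2 * (\<Sum>i=1..m. (x i)\<^sup>2)"
  using sum_embed[of m n "\<lambda>a. a\<^sup>2" r x] by (simp add: power_mult_distrib sum_distrib_left)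

text \<open>Padding a vector from dimension \<open>m\<close> to \<open>n = s m\<close> and
  multiplying it by \<open>sqrt s\<close> preserves the normalized 2-norm. The quadratic term gains
  \<open>s / s^(3/2) = s^(-1/2)\<close> and the penalty \<open>s^(p/2) / s\<close>; taking out
  \<open>s^(-1/2)\<close> leaves the power \<open>(p - 1) / 2\<close> on the parameter.\<close>

lemma phi_scaling:
  assumes m: "1 \<le> m" "m \<le> n" and p: "0 < p"
  defines "s \<equiv> real n / real m"
  shows "s powr (- 1 / 2) * phi p m (t * s powr ((p - 1) / 2)) G \<le> phi p n t G"
proof -
  have n: "1 \<le> n" using m by simp
  have s: "0 < s" and ns: "real n = s * real m" using m by (auto simp: s_def)
  have p0: "p \<noteq> 0" using p by simp
  let ?t = "t * s powr ((p - 1) / 2)"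
  obtain x where x: "x \<in> sphere_n m" "phi p m ?t G = objective (array G) m p ?t x"
    using phi_attained[OF m(1) p, of ?t G] by metis
  let ?y = "embed m n (sqrt s) x"
  have "?y \<in> sphere_n n"
    using x(1) s sum_square_embed[OF m(2), of "sqrt s" x] embed_in_euclid[of m n "sqrt s" x]
    by (simp add: sphere_n_def ns)
  then have "objective (array G) n p t ?y \<le> phi p n t G"
    using phi_attained[OF n p, of t G] by metis
  moreover have "objective (array G) n p t ?y = s powr (- 1 / 2) * objective (array G) m p ?t x"
  proof -
    let ?Q = "\<Sum>k\<in>idx m. x (fst k) * x (snd k) * G k" and ?P = "\<Sum>i=1..m. \<bar>x i\<bar> powr p"
    have 1: "(sqrt s)\<^sup>2 * ?Q / real n powr (3 / 2) = s powr (- 1 / 2) * (?Q / real m powr (3 / 2))"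
    proof -
      have "real n powr (3 / 2) = s powr (3 / 2) * real m powr (3 / 2)"
        unfolding ns using s by (simp add: powr_mult)
      moreover have "s = s powr (- 1 / 2) * s powr (3 / 2)"
        using s by (simp add: powr_add[symmetric])
      then have "s * ?Q / (s powr (3 / 2) * real m powr (3 / 2)) = s powr (- 1 / 2) * s powr (3 / 2) * ?Q / (s powr (3 / 2) * real m powr (3 / 2))"
        by simp
      ultimately show ?thesis using s by simp
    qed
    have "sqrt s powr p = s powr (p / 2)"
      using s by (simp add: powr_half_sqrt[symmetric] powr_powr)
    also have "\<dots> = s * (s powr (- 1 / 2) * s powr ((p - 1) / 2))"
    proof -
      have "s * (s powr (- 1 / 2) * s powr ((p - 1) / 2)) = s powr 1 * (s powr (- 1 / 2) * s powr ((p - 1) / 2))"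
        using s by simp
      also have "\<dots> = s powr (1 + (- 1 / 2 + (p - 1) / 2))" by (simp only: powr_add)
      also have "1 + (- 1 / 2 + (p - 1) / 2) = p / 2" by (simp add: field_simps)
      finally show ?thesis ..
    qed
    finally have "t * (sqrt s powr p * ?P) / real n = s powr (- 1 / 2) * (?t * ?P / real m)"
      unfolding ns using s by (simp add: mult_ac)
    with 1 show ?thesis
      unfolding objective_embed[OF m(2) p real_sqrt_ge_zero[OF less_imp_le[OF s]]] unfolding objective_alt[OF p0]
      by (simp add: right_diff_distrib)
  qed
  ultimately show ?thesis using x by simp
qed

text \<open>The quadratic form gains a factor \<open>u\<close> and the penalty
  \<open>u^(p/2)\<close>; taking out \<open>u\<close> leaves the exponent
  \<open>p / 2 - 1\<close>.\<close>

lemma objective_smul: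
  assumes p: "0 < p" and u: "0 < u"
  shows "objective (array G) n p t (embed n n (sqrt u) x) = u * objective (array G) n p (t * u powr (p / 2 - 1)) x"
proof -
  have p0: "p \<noteq> 0" using p by simp
  have "sqrt u powr p = u powr (p / 2)"
    using u by (simp add: powr_half_sqrt[symmetric] powr_powr)
  also have "\<dots> = u * u powr (p / 2 - 1)" using u by (simp add: powr_diff)
  finally show ?thesis
    unfolding objective_embed[OF order_refl p real_sqrt_ge_zero[OF less_imp_le[OF u]]] unfolding objective_alt[OF p0]
    using u by (simp add: right_diff_distrib mult_ac)
qed

lemma euclid_decompose:
  assumes x: "x \<in> euclid n" and u: "(\<Sum>i=1..n. (x i)\<^sup>2) = real n * u" "0 < u"
  obtains y where "y \<in> sphere_n n" "x = embed n n (sqrt u) y"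
proof (rule that[of "embed n n (1 / sqrt u) x"])
  show "embed n n (1 / sqrt u) x \<in> sphere_n n"
    using u embed_in_euclid[of n n "1 / sqrt u" x] unfolding sphere_n_def
    by (simp add: sum_square_embed power_divide del: One_nat_def)
  show "x = embed n n (sqrt u) (embed n n (1 / sqrt u) x)"
  proof
    fix i show "x i = embed n n (sqrt u) (embed n n (1 / sqrt u) x) i"
      using x u(2) by (cases "i \<in> {1..n}") (auto simp: embed_def euclid_def PiE_iff extensional_def)
  qed
qed

section \<open>Spheres of general radius and the unrestricted maximum\<close>

lemma L_max_sphere_eq:
  assumes n: "1 \<le> n" and p: "0 < p" and u: "0 < u"
  shows "L_max_sphere (array G) n p u t = u * phi p n (t * u powr (p / 2 - 1)) G"
proof -
  let ?t = "t * u powr (p / 2 - 1)"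
  obtain x where x: "x \<in> sphere_n n" "phi p n ?t G = objective (array G) n p ?t x"
    "\<And>y. y \<in> sphere_n n \<Longrightarrow> objective (array G) n p ?t y \<le> phi p n ?t G"
    by (rule phi_attained[OF n p, of ?t G]) (rule that; assumption)
  have S: "{x \<in> euclid n. (normalized_norm n 2 x)\<^sup>2 = u} = {x \<in> euclid n. (\<Sum>i=1..n. (x i)\<^sup>2) = real n * u}"
    unfolding normalized_norm_square using n by (auto simp: field_simps)
  have "max_over (objective (array G) n p t) {x \<in> euclid n. (\<Sum>i=1..n. (x i)\<^sup>2) = real n * u}
      = objective (array G) n p t (embed n n (sqrt u) x)"
  proof (rule max_over_eqI)
    show "embed n n (sqrt u) x \<in> {x \<in> euclid n. (\<Sum>i=1..n. (x i)\<^sup>2) = real n * u}"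
      using x(1) u embed_in_euclid[of n n "sqrt u" x] by (simp add: sum_square_embed sphere_n_def del: One_nat_def)
    fix y assume "y \<in> {x \<in> euclid n. (\<Sum>i=1..n. (x i)\<^sup>2) = real n * u}"
    then have y: "y \<in> euclid n" "(\<Sum>i=1..n. (y i)\<^sup>2) = real n * u" by blast+
    obtain z where z: "z \<in> sphere_n n" "y = embed n n (sqrt u) z"
      by (rule euclid_decompose[OF y u])
    show "objective (array G) n p t y \<le> objective (array G) n p t (embed n n (sqrt u) x)"
      unfolding z(2) objective_smul[OF p u] x(2)[symmetric] using x(3)[OF z(1)] u by (intro mult_left_mono) auto
  qed
  then show ?thesis
    unfolding L_max_sphere_def S objective_smul[OF p u] x(2) .
qed

lemma objective_le_phi:
  assumes n: "1 \<le> n" and p: "0 < p" and x: "x \<in> euclid n"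
    and u: "(\<Sum>i=1..n. (x i)\<^sup>2) = real n * u" "0 < u"
  shows "objective (array G) n p t x \<le> u * phi p n (t * u powr (p / 2 - 1)) G"
proof -
  obtain y where y: "y \<in> sphere_n n" "x = embed n n (sqrt u) y"
    by (rule euclid_decompose[OF x u])
  then show ?thesis
    unfolding y(2) objective_smul[OF p u(2)] using u(2) phi_attained[OF n p, of "t * u powr (p / 2 - 1)" G]
    by (metis mult_left_mono less_imp_le)
qed

lemma objective_zero:
  assumes p: "0 < p" and x: "(\<Sum>i=1..n. (x i)\<^sup>2) = 0"
  shows "objective (array G) n p t x = 0"
proof -
  have p0: "p \<noteq> 0" using p by simp
  have "x i = 0" if "i \<in> {1..n}" for i
    using x that by (subst (asm) sum_nonneg_eq_0_iff) auto
  then have "(\<Sum>k\<in>idx n. x (fst k) * x (snd k) * G k) = 0" "(\<Sum>i=1..n. \<bar>x i\<bar> powr p) = 0"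
    by (auto simp: idx_def intro!: sum.neutral)
  then show ?thesis unfolding objective_alt[OF p0] by simp
qed

text \<open>\<open>U\<close> solves \<open>t U^(p/2-1) = C\<close>. Beyond squared norm
  \<open>n U\<close> the decay of \<open>phi\<close> makes the objective at most 0, its value at the
  origin, so a maximizer on the compact ball is a global one.\<close>

lemma L_max_attained:
  assumes n: "1 \<le> n" and p: "2 < p" and t: "0 < t"
  obtains x where "x \<in> euclid n" "L_max (array G) n p t = objective (array G) n p t x"
    "\<And>y. y \<in> euclid n \<Longrightarrow> objective (array G) n p t y \<le> L_max (array G) n p t"
proof -
  have p': "0 < p" using p by simp
  define C where "C = \<bar>phi p n 0 G\<bar>"
  define U where "U = (C / t) powr (1 / (p / 2 - 1))"
  have far: "objective (array G) n p t y \<le> 0" if y: "y \<in> euclid n" "\<not> (\<Sum>i=1..n. (y i)\<^sup>2) \<le> real n * U" for y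
  proof -
    define u where "u = (\<Sum>i=1..n. (y i)\<^sup>2) / real n"
    have u: "(\<Sum>i=1..n. (y i)\<^sup>2) = real n * u" using n by (simp add: u_def)
    have Uu: "U < u" using y(2) n unfolding u by simp
    have U0: "0 \<le> U" by (simp add: U_def)
    then have u0: "0 < u" using Uu by simp
    have "C / t = U powr (p / 2 - 1)"
      using p t by (simp add: U_def powr_powr C_def)
    also have "\<dots> \<le> u powr (p / 2 - 1)" using Uu U0 p by (intro powr_mono2) auto
    finally have Ct: "C \<le> t * u powr (p / 2 - 1)" using t by (simp add: field_simps)
    have "phi p n (t * u powr (p / 2 - 1)) G \<le> phi p n 0 G - t * u powr (p / 2 - 1)"
      using t by (intro phi_decay n p) auto
    also have "\<dots> \<le> 0" using Ct unfolding C_def by linarith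
    finally show ?thesis
      using objective_le_phi[OF n p' y(1) u u0, of G t] u0 by (simp add: mult_nonneg_nonpos order_trans)
  qed
  let ?S = "{x \<in> euclid n. (\<Sum>i=1..n. (x i)\<^sup>2) \<le> real n * U}"
  have z: "(\<lambda>i\<in>{1..n}. 0) \<in> ?S" by (simp add: euclid_def U_def)
  obtain x where x: "x \<in> ?S" "\<And>y. y \<in> ?S \<Longrightarrow> objective (array G) n p t y \<le> objective (array G) n p t x"
    using continuous_attains_sup[OF compact_euclid_ball _ continuous_on_subset[OF continuous_objective[OF p'] subset_UNIV]] z
    by blast
  have x0: "0 \<le> objective (array G) n p t x"
    using x(2)[OF z] objective_zero[OF p', of "\<lambda>i\<in>{1..n}. 0" n G t] by simp
  have le: "objective (array G) n p t y \<le> objective (array G) n p t x" if "y \<in> euclid n" for y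
    using far[OF that] x(2)[of y] x0 that by (cases "(\<Sum>i=1..n. (y i)\<^sup>2) \<le> real n * U") auto
  have "L_max (array G) n p t = objective (array G) n p t x"
    unfolding L_max_def using x(1) le by (intro max_over_eqI) auto
  with x(1) le show thesis by (intro that[of x]) auto
qed

lemma L_max_ge:
  assumes n: "1 \<le> n" and p: "2 < p" and t: "0 < t" and u: "0 < u"
  shows "u * phi p n (t * u powr (p / 2 - 1)) G \<le> L_max (array G) n p t"
proof -
  have p': "0 < p" using p by simp
  obtain x where x: "phi p n (t * u powr (p / 2 - 1)) G = objective (array G) n p (t * u powr (p / 2 - 1)) x"
    using phi_attained[OF n p', of "t * u powr (p / 2 - 1)" G] by metis
  have "u * phi p n (t * u powr (p / 2 - 1)) G = objective (array G) n p t (embed n n (sqrt u) x)"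
    unfolding objective_smul[OF p' u] x ..
  also have "\<dots> \<le> L_max (array G) n p t"
    using L_max_attained[OF n p t, of G] embed_in_euclid by metis
  finally show ?thesis .
qed

text \<open>The first alternative allows for a maximizer at the origin, which lies on no sphere with
  \<open>0 < u\<close>.\<close>

lemma L_max_cases:
  assumes n: "1 \<le> n" and p: "2 < p" and t: "0 < t"
  shows "L_max (array G) n p t \<le> 0 \<or> (\<exists>u>0. L_max (array G) n p t \<le> u * phi p n (t * u powr (p / 2 - 1)) G)"
proof -
  have p': "0 < p" using p by simp
  obtain x where x: "x \<in> euclid n" "L_max (array G) n p t = objective (array G) n p t x"
    using L_max_attained[OF n p t, of G] by metis
  define u where "u = (\<Sum>i=1..n. (x i)\<^sup>2) / real n"
  have u: "(\<Sum>i=1..n. (x i)\<^sup>2) = real n * u" using n by (simp add: u_def)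
  have "0 \<le> u" unfolding u_def by (intro divide_nonneg_nonneg sum_nonneg) auto
  then consider "u = 0" | "0 < u" by fastforce
  then show ?thesis
  proof cases
    case 1
    then show ?thesis using objective_zero[OF p', of x n G t] u x(2) by simp
  next
    case 2
    then show ?thesis using objective_le_phi[OF n p' x(1) u 2, of G t] x(2) by auto
  qed
qed

section \<open>Almost sure convergence\<close>

text \<open>The shift makes the first value 1, so that every positive \<open>n\<close> is bracketed
  by consecutive values. The exponent 4 turns the rate \<open>2 / sqrt n\<close> into
  \<open>2 / (k + 1)^2\<close>.\<close>

definition fourth :: "nat \<Rightarrow> nat" where
  "fourth k = (k + 1) ^ 4"

lemma fourth_bracket:
  obtains \<kappa> where "\<And>n. 1 \<le> n \<Longrightarrow> fourth (\<kappa> n) \<le> n" "\<And>n. n < fourth (\<kappa> n + 1)"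
    "filterlim \<kappa> at_top sequentially"
proof -
  define \<kappa> where "\<kappa> n = (LEAST k. n < fourth (k + 1))" for n
  have "n < fourth (n + 1)" for n
    using self_le_power[of "n + 2" 4] by (simp add: fourth_def)
  then have up: "n < fourth (\<kappa> n + 1)" for n
    unfolding \<kappa>_def by (rule LeastI)
  have low: "fourth (\<kappa> n) \<le> n" if "1 \<le> n" for n
  proof (cases "\<kappa> n")
    case 0
    then show ?thesis using that by (simp add: fourth_def)
  next
    case (Suc k)
    then have "k < \<kappa> n" by simp
    then have "\<not> n < fourth (k + 1)" unfolding \<kappa>_def by (rule not_less_Least)
    then show ?thesis using Suc by simp
  qed
  have "filterlim \<kappa> at_top sequentially"
  proof (rule filterlim_at_top[THEN iffD2], rule allI)
    fix K
    have "K \<le> \<kappa> n" if "fourth K \<le> n" for n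
    proof (rule ccontr)
      assume "\<not> K \<le> \<kappa> n"
      then have "fourth (\<kappa> n + 1) \<le> fourth K" unfolding fourth_def by (intro power_mono) auto
      with up[of n] that show False by simp
    qed
    then show "\<forall>\<^sub>F n in sequentially. K \<le> \<kappa> n" unfolding eventually_sequentially by blast
  qed
  with low up show thesis by (rule that)
qed

lemma fourth_ratio_tendsto: "(\<lambda>k. real (fourth (k + 1)) / real (fourth k)) \<longlonglongrightarrow> 1"
proof -
  have "(\<lambda>k. 1 + 1 / real (Suc k)) \<longlonglongrightarrow> 1 + 0"
    by (intro tendsto_add tendsto_const LIMSEQ_Suc[OF lim_1_over_n])
  then have "(\<lambda>k. (1 + 1 / real (Suc k)) ^ 4) \<longlonglongrightarrow> (1 + 0) ^ 4" by (rule tendsto_power)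
  moreover have "(1 + 1 / real (Suc k)) ^ 4 = real (fourth (k + 1)) / real (fourth k)" for k
  proof -
    have "1 + 1 / real (Suc k) = real (k + 2) / real (k + 1)" by (simp add: field_simps)
    then show ?thesis by (simp only: power_divide fourth_def of_nat_power add.assoc) simp
  qed
  ultimately show ?thesis by simp
qed

section \<open>Pathwise convergence for one realization of the array\<close>

context
  fixes p :: real and G :: "nat \<times> nat \<Rightarrow> real"
  assumes p: "2 < p"
    and conv: "\<And>q. q \<in> \<rat> \<Longrightarrow> 0 \<le> q \<Longrightarrow> (\<lambda>k. phi p (fourth k) q G) \<longlonglongrightarrow> Phi p q"
begin

lemma phi_tendsto_Phi:
  assumes t: "0 < t"
  shows "(\<lambda>n. phi p n t G) \<longlonglongrightarrow> Phi p t"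
proof -
  have p0: "0 < p" using p by simp
  obtain \<kappa> where \<kappa>: "\<And>n. 1 \<le> n \<Longrightarrow> fourth (\<kappa> n) \<le> n" "\<And>n. n < fourth (\<kappa> n + 1)"
    "filterlim \<kappa> at_top sequentially"
    by (rule fourth_bracket) (rule that; assumption)
  define a where "a n = fourth (\<kappa> n)" for n
  define b where "b n = fourth (\<kappa> n + 1)" for n
  have a1: "1 \<le> a n" for n by (simp add: a_def fourth_def)
  have an: "a n \<le> n" if "1 \<le> n" for n using \<kappa>(1)[OF that] by (simp add: a_def)
  have nb: "n \<le> b n" for n using less_imp_le[OF \<kappa>(2)] by (simp add: b_def)
  have \<kappa>': "filterlim (\<lambda>n. \<kappa> n + 1) at_top sequentially"
    by (rule filterlim_compose[OF filterlim_add_const_nat_at_top \<kappa>(3)])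
  have ca: "(\<lambda>n. phi p (a n) q G) \<longlonglongrightarrow> Phi p q" if "q \<in> \<rat>" "0 \<le> q" for q
    unfolding a_def by (rule filterlim_compose[OF conv[OF that] \<kappa>(3)])
  have cb: "(\<lambda>n. phi p (b n) q G) \<longlonglongrightarrow> Phi p q" if "q \<in> \<rat>" "0 \<le> q" for q
    unfolding b_def by (rule filterlim_compose[OF conv[OF that] \<kappa>'])
  have ba: "(\<lambda>n. real (b n) / real (a n)) \<longlonglongrightarrow> 1"
    unfolding a_def b_def by (rule filterlim_compose[OF fourth_ratio_tendsto \<kappa>(3)])
  define r where "r n = real n / real (a n)" for n
  define s where "s n = real (b n) / real n" for n
  have r: "r \<longlonglongrightarrow> 1"
  proof (rule tendsto_sandwich[OF _ _ tendsto_const ba])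
    have "1 \<le> r n" if "1 \<le> n" for n
      using a1[of n] an[OF that] by (simp add: r_def le_divide_eq)
    then show "\<forall>\<^sub>F n in sequentially. 1 \<le> r n"
      unfolding eventually_sequentially by blast
    have "r n \<le> real (b n) / real (a n)" for n
      unfolding r_def using nb[of n] by (intro divide_right_mono) auto
    then show "\<forall>\<^sub>F n in sequentially. r n \<le> real (b n) / real (a n)" by simp
  qed
  have s: "s \<longlonglongrightarrow> 1"
  proof (rule tendsto_sandwich[OF _ _ tendsto_const ba])
    have "1 \<le> s n" if "1 \<le> n" for n
      using nb[of n] that by (simp add: s_def le_divide_eq)
    then show "\<forall>\<^sub>F n in sequentially. 1 \<le> s n"
      unfolding eventually_sequentially by blast
    have "s n \<le> real (b n) / real (a n)" if "1 \<le> n" for n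
      unfolding s_def using an[OF that] a1[of n] that by (intro divide_left_mono) auto
    then show "\<forall>\<^sub>F n in sequentially. s n \<le> real (b n) / real (a n)"
      unfolding eventually_sequentially by blast
  qed
  have powr1: "(\<lambda>n. f n powr c) \<longlonglongrightarrow> 1" if "f \<longlonglongrightarrow> 1" for f and c :: real
    using tendsto_powr[OF that tendsto_const, of c] by simp
  have near: "\<exists>d>0. \<forall>x. \<bar>x - t\<bar> < d \<longrightarrow> 0 < x \<and> \<bar>Phi p x - Phi p t\<bar> < e" if e: "0 < e" for e
  proof -
    have "isCont (Phi p) t"
      using Phi_continuous_on[OF p0] t by (simp add: continuous_on_eq_continuous_at)
    then obtain d where "0 < d" "\<forall>x. \<bar>x - t\<bar> < d \<longrightarrow> \<bar>Phi p x - Phi p t\<bar> < e"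
      using e unfolding continuous_at_real_range by (auto simp: dist_real_def)
    then show ?thesis using t by (intro exI[of _ "min d t"]) (auto simp: abs_less_iff)
  qed
  show ?thesis
  proof (rule order_tendstoI)
    fix y assume "y < Phi p t"
    then obtain d where d: "0 < d" "\<And>x. \<bar>x - t\<bar> < d \<Longrightarrow> 0 < x \<and> \<bar>Phi p x - Phi p t\<bar> < Phi p t - y"
      using near[of "Phi p t - y"] by auto
    \<comment> \<open>For the lower bound \<open>q\<close> lies above \<open>t\<close>: the rescaled
      parameter tends to \<open>t\<close>, hence is eventually below \<open>q\<close>, and
      \<open>phi\<close> is nonincreasing.\<close>
    obtain q where q: "q \<in> \<rat>" "t < q" "q < t + d"
      using Rats_dense_in_real[of t "t + d"] d by auto
    have qy: "y < Phi p q" using d(2)[of q] q by (auto simp: abs_less_iff)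
    have q0: "0 \<le> q" using q t by simp
    have "(\<lambda>n. r n powr (- 1 / 2) * phi p (a n) q G) \<longlonglongrightarrow> 1 * Phi p q"
      by (intro tendsto_mult powr1 r ca q q0)
    then have "\<forall>\<^sub>F n in sequentially. y < r n powr (- 1 / 2) * phi p (a n) q G"
      using qy by (intro order_tendstoD(1)[where y = "1 * Phi p q"]) auto
    moreover have "(\<lambda>n. t * r n powr ((p - 1) / 2)) \<longlonglongrightarrow> t * 1"
      by (intro tendsto_mult tendsto_const powr1 r)
    then have "\<forall>\<^sub>F n in sequentially. t * r n powr ((p - 1) / 2) < q"
      using q by (intro order_tendstoD(2)[where y = "t * 1"]) auto
    moreover have "\<forall>\<^sub>F n in sequentially. 1 \<le> n" by (rule eventually_ge_at_top)
    ultimately show "\<forall>\<^sub>F n in sequentially. y < phi p n t G"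
    proof eventually_elim
      case (elim n)
      have "r n powr (- 1 / 2) * phi p (a n) q G \<le> r n powr (- 1 / 2) * phi p (a n) (t * r n powr ((p - 1) / 2)) G"
        using elim(2) by (intro mult_left_mono phi_antimono a1 p0) auto
      also have "\<dots> \<le> phi p n t G"
        unfolding r_def by (rule phi_scaling[OF a1 an[OF elim(3)] p0])
      finally show ?case using elim(1) by simp
    qed
  next
    fix y assume "Phi p t < y"
    then obtain d where d: "0 < d" "\<And>x. \<bar>x - t\<bar> < d \<Longrightarrow> 0 < x \<and> \<bar>Phi p x - Phi p t\<bar> < y - Phi p t"
      using near[of "y - Phi p t"] by auto
    \<comment> \<open>For the upper bound the scaling goes from \<open>n\<close> up to
      \<open>b n\<close>, so now \<open>q\<close> itself is rescaled; it lies below \<open>t\<close>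
      and stays there eventually.\<close>
    obtain q where q: "q \<in> \<rat>" "t - d < q" "q < t"
      using Rats_dense_in_real[of "t - d" t] d by auto
    have "0 < q \<and> \<bar>Phi p q - Phi p t\<bar> < y - Phi p t" using q by (intro d) (auto simp: abs_less_iff)
    then have qy: "Phi p q < y" and q0: "0 \<le> q" by (auto simp: abs_less_iff)
    have "(\<lambda>n. s n powr (1 / 2) * phi p (b n) q G) \<longlonglongrightarrow> 1 * Phi p q"
      by (intro tendsto_mult powr1 s cb q q0)
    then have "\<forall>\<^sub>F n in sequentially. s n powr (1 / 2) * phi p (b n) q G < y"
      using qy by (intro order_tendstoD(2)[where y = "1 * Phi p q"]) auto
    moreover have "(\<lambda>n. q * s n powr ((p - 1) / 2)) \<longlonglongrightarrow> q * 1"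
      by (intro tendsto_mult tendsto_const powr1 s)
    then have "\<forall>\<^sub>F n in sequentially. q * s n powr ((p - 1) / 2) < t"
      using q by (intro order_tendstoD(2)[where y = "q * 1"]) auto
    moreover have "\<forall>\<^sub>F n in sequentially. 1 \<le> n" by (rule eventually_ge_at_top)
    ultimately show "\<forall>\<^sub>F n in sequentially. phi p n t G < y"
    proof eventually_elim
      case (elim n)
      have s0: "0 < s n" using elim(3) nb[of n] by (simp add: s_def)
      have "s n powr (- 1 / 2) * phi p n t G \<le> s n powr (- 1 / 2) * phi p n (q * s n powr ((p - 1) / 2)) G"
        using elim(2,3) by (intro mult_left_mono phi_antimono p0) auto
      also have "\<dots> \<le> phi p (b n) q G"
        unfolding s_def by (rule phi_scaling[OF elim(3) nb p0])
      finally have "s n powr (1 / 2) * (s n powr (- 1 / 2) * phi p n t G) \<le> s n powr (1 / 2) * phi p (b n) q G"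
        by (intro mult_left_mono) auto
      moreover have "s n powr (1 / 2) * s n powr (- 1 / 2) = 1"
        using s0 by (simp add: powr_add[symmetric])
      ultimately show ?case using elim(1) by (simp add: mult.assoc[symmetric])
    qed
  qed
qed

text \<open>At parameter 0 the rescaling has no effect, so the bound along fourth powers transfers
  at once to all \<open>n\<close>. Consecutive fourth powers differ by a factor of at most 16, which
  costs the factor 4.\<close>

lemma phi_0_bounded:
  obtains C where "0 < C" "\<And>n. 1 \<le> n \<Longrightarrow> phi p n 0 G \<le> C"
proof -
  have p0: "0 < p" using p by simp
  obtain \<kappa> where \<kappa>: "\<And>n. 1 \<le> n \<Longrightarrow> fourth (\<kappa> n) \<le> n" "\<And>n. n < fourth (\<kappa> n + 1)"
    by (rule fourth_bracket) (rule that; assumption)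
  have "convergent (\<lambda>k. phi p (fourth k) 0 G)" using conv[of 0] by (auto simp: convergent_def)
  then obtain B where B: "0 < B" "\<And>k. norm (phi p (fourth k) 0 G) \<le> B"
    using convergent_imp_Bseq BseqE by blast
  have "phi p n 0 G \<le> 4 * B" if n: "1 \<le> n" for n
  proof -
    let ?b = "fourth (\<kappa> n + 1)"
    define s where "s = real ?b / real n"
    have nb: "n \<le> ?b" using less_imp_le[OF \<kappa>(2)] .
    have s1: "1 \<le> s" using n nb by (simp add: s_def)
    have "?b \<le> 16 * fourth (\<kappa> n)"
    proof -
      have "(\<kappa> n + 2) ^ 4 \<le> (2 * (\<kappa> n + 1)) ^ 4" by (intro power_mono) auto
      also have "\<dots> = 16 * (\<kappa> n + 1) ^ 4" by (simp only: power_mult_distrib) simp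
      finally show ?thesis by (simp only: fourth_def add.assoc one_add_one)
    qed
    also have "\<dots> \<le> 16 * n" using \<kappa>(1)[OF n] by simp
    finally have "real ?b \<le> real (16 * n)" by (rule of_nat_mono)
    then have s16: "s \<le> 16" using n by (simp add: s_def divide_le_eq)
    have "s powr (- 1 / 2) * phi p n (0 * s powr ((p - 1) / 2)) G \<le> phi p ?b 0 G"
      unfolding s_def by (rule phi_scaling[OF n nb p0])
    also have "\<dots> \<le> B" using B(2)[of "\<kappa> n + 1"] by simp
    finally have "s powr (1 / 2) * (s powr (- 1 / 2) * phi p n 0 G) \<le> s powr (1 / 2) * B"
      by (intro mult_left_mono) auto
    moreover have "s powr (1 / 2) * s powr (- 1 / 2) = 1"
      using s1 by (simp add: powr_add[symmetric])
    moreover have "s powr (1 / 2) * B \<le> 4 * B"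
    proof -
      have "s powr (1 / 2) \<le> 16 powr (1 / 2)" using s1 s16 by (intro powr_mono2) auto
      also have "16 powr (1 / 2) = (4 :: real)" by (simp add: powr_half_sqrt)
      finally show ?thesis using B(1) by (intro mult_right_mono) auto
    qed
    ultimately show ?thesis by (simp add: mult.assoc[symmetric])
  qed
  then show thesis using B(1) by (intro that[of "4 * B"]) auto
qed

end

section \<open>The supremum over all radii and its attainment in the limit\<close>

definition Lfree :: "real \<Rightarrow> real \<Rightarrow> real" where
  "Lfree p t = (SUP u\<in>{0<..}. u * Phi p (t * u powr (p / 2 - 1)))"

context
  fixes p t :: real
  assumes p: "2 < p" and t: "0 < t"
begin

text \<open>\<open>U\<close> is where the upper bound \<open>sqrt 2 - t u^(p/2-1)\<close> from
  \<open>Phi_le\<close> changes sign; beyond it the terms are at most 0.\<close>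

lemma Lfree_bdd: "bdd_above ((\<lambda>u. u * Phi p (t * u powr (p / 2 - 1))) ` {0<..})"
proof (rule bdd_aboveI2)
  fix u :: real assume u: "u \<in> {0<..}"
  define U where "U = (sqrt 2 / t) powr (1 / (p / 2 - 1))"
  have P: "Phi p (t * u powr (p / 2 - 1)) \<le> sqrt 2 - t * u powr (p / 2 - 1)"
    using t by (intro Phi_le p) auto
  show "u * Phi p (t * u powr (p / 2 - 1)) \<le> U * sqrt 2"
  proof (cases "u \<le> U")
    case True
    have "u * Phi p (t * u powr (p / 2 - 1)) \<le> u * sqrt 2"
    proof (rule mult_left_mono)
      have "0 \<le> t * u powr (p / 2 - 1)" using t by simp
      with P show "Phi p (t * u powr (p / 2 - 1)) \<le> sqrt 2" by linarith
    qed (use u in auto)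
    also have "\<dots> \<le> U * sqrt 2" using True by (intro mult_right_mono) auto
    finally show ?thesis .
  next
    case False
    have "sqrt 2 / t = U powr (p / 2 - 1)" using p t by (simp add: U_def powr_powr)
    also have "\<dots> \<le> u powr (p / 2 - 1)" using False p by (intro powr_mono2) (auto simp: U_def)
    finally have "sqrt 2 \<le> t * u powr (p / 2 - 1)" using t by (simp add: field_simps)
    with P have "Phi p (t * u powr (p / 2 - 1)) \<le> 0" by linarith
    then have "u * Phi p (t * u powr (p / 2 - 1)) \<le> 0" using u by (simp add: mult_nonneg_nonpos)
    also have "0 \<le> U * sqrt 2" by (simp add: U_def)
    finally show ?thesis .
  qed
qed

lemma Lfree_upper: "0 < u \<Longrightarrow> u * Phi p (t * u powr (p / 2 - 1)) \<le> Lfree p t"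
  unfolding Lfree_def by (rule cSUP_upper[OF _ Lfree_bdd]) auto

text \<open>As \<open>u\<close> tends to 0 the parameter of \<open>Phi\<close> decreases, so
  \<open>Phi\<close> stays above a fixed number and the terms are bounded below by a null sequence.
  This matches the value 0 of the objective at the origin.\<close>

lemma Lfree_nonneg: "0 \<le> Lfree p t"
proof -
  have "(1 / real (Suc n)) * Phi p t \<le> Lfree p t" for n
  proof -
    let ?u = "1 / real (Suc n)"
    have u: "0 < ?u" "?u \<le> 1" by simp_all
    have "?u powr (p / 2 - 1) \<le> 1 powr (p / 2 - 1)"
      using p by (intro powr_mono2) auto
    then have "t * ?u powr (p / 2 - 1) \<le> t"
      using t mult_left_mono[of "?u powr (p / 2 - 1)" 1 t] by simp
    then have "Phi p t \<le> Phi p (t * ?u powr (p / 2 - 1))"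
      using p t by (intro Phi_antimono) auto
    then have "?u * Phi p t \<le> ?u * Phi p (t * ?u powr (p / 2 - 1))"
      by (intro mult_left_mono) auto
    also have "\<dots> \<le> Lfree p t" by (rule Lfree_upper[OF u(1)])
    finally show ?thesis .
  qed
  moreover have "(\<lambda>n. (1 / real (Suc n)) * Phi p t) \<longlonglongrightarrow> 0 * Phi p t"
    by (intro tendsto_mult LIMSEQ_Suc[OF lim_1_over_n] tendsto_const)
  ultimately show ?thesis by (intro LIMSEQ_le_const2[of _ 0]) auto
qed

text \<open>A supremum of extended reals cannot hide unboundedness; the equality therefore also
  records that the real supremum is finite.\<close>

lemma ereal_Lfree:
  "ereal (Lfree p t) = (SUP u\<in>{0<..}. ereal (u * Phi p (t * u powr (p / 2 - 1))))"
proof (rule antisym)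
  let ?f = "\<lambda>u. u * Phi p (t * u powr (p / 2 - 1))"
  show "(SUP u\<in>{0<..}. ereal (?f u)) \<le> ereal (Lfree p t)"
    using Lfree_upper by (intro SUP_least) auto
  show "ereal (Lfree p t) \<le> (SUP u\<in>{0<..}. ereal (?f u))"
  proof (rule ereal_le_real)
    fix z assume z: "(SUP u\<in>{0<..}. ereal (?f u)) \<le> ereal z"
    have "Lfree p t \<le> z" unfolding Lfree_def
    proof (rule cSUP_least)
      fix u :: real assume "u \<in> {0<..}"
      then have "ereal (?f u) \<le> ereal z" using z by (rule order_trans[OF SUP_upper])
      then show "?f u \<le> z" by simp
    qed (auto intro: exI[of _ 1])
    then show "ereal (Lfree p t) \<le> ereal z" by simp
  qed
qed

text \<open>The lower bound needs a single near-optimal \<open>u\<close>. The upper bound must be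
  uniform in \<open>u\<close>, whereas only pointwise convergence is known: decay confines
  \<open>u\<close> to an interval up to \<open>U\<close>, and monotonicity of \<open>phi\<close>
  reduces that interval to a finite grid.\<close>

lemma L_max_tendsto_Lfree:
  assumes conv: "\<And>s. 0 < s \<Longrightarrow> (\<lambda>n. phi p n s G) \<longlonglongrightarrow> Phi p s"
    and C: "0 < C" "\<And>n. 1 \<le> n \<Longrightarrow> phi p n 0 G \<le> C"
  shows "(\<lambda>n. L_max (array G) n p t) \<longlonglongrightarrow> Lfree p t"
proof (rule order_tendstoI)
  define \<alpha> where "\<alpha> = p / 2 - 1"
  have \<alpha>: "0 < \<alpha>" using p by (simp add: \<alpha>_def)
  have p0: "0 < p" using p by simp
  fix y
  {
    assume y: "y < Lfree p t"
    have "\<exists>u\<in>{0<..}. y < u * Phi p (t * u powr \<alpha>)"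
      using y less_cSUP_iff[OF _ Lfree_bdd, of y] unfolding Lfree_def \<alpha>_def by auto
    then obtain u where u: "0 < u" "y < u * Phi p (t * u powr \<alpha>)" by auto
    have "(\<lambda>n. u * phi p n (t * u powr \<alpha>) G) \<longlonglongrightarrow> u * Phi p (t * u powr \<alpha>)"
      using u t by (intro tendsto_mult tendsto_const conv) auto
    then have "\<forall>\<^sub>F n in sequentially. y < u * phi p n (t * u powr \<alpha>) G"
      by (rule order_tendstoD(1)) (rule u)
    moreover have "\<forall>\<^sub>F n in sequentially. 1 \<le> n" by (rule eventually_ge_at_top)
    ultimately show "\<forall>\<^sub>F n in sequentially. y < L_max (array G) n p t"
      by eventually_elim (use L_max_ge[OF _ p t u(1), of _ G] in \<open>auto simp: \<alpha>_def intro: less_le_trans\<close>)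
  next
    assume y: "Lfree p t < y"
    define e where "e = (y - Lfree p t) / 3"
    have e: "0 < e" "Lfree p t + 2 * e < y" using y by (auto simp: e_def field_simps)
    define U where "U = (C / t) powr (1 / \<alpha>)"
    \<comment> \<open>The mesh is chosen so that passing to the grid point below \<open>u\<close>
      costs at most \<open>h * C = e\<close>. Convergence at the grid points costs a second
      \<open>e\<close>; a third of the gap remains.\<close>
    define h where "h = e / C"
    have h: "0 < h" "h * C = e" using e C by (auto simp: h_def)
    define J where "J = nat \<lceil>U / h\<rceil>"
    have "\<forall>\<^sub>F n in sequentially. \<forall>j\<in>{1..J}. (real j * h) * phi p n (t * (real j * h) powr \<alpha>) G < Lfree p t + e"
    proof (rule eventually_ball_finite)
      show "\<forall>j\<in>{1..J}. \<forall>\<^sub>F n in sequentially. (real j * h) * phi p n (t * (real j * h) powr \<alpha>) G < Lfree p t + e"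
      proof
        fix j assume "j \<in> {1..J}"
        then have v: "0 < real j * h" using h by simp
        have "0 < t * (real j * h) powr \<alpha>"
          by (rule mult_pos_pos[OF t]) (use v in \<open>simp only: powr_gt_zero less_imp_neq[OF v, symmetric] simp_thms\<close>)
        then have "(\<lambda>n. (real j * h) * phi p n (t * (real j * h) powr \<alpha>) G) \<longlonglongrightarrow> (real j * h) * Phi p (t * (real j * h) powr \<alpha>)"
          by (intro tendsto_mult tendsto_const conv)
        moreover have "(real j * h) * Phi p (t * (real j * h) powr \<alpha>) < Lfree p t + e"
          using Lfree_upper[OF v] e(1) unfolding \<alpha>_def by linarith
        ultimately show "\<forall>\<^sub>F n in sequentially. (real j * h) * phi p n (t * (real j * h) powr \<alpha>) G < Lfree p t + e"
          by (rule order_tendstoD(2))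
      qed
    qed simp
    moreover have "\<forall>\<^sub>F n in sequentially. 1 \<le> n" by (rule eventually_ge_at_top)
    ultimately show "\<forall>\<^sub>F n in sequentially. L_max (array G) n p t < y"
    proof eventually_elim
      case (elim n)
      note n = elim(2)
      have "u * phi p n (t * u powr \<alpha>) G \<le> Lfree p t + 2 * e" if u: "0 < u" for u
      proof (cases "phi p n (t * u powr \<alpha>) G \<le> 0")
        case True
        then have "u * phi p n (t * u powr \<alpha>) G \<le> 0" using u by (simp add: mult_nonneg_nonpos)
        then show ?thesis using Lfree_nonneg e by linarith
      next
        case False
        have "phi p n (t * u powr \<alpha>) G \<le> phi p n 0 G - t * u powr \<alpha>"
          using t by (intro phi_decay n p) auto
        with False C(2)[OF n] have "t * u powr \<alpha> \<le> C" by linarith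
        then have "u powr \<alpha> \<le> C / t" using t by (simp add: field_simps)
        then have "(u powr \<alpha>) powr (1 / \<alpha>) \<le> U"
          unfolding U_def using \<alpha> by (intro powr_mono2) auto
        then have uU: "u \<le> U" using u \<alpha> by (simp add: powr_powr)
        define j where "j = nat \<lfloor>u / h\<rfloor>"
        have uh: "0 \<le> u / h" using u h by simp
        have j1: "real j \<le> u / h" "u / h < real j + 1" using uh unfolding j_def by linarith+
        have ju: "real j * h \<le> u" "u < real j * h + h"
          using j1 h by (simp_all add: field_simps)
        have "u / h \<le> U / h" using uU h by (intro divide_right_mono) auto
        then have jJ: "j \<le> J" using uh unfolding j_def J_def by linarith
        define F where "F = phi p n (t * (real j * h) powr \<alpha>) G"
        have "t * (real j * h) powr \<alpha> \<le> t * u powr \<alpha>"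
          using ju h t \<alpha> by (intro mult_left_mono powr_mono2) auto
        then have "phi p n (t * u powr \<alpha>) G \<le> F"
          unfolding F_def by (intro phi_antimono n p0)
        with False have F: "0 \<le> F" "u * phi p n (t * u powr \<alpha>) G \<le> u * F"
          using u by (auto intro: mult_left_mono)
        have "F \<le> phi p n 0 G" unfolding F_def using t by (intro phi_antimono n p0) auto
        then have FC: "F \<le> C" using C(2)[OF n] by simp
        have "u * F \<le> (real j * h + h) * F" using ju F by (intro mult_right_mono) auto
        also have "\<dots> \<le> (real j * h) * F + h * C"
          using mult_left_mono[OF FC, of h] h(1) by (simp add: distrib_right)
        also have "(real j * h) * F \<le> Lfree p t + e"
        proof (cases "j = 0")
          \<comment> \<open>For \<open>u\<close> below the mesh the grid point is 0, where the main
            term vanishes and no convergence is available; \<open>Lfree_nonneg\<close> covers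
            it.\<close>
          case True
          then show ?thesis using Lfree_nonneg e by simp
        next
          case False
          then show ?thesis using elim(1) jJ unfolding F_def by (auto intro: less_imp_le)
        qed
        finally show ?thesis using F(2) h(2) by linarith
      qed
      then have "L_max (array G) n p t \<le> Lfree p t + 2 * e"
        using L_max_cases[OF n p t, of G] Lfree_nonneg e(1) unfolding \<alpha>_def by force
      then show ?case using e(2) by linarith
    qed
  }
qed

end

section \<open>Transfer to the given probability space\<close>

lemma array_law:
  fixes M :: "'a measure" and g :: "nat \<Rightarrow> nat \<Rightarrow> 'a \<Rightarrow> real"
  assumes M: "prob_space M" and g: "iid_std_gaussian_array M g" and n: "1 \<le> n"
  shows "(\<lambda>\<omega>. \<lambda>k\<in>idx n. g (fst k) (snd k) \<omega>) \<in> measurable M (PiM (idx n) (\<lambda>_. borel))"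
    and "distr M (PiM (idx n) (\<lambda>_. borel)) (\<lambda>\<omega>. \<lambda>k\<in>idx n. g (fst k) (snd k) \<omega>) = gauss (idx n)"
proof -
  interpret prob_space M by (rule M)
  let ?X = "\<lambda>k \<omega>. g (fst k) (snd k) \<omega>"
  have D: "distributed M lborel (g i j) std_normal_density" if "1 \<le> i" "1 \<le> j" for i j
    using g that unfolding iid_std_gaussian_array_def by auto
  have rv: "?X k \<in> borel_measurable M" if "k \<in> idx n" for k
    using distributed_measurable[OF D[of "fst k" "snd k"]] that by (simp add: idx_def mem_Times_iff)
  then show "(\<lambda>\<omega>. \<lambda>k\<in>idx n. g (fst k) (snd k) \<omega>) \<in> measurable M (PiM (idx n) (\<lambda>_. borel))"
    by (intro measurable_restrict)
  have "indep_vars (\<lambda>_. borel) (\<lambda>(i, j). g i j) ({1..} \<times> {1..})"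
    using g unfolding iid_std_gaussian_array_def by blast
  then have "indep_vars (\<lambda>_. borel) ?X ({1..} \<times> {1..})"
    by (simp add: case_prod_unfold)
  then have ind: "indep_vars (\<lambda>_. borel) ?X (idx n)"
    by (rule indep_vars_subset) (auto simp: idx_def)
  have "idx n \<noteq> {}" using n by (auto simp: idx_def)
  from indep_vars_iff_distr_eq_PiM'[OF this rv] ind
  have "distr M (PiM (idx n) (\<lambda>_. borel)) (\<lambda>\<omega>. \<lambda>k\<in>idx n. ?X k \<omega>) = PiM (idx n) (\<lambda>k. distr M borel (?X k))"
    by simp
  also have "\<dots> = gauss (idx n)"
    unfolding gauss_def
  proof (rule PiM_cong[OF refl])
    fix k assume k: "k \<in> idx n"
    have "distr M borel (?X k) = distr M lborel (?X k)" by (intro distr_cong) auto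
    also have "\<dots> = stdN"
      using distributed_distr_eq_density[OF D[of "fst k" "snd k"]] k by (simp add: idx_def mem_Times_iff)
    finally show "distr M borel (?X k) = stdN" .
  qed
  finally show "distr M (PiM (idx n) (\<lambda>_. borel)) (\<lambda>\<omega>. \<lambda>k\<in>idx n. g (fst k) (snd k) \<omega>) = gauss (idx n)" .
qed

lemma array_integral:
  fixes M :: "'a measure" and g :: "nat \<Rightarrow> nat \<Rightarrow> 'a \<Rightarrow> real"
  assumes M: "prob_space M" and g: "iid_std_gaussian_array M g" and n: "1 \<le> n" and p: "0 < p"
  shows "integrable M (\<lambda>\<omega>. phi p n t (\<lambda>k. g (fst k) (snd k) \<omega>))"
    and "(\<integral>\<omega>. phi p n t (\<lambda>k. g (fst k) (snd k) \<omega>) \<partial>M) = Ephi p n t"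
    and "(\<integral>\<omega>. \<bar>phi p n t (\<lambda>k. g (fst k) (snd k) \<omega>) - Ephi p n t\<bar> \<partial>M) \<le> 2 / sqrt (real n)"
proof -
  note law = array_law[OF M g n]
  note mp = measurable_phi[OF n p, of t]
  let ?X = "\<lambda>\<omega>. \<lambda>k\<in>idx n. g (fst k) (snd k) \<omega>"
  have e: "phi p n t (\<lambda>k. g (fst k) (snd k) \<omega>) = phi p n t (?X \<omega>)" for \<omega>
    using phi_restrict[OF p, of n t "\<lambda>k. g (fst k) (snd k) \<omega>"] by simp
  show "integrable M (\<lambda>\<omega>. phi p n t (\<lambda>k. g (fst k) (snd k) \<omega>))"
    unfolding e using integrable_distr_eq[OF law(1) mp] integrable_phi[OF n p, of t] unfolding law(2) by simp
  show "(\<integral>\<omega>. phi p n t (\<lambda>k. g (fst k) (snd k) \<omega>) \<partial>M) = Ephi p n t"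
    unfolding e Ephi_def using integral_distr[OF law(1) mp] unfolding law(2) by simp
  have m: "(\<lambda>G. \<bar>phi p n t G - Ephi p n t\<bar>) \<in> borel_measurable (PiM (idx n) (\<lambda>_. borel))"
    by (intro borel_measurable_abs borel_measurable_diff mp borel_measurable_const)
  show "(\<integral>\<omega>. \<bar>phi p n t (\<lambda>k. g (fst k) (snd k) \<omega>) - Ephi p n t\<bar> \<partial>M) \<le> 2 / sqrt (real n)"
    unfolding e using integral_distr[OF law(1) m] phi_concentration[OF n p, of t] unfolding law(2) by simp
qed

text \<open>The mean deviations along fourth powers have a finite sum, so the series of deviations
  is almost surely finite and its terms tend to 0.\<close>

lemma AE_phi_fourth:
  fixes M :: "'a measure" and g :: "nat \<Rightarrow> nat \<Rightarrow> 'a \<Rightarrow> real"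
  assumes M: "prob_space M" and g: "iid_std_gaussian_array M g" and p: "0 < p" and t: "0 \<le> t"
  shows "AE \<omega> in M. (\<lambda>k. phi p (fourth k) t (\<lambda>k. g (fst k) (snd k) \<omega>)) \<longlonglongrightarrow> Phi p t"
proof -
  interpret prob_space M by (rule M)
  define f where "f k \<omega> = \<bar>phi p (fourth k) t (\<lambda>k. g (fst k) (snd k) \<omega>) - Ephi p (fourth k) t\<bar>" for k \<omega>
  have f1: "1 \<le> fourth k" for k by (simp add: fourth_def)
  note ai = array_integral[OF M g f1 p, of _ t]
  have fi: "integrable M (f k)" for k
    unfolding f_def by (intro integrable_abs Bochner_Integration.integrable_diff ai(1) integrable_const)
  have mf: "(\<lambda>\<omega>. ennreal (f k \<omega>)) \<in> borel_measurable M" for k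
    using borel_measurable_integrable[OF fi] by (rule measurable_compose) simp
  have "(\<integral>\<^sup>+\<omega>. (\<Sum>k. ennreal (f k \<omega>)) \<partial>M) = (\<Sum>k. \<integral>\<^sup>+\<omega>. ennreal (f k \<omega>) \<partial>M)"
    by (rule nn_integral_suminf[OF mf])
  also have "\<dots> \<le> (\<Sum>k. ennreal (2 * inverse (real (Suc k) ^ 2)))"
  proof (rule suminf_le)
    fix k
    have "sqrt (real (fourth k)) = real (Suc k) ^ 2"
      by (rule real_sqrt_unique) (simp_all add: fourth_def power_mult[symmetric])
    then have "(\<integral>\<omega>. f k \<omega> \<partial>M) \<le> 2 * inverse (real (Suc k) ^ 2)"
      using ai(3)[of k] unfolding f_def by (simp add: divide_inverse)
    moreover have "(\<integral>\<^sup>+\<omega>. ennreal (f k \<omega>) \<partial>M) = ennreal (\<integral>\<omega>. f k \<omega> \<partial>M)"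
      by (rule nn_integral_eq_integral[OF fi]) (simp add: f_def)
    ultimately show "(\<integral>\<^sup>+\<omega>. ennreal (f k \<omega>) \<partial>M) \<le> ennreal (2 * inverse (real (Suc k) ^ 2))"
      by (simp add: ennreal_leI)
  qed auto
  also have "\<dots> < \<infinity>"
  proof -
    have "summable (\<lambda>k. inverse (real k ^ 2))"
      using inverse_power_summable[of 2, where 'a = real] by simp
    then have "summable (\<lambda>k. 2 * inverse (real (Suc k) ^ 2))"
      by (intro summable_mult) (subst summable_Suc_iff)
    then have "(\<Sum>k. ennreal (2 * inverse (real (Suc k) ^ 2))) = ennreal (\<Sum>k. 2 * inverse (real (Suc k) ^ 2))"
      by (intro suminf_ennreal2) auto
    then show ?thesis by simp
  qed
  finally have "(\<integral>\<^sup>+\<omega>. (\<Sum>k. ennreal (f k \<omega>)) \<partial>M) \<noteq> \<infinity>" by simp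
  then have "AE \<omega> in M. (\<Sum>k. ennreal (f k \<omega>)) \<noteq> \<infinity>"
    by (intro nn_integral_PInf_AE borel_measurable_suminf_order mf) auto
  then show ?thesis
  proof eventually_elim
    case (elim \<omega>)
    then have "summable (\<lambda>k. f k \<omega>)"
      by (intro summable_suminf_not_top) (auto simp: f_def)
    then have "(\<lambda>k. f k \<omega>) \<longlonglongrightarrow> 0" by (rule summable_LIMSEQ_zero)
    then have z: "(\<lambda>k. phi p (fourth k) t (\<lambda>k. g (fst k) (snd k) \<omega>) - Ephi p (fourth k) t) \<longlonglongrightarrow> 0"
      unfolding f_def by (rule tendsto_rabs_zero_cancel)
    have "filterlim fourth at_top sequentially"
      by (rule filterlim_subseq) (auto simp: strict_mono_def fourth_def intro!: power_strict_mono)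
    then have "(\<lambda>k. Ephi p (fourth k) t) \<longlonglongrightarrow> Phi p t"
      by (rule filterlim_compose[OF Ephi_tendsto[OF p t]])
    from tendsto_add[OF z this] show ?case by simp
  qed
qed

theorem theorem1p5:
  fixes M :: "'a measure" and g :: "nat \<Rightarrow> nat \<Rightarrow> 'a \<Rightarrow> real" and p :: real
  assumes "prob_space M"
    and "iid_std_gaussian_array M g"
    and "2 < p"
  shows "\<exists>(Lu :: real \<Rightarrow> real \<Rightarrow> real) (L :: real \<Rightarrow> real).
    (AE \<omega> in M.
      (\<forall>u>0. \<forall>t>0. (\<lambda>n. L_max_sphere (\<lambda>i j. g i j \<omega>) n p u t) \<longlonglongrightarrow> Lu u t) \<and>
      (\<forall>t>0. (\<lambda>n. L_max (\<lambda>i j. g i j \<omega>) n p t) \<longlonglongrightarrow> L t)) \<and>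
    (\<forall>u>0. \<forall>t>0.
      (\<lambda>n. \<integral>\<omega>. L_max_sphere (\<lambda>i j. g i j \<omega>) n p u t \<partial>M) \<longlonglongrightarrow> Lu u t) \<and>
    (\<forall>t>0. ereal (L t) = (SUP u\<in>{0<..}. ereal (Lu u t)))"
proof -
  have p: "2 < p" and p0: "0 < p" using assms(3) by auto
  \<comment> \<open>The scaling identity \<open>L_max_sphere_eq\<close> passed to the limit. The
    limit functions are deterministic and fixed before the random event.\<close>
  define Lu where "Lu u t = u * Phi p (t * u powr (p / 2 - 1))" for u t
  define G where "G \<omega> = (\<lambda>k. g (fst k) (snd k) \<omega>)" for \<omega>
  have arr: "array (G \<omega>) = (\<lambda>i j. g i j \<omega>)" for \<omega> by (simp add: G_def)
  have Lu_eq: "L_max_sphere (\<lambda>i j. g i j \<omega>) n p u t = u * phi p n (t * u powr (p / 2 - 1)) (G \<omega>)"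
    if "1 \<le> n" "0 < u" for n u t \<omega>
    using L_max_sphere_eq[OF that(1) p0 that(2), of "G \<omega>" t] unfolding arr .
  have "AE \<omega> in M. \<forall>q\<in>{q \<in> \<rat>. 0 \<le> q}. (\<lambda>k. phi p (fourth k) q (G \<omega>)) \<longlonglongrightarrow> Phi p q"
    unfolding G_def using AE_phi_fourth[OF assms(1,2) p0]
    by (subst AE_ball_countable) (auto intro: countable_subset[OF _ countable_rat])
  then have "AE \<omega> in M. (\<forall>u>0. \<forall>t>0. (\<lambda>n. L_max_sphere (\<lambda>i j. g i j \<omega>) n p u t) \<longlonglongrightarrow> Lu u t) \<and>
      (\<forall>t>0. (\<lambda>n. L_max (\<lambda>i j. g i j \<omega>) n p t) \<longlonglongrightarrow> Lfree p t)"
  proof eventually_elim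
    case (elim \<omega>)
    then have c: "\<And>q. q \<in> \<rat> \<Longrightarrow> 0 \<le> q \<Longrightarrow> (\<lambda>k. phi p (fourth k) q (G \<omega>)) \<longlonglongrightarrow> Phi p q" by blast
    note conv = phi_tendsto_Phi[OF p c]
    obtain C where C: "0 < C" "\<And>n. 1 \<le> n \<Longrightarrow> phi p n 0 (G \<omega>) \<le> C"
      by (rule phi_0_bounded[OF p c], assumption+, rule that, assumption+)
    show ?case
    proof (intro conjI allI impI)
      fix u t :: real assume u: "0 < u" and t: "0 < t"
      have "(\<lambda>n. u * phi p n (t * u powr (p / 2 - 1)) (G \<omega>)) \<longlonglongrightarrow> Lu u t"
        unfolding Lu_def using u t by (intro tendsto_mult tendsto_const conv) auto
      \<comment> \<open>\<open>Lu_eq\<close> is available from \<open>n = 1\<close> on, which is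
        enough for the limit.\<close>
      then show "(\<lambda>n. L_max_sphere (\<lambda>i j. g i j \<omega>) n p u t) \<longlonglongrightarrow> Lu u t"
        by (rule Lim_transform_eventually)
          (use Lu_eq[OF _ u] in \<open>auto simp: eventually_sequentially intro!: exI[of _ 1]\<close>)
    next
      fix t :: real assume t: "0 < t"
      show "(\<lambda>n. L_max (\<lambda>i j. g i j \<omega>) n p t) \<longlonglongrightarrow> Lfree p t"
        using L_max_tendsto_Lfree[OF p t conv C] unfolding arr .
    qed
  qed
  moreover have "(\<lambda>n. \<integral>\<omega>. L_max_sphere (\<lambda>i j. g i j \<omega>) n p u t \<partial>M) \<longlonglongrightarrow> Lu u t" if u: "0 < u" and t: "0 < t" for u t
  proof -
    have "(\<lambda>n. u * Ephi p n (t * u powr (p / 2 - 1))) \<longlonglongrightarrow> Lu u t"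
      unfolding Lu_def using t by (intro tendsto_mult tendsto_const Ephi_tendsto p0) auto
    moreover have "u * Ephi p n (t * u powr (p / 2 - 1)) = (\<integral>\<omega>. L_max_sphere (\<lambda>i j. g i j \<omega>) n p u t \<partial>M)" if "1 \<le> n" for n
      unfolding Lu_eq[OF that u] integral_mult_right_zero G_def array_integral(2)[OF assms(1,2) that p0] ..
    then have "\<forall>\<^sub>F n in sequentially. u * Ephi p n (t * u powr (p / 2 - 1)) = (\<integral>\<omega>. L_max_sphere (\<lambda>i j. g i j \<omega>) n p u t \<partial>M)"
      unfolding eventually_sequentially by blast
    ultimately show ?thesis
      by (rule Lim_transform_eventually)
  qed
  moreover have "ereal (Lfree p t) = (SUP u\<in>{0<..}. ereal (Lu u t))" if "0 < t" for t
    unfolding Lu_def by (rule ereal_Lfree[OF p that])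
  ultimately show ?thesis by blast
qed

end
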